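(* Let $f:\mathbb{T}\to\mathbb{R}$ be a monotonic function which is $C^1$ on $(0,1)$. Assume that: (i) on the torus $\mathbb{T}$, $x=0$ is a jump discontinuity point of $f$; (ii) $f$ is right-continuous at $0$, i.e. $f(0)=\lim_{x\to0^+}f(x)$; (iii) the right derivative $f'_+(0)$ exists and is finite; (iv) $\inf_{x\in(0,1)}|f'(x)|\ge c>0$; (v) $\|f\|_{C^1(0,1)}<C$; where $c$ and $C$ are positive constants depending on $f$. Then there exists a constant $\lambda_0=\lambda_0(f)>0$ such that for all $\lambda>\lambda_0$ and almost every $x\in\mathbb{T}$, the operator $H(x)$ on $\ell^2(\mathbb{N})$ defined by $$(H(x)u)_n=u_{n+1}+u_{n-1}+\lambda f(T^nx)u_n,\quad n\ge0,\qquad u_{-1}=0,$$ exhibits Anderson localization.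
   Context: $\mathbb{T}=\mathbb{R}/\mathbb{Z}$ with Lebesgue measure, identified with $[0,1)$ for the purpose of monotonicity; $\mathbb{N}=\{0,1,2,\dots\}$; $T:\mathbb{T}\to\mathbb{T}$, $Tx=2x\bmod 1$, is the doubling map. An operator exhibits Anderson localization if it has pure point spectrum and all its eigenfunctions decay exponentially at infinity. *)

theory Defs
  imports "HOL-Analysis.Analysis"
begin

text \<open>
  Functions on the torus \<open>\<real>/\<int>\<close> are represented by 1-periodic functions on \<open>\<real>\<close>, and its points by
  their representatives in \<open>[0,1)\<close>.
\<close>

definition doubling_map :: "real \<Rightarrow> real" where
  "doubling_map x = frac (2 * x)"

definition jump_discontinuity :: "(real \<Rightarrow> real) \<Rightarrow> real \<Rightarrow> bool" where
  "jump_discontinuity f a \<longleftrightarrow>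
     (\<exists>l r. (f \<longlongrightarrow> l) (at_left a) \<and> (f \<longlongrightarrow> r) (at_right a) \<and> l \<noteq> r)"

text \<open>Extended-real valued, so that an unbounded \<open>f\<close> or \<open>f'\<close> gives the value \<open>\<infinity>\<close>.\<close>

definition C1_norm :: "real set \<Rightarrow> (real \<Rightarrow> real) \<Rightarrow> ereal" where
  "C1_norm S f = (SUP x\<in>S. ereal \<bar>f x\<bar>) + (SUP x\<in>S. ereal \<bar>deriv f x\<bar>)"

definition ell2 :: "(nat \<Rightarrow> complex) set" where
  "ell2 = {u. summable (\<lambda>n. (cmod (u n))\<^sup>2)}"

definition ell2_norm :: "(nat \<Rightarrow> complex) \<Rightarrow> real" where
  "ell2_norm u = sqrt (\<Sum>n. (cmod (u n))\<^sup>2)"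

definition eigenfunction :: "((nat \<Rightarrow> complex) \<Rightarrow> (nat \<Rightarrow> complex)) \<Rightarrow> (nat \<Rightarrow> complex) \<Rightarrow> bool" where
  "eigenfunction A u \<longleftrightarrow>
     u \<in> ell2 \<and> (\<exists>n. u n \<noteq> 0) \<and> (\<exists>E::complex. \<forall>n. A u n = E * u n)"

text \<open>
  Pure point spectrum of a self-adjoint operator on \<open>\<ell>\<^sup>2(\<nat>)\<close>: the pure point subspace, which is the
  closed complex-linear span of the eigenfunctions, is the whole space.
\<close>

definition pure_point_spectrum :: "((nat \<Rightarrow> complex) \<Rightarrow> (nat \<Rightarrow> complex)) \<Rightarrow> bool" where
  "pure_point_spectrum A \<longleftrightarrow>
     (\<forall>v\<in>ell2. \<forall>\<epsilon>>0. \<exists>B a. finite B \<and> (\<forall>u\<in>B. eigenfunction A u) \<and>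
        ell2_norm (\<lambda>n. v n - (\<Sum>u\<in>B. a u * u n)) < \<epsilon>)"

definition exponentially_decaying :: "(nat \<Rightarrow> complex) \<Rightarrow> bool" where
  "exponentially_decaying u \<longleftrightarrow>
     (\<exists>K>0. \<exists>\<alpha>>0. \<forall>n. cmod (u n) \<le> K * exp (- \<alpha> * real n))"

definition anderson_localization :: "((nat \<Rightarrow> complex) \<Rightarrow> (nat \<Rightarrow> complex)) \<Rightarrow> bool" where
  "anderson_localization A \<longleftrightarrow>
     pure_point_spectrum A \<and> (\<forall>u. eigenfunction A u \<longrightarrow> exponentially_decaying u)"

definition doubling_schroedinger ::
    "(real \<Rightarrow> real) \<Rightarrow> real \<Rightarrow> real \<Rightarrow> (nat \<Rightarrow> complex) \<Rightarrow> (nat \<Rightarrow> complex)" where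
  "doubling_schroedinger f lam x u = (\<lambda>n.
     u (n + 1) + (if n = 0 then 0 else u (n - 1)) + of_real (lam * f ((doubling_map ^^ n) x)) * u n)"

end

theory Submission
  imports
    Defs
    "HOL-Computational_Algebra.Computational_Algebra"
    "HOL-Real_Asymp.Real_Asymp"
    "Jordan_Normal_Form.Determinant"
begin

text \<open>
  For a phase \<open>x\<close> and a real energy \<open>E\<close> consider the solution \<open>u\<close> of \<open>H(x) u = E u\<close> with \<open>u (- 1) = 0\<close> and
  \<open>u 0 = 1\<close>. As a function of \<open>E\<close> its \<open>n\<close>-th value is the characteristic polynomial of the box of the first
  \<open>n\<close> sites. Anderson localization follows once every solution with a linear bound decays exponentially,
  uniformly in the energy (\<open>localization_criterion\<close>): by Gauss quadrature on long boxes most of the spectral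
  mass sits near energies with linearly bounded solutions, and by uniform decay these energies have
  eigenfunctions that approximate the eigenvectors of the boxes. The rest of the proof provides the decay.

  On \<open>[0, 1)\<close> the function \<open>f\<close> is steep, \<open>\<bar>f x - f y\<bar> \<ge> c * \<bar>x - y\<bar>\<close>, so the potential depends strongly
  on the binary digits of the phase. Build a box up from right to left. Given all sites to the right, the
  next site has two possible potentials, according to one binary digit, and they differ by at least
  \<open>lam * c / 2\<close>; hence at most one of them can destroy the growth of the solution. Moreover only a small fraction of digit blocks
  makes a site resonant at all, in the sense that \<open>lam * f\<close> comes close to \<open>E\<close> there. A Lyapunov
  function with a penalty for resonant sites (\<open>penalized\<close>), whose exponent \<open>\<kappa>\<close> is adapted to \<open>lam\<close>, turns this
  into a bound at fixed energy: with exponentially small exceptional probability the solution on a box of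
  \<open>100 * k\<close> sites, or on the box without its first site, has size at least \<open>lam ^ (60 * k)\<close>
  (\<open>large_deviation\<close>). For large \<open>lam\<close> this beats the square root of the trivial upper bound, of order
  \<open>lam ^ (100 * k)\<close>, so Green's formula makes every linearly bounded solution exponentially small at the centre
  of such a box.

  The energy of a linearly bounded solution depends on the phase, so the fixed-energy bound does not apply
  to it directly. By Fubini's theorem and Boole's inequality, for almost every phase the set of energies at
  which the solution on a long initial box is small has exponentially small measure
  (\<open>AE_low_energies_small\<close>). It is a sublevel set of a polynomial, so it has few components. All energies in
  question are therefore exponentially close to a short list of candidates (\<open>energy_near_candidate\<close>), and the
  list can be read off from an initial segment of binary digits. Windows further to the right depend on later,
  independent digits. So by the fixed-energy bound and the Borel-Cantelli lemma the candidates are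
  typical for all these windows (\<open>AE_no_resonant_window\<close>), and solutions with a linear bound are
  exponentially small at their centres, which cover all distant sites.
\<close>

section \<open>Continuants\<close>

text \<open>
  The continuant is the determinant of the tridiagonal matrix with diagonal \<open>e 0, \<dots>, e (n - 1)\<close> and
  all products of opposite off-diagonal entries equal to \<open>1\<close>. With \<open>e k = E - V k\<close> it is at the same time
  the characteristic polynomial of a box of a discrete Schroedinger operator and the solution of the
  eigenvalue equation with Dirichlet condition at the left end; the whole proof moves between these two
  readings.
\<close>

fun continuant :: "(nat \<Rightarrow> 'a::comm_ring_1) \<Rightarrow> nat \<Rightarrow> 'a" where
  "continuant e 0 = 1"
| "continuant e (Suc 0) = e 0"
| "continuant e (Suc (Suc n)) = e (Suc n) * continuant e (Suc n) - continuant e n"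

definition shift :: "(nat \<Rightarrow> 'a) \<Rightarrow> nat \<Rightarrow> 'a" where
  "shift e = (\<lambda>k. e (Suc k))"

text \<open>
  The determinant can also be expanded along its first row. The definition extends a box to the right,
  this recursion extends it to the left. It is adapted to the doubling map, where one more site on the
  left means one more binary digit in front.
\<close>

lemma continuant_first:
  "continuant e (Suc (Suc n)) = e 0 * continuant (shift e) (Suc n) - continuant (shift (shift e)) n"
proof (induction n rule: induct_nat_012)
  case 0
  show ?case by (simp add: shift_def)
next
  case 1
  show ?case by (simp add: shift_def algebra_simps)
next
  case (ge2 n)
  have "continuant e (Suc (Suc (Suc (Suc n)))) =
    e (Suc (Suc (Suc n))) * continuant e (Suc (Suc (Suc n))) - continuant e (Suc (Suc n))"
    by (rule continuant.simps(3))
  then show ?case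
    unfolding ge2 by (simp add: shift_def algebra_simps)
qed

lemma of_real_continuant:
  "of_real (continuant e n) = continuant (\<lambda>k. of_real (e k) :: 'a::{real_algebra_1,comm_ring_1}) n"
  by (induction n rule: induct_nat_012) auto

lemma cnj_continuant: "cnj (continuant e n) = continuant (\<lambda>k. cnj (e k)) n"
  by (induction n rule: induct_nat_012) auto

lemma recurrence_solution_eq_continuant:
  fixes u :: "nat \<Rightarrow> 'a::comm_ring_1"
  assumes "u 1 = e 0 * u 0" "\<And>n. u (Suc (Suc n)) = e (Suc n) * u (Suc n) - u n"
  shows "u n = u 0 * continuant e n"
proof (induction n rule: induct_nat_012)
  case 1
  then show ?case using assms(1) by (simp add: mult.commute)
next
  case (ge2 n)
  show ?case
    unfolding assms(2)[of n] ge2 by (simp add: algebra_simps)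
qed simp

text \<open>
  Green's formula for the box of sites \<open>1, \<dots>, h + d + 1\<close>: inside a box a solution is determined by its
  two exterior boundary values, with coefficients that are quotients of continuants. A solution is
  therefore small inside a box whose own continuant is much larger than those of the two parts.
  Both sides obey the same recursion in \<open>d\<close>, and \<open>d = 0\<close> is the constancy of the Wronskian.
\<close>

lemma window_identity:
  fixes u :: "nat \<Rightarrow> 'a::comm_ring_1"
  assumes u: "\<And>k. u (Suc (Suc k)) = e k * u (Suc k) - u k"
  shows "continuant e (Suc (h + d)) * u (Suc h) =
    continuant e h * u (Suc (Suc (h + d))) + continuant (\<lambda>k. e (Suc (k + h))) d * u 0"
proof -
  have base: "continuant e (Suc h) * u (Suc h) = continuant e h * u (Suc (Suc h)) + u 0" for h
  proof (induction h)
    case 0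
    show ?case by (simp add: u)
  next
    case (Suc h)
    have "continuant e (Suc (Suc h)) * u (Suc (Suc h)) =
      e (Suc h) * continuant e (Suc h) * u (Suc (Suc h)) - continuant e h * u (Suc (Suc h))"
      by (simp add: left_diff_distrib)
    also have "continuant e h * u (Suc (Suc h)) = continuant e (Suc h) * u (Suc h) - u 0"
      using Suc.IH by simp
    finally show ?case
      unfolding u[of "Suc h"] by (simp add: right_diff_distrib mult_ac)
  qed
  show ?thesis
  proof (induction d rule: induct_nat_012)
    case 0
    then show ?case using base[of h] by simp
  next
    case 1
    have "continuant e (Suc (Suc h)) * u (Suc h) =
      e (Suc h) * (continuant e (Suc h) * u (Suc h)) - continuant e h * u (Suc h)"
      by (simp add: algebra_simps)
    then show ?case
      unfolding base by (simp add: u[of "Suc h"] algebra_simps)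
  next
    case (ge2 d)
    have "continuant e (Suc (h + Suc (Suc d))) * u (Suc h) =
      e (Suc (Suc (h + d))) * (continuant e (Suc (h + Suc d)) * u (Suc h))
        - continuant e (Suc (h + d)) * u (Suc h)"
      by (simp add: algebra_simps)
    also have "\<dots> = continuant e h * u (Suc (Suc (h + Suc (Suc d)))) +
      continuant (\<lambda>k. e (Suc (k + h))) (Suc (Suc d)) * u 0"
    proof -
      have "u (Suc (Suc (h + Suc (Suc d)))) =
        e (Suc (Suc (h + d))) * u (Suc (Suc (h + Suc d))) - u (Suc (Suc (h + d)))"
        using u[of "Suc (Suc (h + d))"] by simp
      note m = this
      show ?thesis
        unfolding ge2 m by (simp add: algebra_simps)
    qed
    finally show ?case .
  qed
qed

lemma continuant_bound:
  fixes e :: "nat \<Rightarrow> real"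
  assumes "\<And>k. \<bar>e k\<bar> \<le> D"
  shows "\<bar>continuant e n\<bar> \<le> (D + 1) ^ n"
proof (induction n rule: induct_nat_012)
  case 0
  show ?case by simp
next
  case 1
  show ?case using assms[of 0] by simp
next
  case (ge2 n)
  have D: "D \<ge> 0" using assms[of 0] by linarith
  have "\<bar>continuant e (Suc (Suc n))\<bar> \<le> \<bar>e (Suc n)\<bar> * \<bar>continuant e (Suc n)\<bar> + \<bar>continuant e n\<bar>"
    by (simp add: abs_mult[symmetric])
  also have "\<dots> \<le> D * (D + 1) ^ Suc n + (D + 1) ^ n"
    by (intro add_mono mult_mono assms ge2) (use D in auto)
  also have "\<dots> \<le> (D + 1) ^ n * ((D + 1) * (D + 1))"
    using D by (simp add: algebra_simps)
  finally show ?case by (simp add: mult_ac)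
qed

lemma continuant_lipschitz:
  fixes e e' :: "nat \<Rightarrow> real"
  assumes "\<And>k. \<bar>e k\<bar> \<le> D" "\<And>k. \<bar>e' k\<bar> \<le> D" "\<And>k. k < n \<Longrightarrow> \<bar>e k - e' k\<bar> \<le> h" "0 \<le> h"
  shows "\<bar>continuant e n - continuant e' n\<bar> \<le> real n * (D + 1) ^ n * h"
  using assms(3)
proof (induction n rule: induct_nat_012)
  case 0
  show ?case by simp
next
  case 1
  have D: "D \<ge> 0" using assms(1)[of 0] by linarith
  have "h \<le> (D + 1) * h" using D assms(4) by (simp add: algebra_simps)
  then show ?case using 1[of 0] by simp
next
  case (ge2 n)
  have D: "D \<ge> 0" using assms(1)[of 0] by linarith
  have "continuant e (Suc (Suc n)) - continuant e' (Suc (Suc n)) =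
      (e (Suc n) - e' (Suc n)) * continuant e (Suc n)
      + e' (Suc n) * (continuant e (Suc n) - continuant e' (Suc n)) - (continuant e n - continuant e' n)"
    by (simp add: algebra_simps)
  also have "\<bar>\<dots>\<bar> \<le> \<bar>e (Suc n) - e' (Suc n)\<bar> * \<bar>continuant e (Suc n)\<bar>
      + \<bar>e' (Suc n)\<bar> * \<bar>continuant e (Suc n) - continuant e' (Suc n)\<bar> + \<bar>continuant e n - continuant e' n\<bar>"
    unfolding abs_mult[symmetric] by linarith
  also have "\<dots> \<le> h * (D + 1) ^ Suc n + D * (real (Suc n) * (D + 1) ^ Suc n * h) + real n * (D + 1) ^ n * h"
    by (intro add_mono mult_mono ge2 continuant_bound assms) (use D assms(4) ge2.prems in auto)
  also have "\<dots> = (D + 1) ^ n * h * ((D + 1) + D * (1 + real n) * (D + 1) + real n)"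
    by (simp add: algebra_simps)
  also have "\<dots> \<le> (D + 1) ^ n * h * (real (Suc (Suc n)) * ((D + 1) * (D + 1)))"
  proof (rule mult_left_mono)
    show "D + 1 + D * (1 + real n) * (D + 1) + real n \<le> real (Suc (Suc n)) * ((D + 1) * (D + 1))"
    proof -
      have "0 \<le> D * D + (2 * D + 1) + real n * D" using D by simp
      then show ?thesis by (simp add: algebra_simps)
    qed
  qed (use D assms(4) in auto)
  finally show ?case by (simp add: mult_ac)
qed

definition char_poly_seq :: "(nat \<Rightarrow> 'a::comm_ring_1) \<Rightarrow> nat \<Rightarrow> 'a poly" where
  "char_poly_seq V n = continuant (\<lambda>k. [:- V k, 1:]) n"

lemma poly_char_poly_seq: "poly (char_poly_seq V n) E = continuant (\<lambda>k. E - V k) n"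
  unfolding char_poly_seq_def by (induction n rule: induct_nat_012) (auto simp: algebra_simps)

lemma degree_char_poly_seq:
  fixes V :: "nat \<Rightarrow> 'a::{idom}"
  shows "degree (char_poly_seq V n) = n \<and> lead_coeff (char_poly_seq V n) = 1"
  unfolding char_poly_seq_def
proof (induction n rule: induct_nat_012)
  case (ge2 n)
  let ?c = "continuant (\<lambda>k. [:- V k, 1:])"
  have nz: "?c (Suc n) \<noteq> 0" using ge2 by auto
  have d: "degree ([:- V (Suc n), 1:] * ?c (Suc n)) = Suc (Suc n)"
    using nz ge2 by (subst degree_mult_eq) auto
  have l: "lead_coeff ([:- V (Suc n), 1:] * ?c (Suc n)) = 1"
    unfolding lead_coeff_mult conjunct2[OF ge2(2)] by simp
  have lt: "degree (- ?c n) < degree ([:- V (Suc n), 1:] * ?c (Suc n))"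
    unfolding d using ge2 by (simp del: continuant.simps)
  have eq: "?c (Suc (Suc n)) = - ?c n + [:- V (Suc n), 1:] * ?c (Suc n)" by simp
  show ?case
    unfolding eq degree_add_eq_right[OF lt] using lt d l
    by (metis degree_add_eq_right lead_coeff_add_le)
qed auto

section \<open>Gauss quadrature for finite Jacobi matrices\<close>

text \<open>
  The solution of \<open>u (n + 1) + u (n - 1) + V n * u n = E * u n\<close> with \<open>u (- 1) = 0\<close> and \<open>u 0 = 1\<close>; these are
  also the orthonormal polynomials of the Jacobi matrix with potential \<open>V\<close>.
\<close>

definition dsol :: "(nat \<Rightarrow> 'a::comm_ring_1) \<Rightarrow> 'a \<Rightarrow> nat \<Rightarrow> 'a" where
  "dsol V E = continuant (\<lambda>k. E - V k)"

lemma dsol_rec [simp]: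
  "dsol V E 0 = 1" "dsol V E (Suc 0) = E - V 0"
  "dsol V E (Suc (Suc n)) = (E - V (Suc n)) * dsol V E (Suc n) - dsol V E n"
  by (simp_all add: dsol_def)

lemma poly_char: "poly (char_poly_seq V n) E = dsol V E n"
  by (simp add: poly_char_poly_seq dsol_def)

lemma christoffel_darboux:
  "(x - y) * (\<Sum>k\<le>n. dsol V x k * dsol V y k)
     = dsol V x (Suc n) * dsol V y n - dsol V x n * dsol V y (Suc n)"
proof (induction n)
  case (Suc n)
  then show ?case by (simp add: algebra_simps)
qed simp

text \<open>
  For a Dirichlet solution and the solution that starts one site later, the Wronskian with
  respect to the energy is a sum of squares, by induction along the recursion of \<open>continuant_first\<close>. Its last summand
  is \<open>1\<close> and its first is the square of the second solution. Hence, for a real potential, the two have no common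
  real zero, real zeros are simple, and the quotient of the two increases in \<open>E\<close> with slope at least \<open>1\<close>
  wherever it is defined.
\<close>

lemma wronskian_sum_squares:
  fixes V :: "nat \<Rightarrow> 'a::idom"
  shows "poly (pderiv (char_poly_seq V (Suc n))) z * poly (char_poly_seq (shift V) n) z
     - poly (char_poly_seq V (Suc n)) z * poly (pderiv (char_poly_seq (shift V) n)) z
     = (\<Sum>j\<le>n. (dsol (\<lambda>k. V (k + Suc j)) z (n - j))\<^sup>2)"
proof (induction n arbitrary: V)
  case 0
  show ?case by (simp add: char_poly_seq_def pderiv_pCons dsol_def)
next
  case (Suc n)
  let ?s = "shift V"
  have first: "char_poly_seq V (Suc (Suc n)) =
      [:- V 0, 1:] * char_poly_seq ?s (Suc n) - char_poly_seq (shift ?s) n"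
    unfolding char_poly_seq_def by (subst continuant_first) (simp add: shift_def)
  have ind: "(\<Sum>j\<le>n. (dsol (\<lambda>k. ?s (k + Suc j)) z (n - j))\<^sup>2)
     = (\<Sum>j\<le>n. (dsol (\<lambda>k. V (k + Suc (Suc j))) z (Suc n - Suc j))\<^sup>2)"
    by (simp add: shift_def)
  have "(\<Sum>j\<le>Suc n. (dsol (\<lambda>k. V (k + Suc j)) z (Suc n - j))\<^sup>2) =
     (poly (char_poly_seq ?s (Suc n)) z)\<^sup>2
     + (\<Sum>j\<le>n. (dsol (\<lambda>k. V (k + Suc (Suc j))) z (Suc n - Suc j))\<^sup>2)"
    by (subst sum.atMost_Suc_shift) (simp add: poly_char shift_def)
  also have "\<dots> = (poly (char_poly_seq ?s (Suc n)) z)\<^sup>2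
     + (poly (pderiv (char_poly_seq ?s (Suc n))) z * poly (char_poly_seq (shift ?s) n) z
     - poly (char_poly_seq ?s (Suc n)) z * poly (pderiv (char_poly_seq (shift ?s) n)) z)"
    unfolding Suc.IH[of ?s] ind ..
  finally have rhs: "(\<Sum>j\<le>Suc n. (dsol (\<lambda>k. V (k + Suc j)) z (Suc n - j))\<^sup>2) = \<dots>" .
  have val: "poly (char_poly_seq V (Suc (Suc n))) z =
      (z - V 0) * poly (char_poly_seq ?s (Suc n)) z - poly (char_poly_seq (shift ?s) n) z"
    unfolding first by (simp add: algebra_simps)
  have der: "poly (pderiv (char_poly_seq V (Suc (Suc n)))) z =
      poly (char_poly_seq ?s (Suc n)) z + (z - V 0) * poly (pderiv (char_poly_seq ?s (Suc n))) z
        - poly (pderiv (char_poly_seq (shift ?s) n)) z"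
    unfolding first pderiv_diff pderiv_mult by (simp add: pderiv_pCons algebra_simps)
  show ?case
    unfolding rhs val der by (simp add: algebra_simps power2_eq_square)
qed

lemma dsol_of_real: "dsol (\<lambda>k. of_real (V k)) (of_real E) n = (of_real (dsol V E n) :: complex)"
  unfolding dsol_def of_real_continuant by simp

text \<open>
  A left inverse of a square matrix is a right inverse.
\<close>

lemma square_orthonormal_rows_imp_columns:
  fixes \<phi> :: "nat \<Rightarrow> 'a \<Rightarrow> real"
  assumes "finite S" "card S = N"
    and rows: "\<And>x y. x \<in> S \<Longrightarrow> y \<in> S \<Longrightarrow> (\<Sum>k<N. \<phi> k x * \<phi> k y) = (if x = y then 1 else 0)"
    and "m < N" "n < N"
  shows "(\<Sum>x\<in>S. \<phi> m x * \<phi> n x) = (if m = n then 1 else 0)"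
proof -
  obtain h where h: "bij_betw h {0..<N} S"
    using ex_bij_betw_nat_finite[OF assms(1)] assms(2) by auto
  define A where "A = mat N N (\<lambda>(i, k). \<phi> k (h i))"
  define B where "B = mat N N (\<lambda>(k, i). \<phi> k (h i))"
  have A: "A \<in> carrier_mat N N" and B: "B \<in> carrier_mat N N"
    by (auto simp: A_def B_def)
  have "A * B = 1\<^sub>m N"
  proof (rule eq_matI)
    fix i j assume "i < dim_row (1\<^sub>m N :: real mat)" "j < dim_col (1\<^sub>m N :: real mat)"
    then have ij: "i < N" "j < N" by auto
    have "(A * B) $$ (i, j) = (\<Sum>k\<in>{0..<N}. \<phi> k (h i) * \<phi> k (h j))"
      using ij by (simp add: A_def B_def scalar_prod_def)
    also have "\<dots> = (if h i = h j then 1 else 0)"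
      using rows[of "h i" "h j"] ij h by (auto simp: bij_betw_def atLeast0LessThan)
    also have "\<dots> = 1\<^sub>m N $$ (i, j)"
      using ij h by (auto simp: bij_betw_def inj_on_def)
    finally show "(A * B) $$ (i, j) = 1\<^sub>m N $$ (i, j)" .
  qed (auto simp: A_def B_def)
  then have BA: "B * A = 1\<^sub>m N"
    using mat_mult_left_right_inverse[OF A B] by simp
  have "(\<Sum>x\<in>S. \<phi> m x * \<phi> n x) = (\<Sum>i\<in>{0..<N}. \<phi> m (h i) * \<phi> n (h i))"
    by (rule sum.reindex_bij_betw[OF h, symmetric])
  also have "\<dots> = (B * A) $$ (m, n)"
    using assms(4,5) by (simp add: A_def B_def scalar_prod_def)
  finally show ?thesis unfolding BA using assms(4,5) by simp
qed

text \<open>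
  A zero of the characteristic polynomial is an eigenvalue of a symmetric matrix: for \<open>y = cnj z\<close> the
  Christoffel-Darboux formula reads \<open>(z - cnj z) * (positive number) = 0\<close>.
\<close>

lemma dsol_complex_roots_real:
  fixes V :: "nat \<Rightarrow> real"
  assumes "dsol (\<lambda>k. complex_of_real (V k)) z (Suc n) = 0"
  shows "z \<in> \<real>"
proof -
  let ?V = "\<lambda>k. complex_of_real (V k)"
  have c: "dsol ?V (cnj z) k = cnj (dsol ?V z k)" for k
    unfolding dsol_def cnj_continuant by simp
  have "(z - cnj z) * (\<Sum>k\<le>n. dsol ?V z k * dsol ?V (cnj z) k) = 0"
    unfolding christoffel_darboux using assms c[of "Suc n"] by (simp del: dsol_rec)
  moreover have eq: "(\<Sum>k\<le>n. dsol ?V z k * dsol ?V (cnj z) k) = of_real (\<Sum>k\<le>n. (cmod (dsol ?V z k))\<^sup>2)"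
    unfolding c of_real_sum complex_norm_square ..
  moreover have "(\<Sum>k\<le>n. (cmod (dsol ?V z k))\<^sup>2) \<ge> (\<Sum>k\<in>{0}. (cmod (dsol ?V z k))\<^sup>2)"
    by (rule sum_mono2) auto
  ultimately have "z = cnj z" unfolding eq by (simp del: of_real_sum)
  then show ?thesis by (metis Reals_cnj_iff)
qed

text \<open>
  All complex zeros are real and, by the Wronskian identity, simple; so there are as many as the degree.
\<close>

lemma dsol_roots_card:
  fixes V :: "nat \<Rightarrow> real"
  shows "finite {E. dsol V E (Suc n) = 0}" and "card {E. dsol V E (Suc n) = 0} = Suc n"
proof -
  let ?V = "\<lambda>k. complex_of_real (V k)"
  define p where "p = char_poly_seq ?V (Suc n)"
  have deg: "degree p = Suc n" "lead_coeff p = 1"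
    using degree_char_poly_seq[of ?V "Suc n"] by (auto simp: p_def)
  have roots: "{z. poly p z = 0} = complex_of_real ` {E. dsol V E (Suc n) = 0}"
  proof (safe)
    fix z assume z: "poly p z = 0"
    then have "z \<in> \<real>"
      using dsol_complex_roots_real[of V z n] by (simp add: p_def poly_char)
    then obtain E where E: "z = of_real E" by (auto elim: Reals_cases)
    then show "z \<in> complex_of_real ` {E. dsol V E (Suc n) = 0}"
      using z unfolding p_def poly_char E dsol_of_real by (auto simp del: dsol_rec)
  next
    fix E assume "dsol V E (Suc n) = 0"
    then show "poly p (complex_of_real E) = 0"
      unfolding p_def poly_char dsol_of_real by simp
  qed
  have "rsquarefree p"
    unfolding rsquarefree_roots
  proof (intro allI notI, elim conjE)
    fix z assume z: "poly p z = 0" "poly (pderiv p) z = 0"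
    then obtain E where E: "z = of_real E" using roots by blast
    have "complex_of_real (\<Sum>j\<le>n. (dsol (\<lambda>k. V (k + Suc j)) E (n - j))\<^sup>2) =
        (\<Sum>j\<le>n. (dsol (\<lambda>k. ?V (k + Suc j)) z (n - j))\<^sup>2)"
      unfolding E dsol_of_real by simp
    also have "\<dots> = 0"
      using wronskian_sum_squares[of ?V n z] z by (simp add: p_def)
    finally have "(\<Sum>j\<le>n. (dsol (\<lambda>k. V (k + Suc j)) E (n - j))\<^sup>2) = 0"
      unfolding of_real_eq_0_iff .
    moreover have "(\<Sum>j\<in>{n}. (dsol (\<lambda>k. V (k + Suc j)) E (n - j))\<^sup>2)
        \<le> (\<Sum>j\<le>n. (dsol (\<lambda>k. V (k + Suc j)) E (n - j))\<^sup>2)"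
      by (rule sum_mono2) auto
    ultimately show False by simp
  qed
  from complex_poly_decompose_rsquarefree[OF this]
  have "p = (\<Prod>z|poly p z = 0. [:-z, 1:])" using deg by simp
  then have "degree p = degree (\<Prod>z|poly p z = 0. [:-z, 1:])" by simp
  also have "\<dots> = (\<Sum>z|poly p z = 0. degree [:-z, 1:])"
    by (rule degree_prod_eq_sum_degree) auto
  finally have c: "card {z. poly p z = 0} = Suc n" using deg by simp
  moreover have inj: "inj_on complex_of_real {E. dsol V E (Suc n) = 0}"
    by (auto simp: inj_on_def)
  ultimately show "card {E. dsol V E (Suc n) = 0} = Suc n"
    unfolding roots by (simp only: card_image)
  then show "finite {E. dsol V E (Suc n) = 0}"
    using card.infinite by fastforce
qed

definition christoffel_weight :: "(nat \<Rightarrow> real) \<Rightarrow> nat \<Rightarrow> real \<Rightarrow> real" where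
  "christoffel_weight V N E = 1 / (\<Sum>k<N. (dsol V E k)\<^sup>2)"

lemma christoffel_weight_pos: "christoffel_weight V (Suc n) E > 0"
proof -
  have "(\<Sum>k\<in>{0}. (dsol V E k)\<^sup>2) \<le> (\<Sum>k<Suc n. (dsol V E k)\<^sup>2)"
    by (rule sum_mono2) auto
  then show ?thesis by (simp add: christoffel_weight_def)
qed

lemma node_rows:
  assumes "dsol V x (Suc n) = 0" "dsol V y (Suc n) = 0"
  shows "(\<Sum>k<Suc n. dsol V x k * dsol V y k) = (if x = y then 1 / christoffel_weight V (Suc n) x else 0)"
proof (cases "x = y")
  case True
  then show ?thesis by (simp add: christoffel_weight_def power2_eq_square)
next
  case False
  then show ?thesis
    using christoffel_darboux[of x y V n] assms by (simp add: lessThan_Suc_atMost)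
qed

text \<open>
  At the zeros of the next polynomial the vectors of polynomial values are orthogonal by the
  Christoffel-Darboux formula. There are as many zeros as coordinates, so after normalisation they form
  a square matrix with orthonormal rows, and its columns are orthonormal too. This is the spectral
  theorem for a finite box.
\<close>

lemma gauss_quadrature:
  fixes V :: "nat \<Rightarrow> real"
  assumes "m < Suc N" "n < Suc N"
  shows "(\<Sum>E | dsol V E (Suc N) = 0. christoffel_weight V (Suc N) E * dsol V E m * dsol V E n)
     = (if m = n then 1 else 0)"
proof -
  let ?w = "christoffel_weight V (Suc N)"
  let ?S = "{E. dsol V E (Suc N) = 0}"
  define \<phi> where "\<phi> k E = sqrt (?w E) * dsol V E k" for k E
  have "(\<Sum>x\<in>?S. \<phi> m x * \<phi> n x) = (if m = n then 1 else 0)"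
  proof (rule square_orthonormal_rows_imp_columns[OF dsol_roots_card _ assms])
    fix x y assume xy: "x \<in> ?S" "y \<in> ?S"
    have "(\<Sum>k<Suc N. \<phi> k x * \<phi> k y) = sqrt (?w x) * sqrt (?w y) * (\<Sum>k<Suc N. dsol V x k * dsol V y k)"
      unfolding sum_distrib_left by (simp add: \<phi>_def mult_ac)
    also have "\<dots> = (if x = y then 1 else 0)"
      using xy node_rows[of V x N y] christoffel_weight_pos[of V N x]
      by (auto simp del: sum.lessThan_Suc)
    finally show "(\<Sum>k<Suc N. \<phi> k x * \<phi> k y) = (if x = y then 1 else 0)" .
  qed
  moreover have "\<phi> m x * \<phi> n x = ?w x * dsol V x m * dsol V x n" for x
    using christoffel_weight_pos[of V N x] by (simp add: \<phi>_def mult_ac)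
  ultimately show ?thesis by simp
qed

section \<open>A localization criterion for bounded Jacobi operators\<close>

lemma sum_inverse_squares_le: "(\<Sum>n<Suc N. 1 / (real n + 1)\<^sup>2) \<le> 2 - 1 / (real N + 1)"
proof (induction N)
  case (Suc N)
  have "1 / (real N + 2)\<^sup>2 \<le> 1 / (real N + 1) - 1 / (real N + 2)"
    by (simp add: divide_simps power2_eq_square)
  with Suc show ?case by (simp add: add.commute)
qed simp

text \<open>
  A Chebyshev inequality: by quadrature the weighted sum over all nodes of
  \<open>\<Sum>n. (dsol V E n)\<^sup>2 / (n + 1)\<^sup>2\<close> is at most \<open>\<Sum>n. 1 / (n + 1)\<^sup>2 \<le> 2\<close>. It says that spectrally most
  energies have linearly bounded solutions.
\<close>

lemma node_mass_outside:
  fixes V :: "nat \<Rightarrow> real" and N :: nat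
  assumes "K > 0"
  defines "S \<equiv> {E. dsol V E (Suc N) = 0}"
  defines "J \<equiv> {E \<in> S. \<forall>n<Suc N. \<bar>dsol V E n\<bar> \<le> K * (real n + 1)}"
  shows "(\<Sum>E\<in>S - J. christoffel_weight V (Suc N) E) \<le> 2 / K\<^sup>2"
proof -
  let ?w = "christoffel_weight V (Suc N)"
  let ?h = "\<lambda>E. \<Sum>n<Suc N. (dsol V E n)\<^sup>2 / (real n + 1)\<^sup>2"
  have fin: "finite S" unfolding S_def by (rule dsol_roots_card)
  have w: "?w E \<ge> 0" for E using christoffel_weight_pos[of V N E] by simp
  have h: "?h E \<ge> 0" for E by (intro sum_nonneg) auto
  have big: "K\<^sup>2 \<le> ?h E" if "E \<in> S - J" for E
  proof -
    from that obtain n where n: "n < Suc N" "K * (real n + 1) < \<bar>dsol V E n\<bar>"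
      by (auto simp: J_def not_le simp del: dsol_rec)
    have "(K * (real n + 1))\<^sup>2 \<le> (dsol V E n)\<^sup>2"
      using n assms(1) by (intro abs_le_square_iff[THEN iffD1]) (simp add: abs_mult)
    then have "K\<^sup>2 \<le> (dsol V E n)\<^sup>2 / (real n + 1)\<^sup>2"
      by (simp add: power_mult_distrib pos_le_divide_eq)
    also have "\<dots> = (\<Sum>n\<in>{n}. (dsol V E n)\<^sup>2 / (real n + 1)\<^sup>2)" by simp
    also have "\<dots> \<le> ?h E" by (rule sum_mono2) (use n in auto)
    finally show ?thesis .
  qed
  have "K\<^sup>2 * (\<Sum>E\<in>S - J. ?w E) = (\<Sum>E\<in>S - J. ?w E * K\<^sup>2)"
    unfolding sum_distrib_left by (simp add: mult.commute)
  also have "\<dots> \<le> (\<Sum>E\<in>S - J. ?w E * ?h E)"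
    by (intro sum_mono mult_left_mono big w)
  also have "\<dots> \<le> (\<Sum>E\<in>S. ?w E * ?h E)"
    by (intro sum_mono2 fin mult_nonneg_nonneg w h) auto
  also have "\<dots> = (\<Sum>n<Suc N. \<Sum>E\<in>S. (?w E * dsol V E n * dsol V E n) / (real n + 1)\<^sup>2)"
    unfolding sum_distrib_left by (subst sum.swap) (simp add: power2_eq_square mult_ac)
  also have "\<dots> = (\<Sum>n<Suc N. 1 / (real n + 1)\<^sup>2)"
    unfolding sum_divide_distrib[symmetric] S_def
    by (intro sum.cong refl) (simp add: gauss_quadrature)
  also have "\<dots> \<le> 2" using sum_inverse_squares_le[of N] by (smt (verit) divide_nonneg_nonneg of_nat_0_le_iff)
  finally show ?thesis using assms(1) by (simp add: pos_le_divide_eq mult.commute)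
qed

text \<open>
  Parseval's identity for the orthogonal eigenvectors of the box.
\<close>

lemma node_combination_energy:
  fixes \<phi> :: "real \<Rightarrow> complex"
  assumes Q: "Q \<subseteq> {E. dsol V E (Suc N) = 0}"
  shows "(\<Sum>n<Suc N. (cmod (\<Sum>E\<in>Q. of_real (christoffel_weight V (Suc N) E) * \<phi> E * of_real (dsol V E n)))\<^sup>2)
    = (\<Sum>E\<in>Q. christoffel_weight V (Suc N) E * (cmod (\<phi> E))\<^sup>2)"
proof -
  let ?w = "christoffel_weight V (Suc N)"
  have fin: "finite Q" using Q dsol_roots_card(1)[of V N] by (rule finite_subset)
  have w: "?w E > 0" for E using christoffel_weight_pos[of V N E] by simp
  have "complex_of_real (\<Sum>n<Suc N. (cmod (\<Sum>E\<in>Q. ?w E * \<phi> E * of_real (dsol V E n)))\<^sup>2)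
    = (\<Sum>n<Suc N. \<Sum>x\<in>Q. \<Sum>y\<in>Q. (?w x * \<phi> x * of_real (dsol V x n)) * (?w y * cnj (\<phi> y) * of_real (dsol V y n)))"
    unfolding of_real_sum complex_norm_square by (simp only: cnj_sum sum_product) simp
  also have "\<dots> = (\<Sum>x\<in>Q. \<Sum>y\<in>Q. \<Sum>n<Suc N. (?w x * \<phi> x * of_real (dsol V x n)) * (?w y * cnj (\<phi> y) * of_real (dsol V y n)))"
    by (subst sum.swap, rule sum.cong[OF refl], subst sum.swap, rule refl)
  also have "\<dots> = (\<Sum>x\<in>Q. \<Sum>y\<in>Q. ?w x * ?w y * (\<phi> x * cnj (\<phi> y)) * of_real (\<Sum>n<Suc N. dsol V x n * dsol V y n))"
    unfolding of_real_sum sum_distrib_left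
    by (intro sum.cong refl) (simp del: dsol_rec)
  also have "\<dots> = (\<Sum>x\<in>Q. \<Sum>y\<in>Q. if x = y then of_real (?w x * (cmod (\<phi> x))\<^sup>2) else 0)"
  proof (intro sum.cong refl)
    fix x y assume xy: "x \<in> Q" "y \<in> Q"
    have row: "(\<Sum>n<Suc N. dsol V x n * dsol V y n) = (if x = y then 1 / ?w x else 0)"
      using xy Q by (intro node_rows) auto
    show "?w x * ?w y * (\<phi> x * cnj (\<phi> y)) * of_real (\<Sum>n<Suc N. dsol V x n * dsol V y n)
      = (if x = y then of_real (?w x * (cmod (\<phi> x))\<^sup>2) else 0)"
      unfolding row using w[of x] by (simp add: complex_norm_square[symmetric])
  qed
  also have "\<dots> = of_real (\<Sum>E\<in>Q. ?w E * (cmod (\<phi> E))\<^sup>2)"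
    using fin by simp
  finally show ?thesis by (simp only: of_real_eq_iff)
qed

text \<open>
  Off the interval \<open>[- B - 2, B + 2]\<close> the coefficient \<open>E - V n\<close> exceeds \<open>2\<close> in absolute value, so solutions cannot shrink.
\<close>

lemma dsol_nondecreasing_outside:
  fixes V :: "nat \<Rightarrow> real"
  assumes V: "\<And>n. \<bar>V n\<bar> \<le> B" and E: "\<bar>E\<bar> > B + 2"
  shows "1 \<le> \<bar>dsol V E n\<bar> \<and> \<bar>dsol V E n\<bar> \<le> \<bar>dsol V E (Suc n)\<bar>"
proof (induction n)
  case 0
  show ?case using V[of 0] E by simp
next
  case (Suc n)
  have "2 \<le> \<bar>E - V (Suc n)\<bar>" using V[of "Suc n"] E by linarith
  then have "2 * \<bar>dsol V E (Suc n)\<bar> \<le> \<bar>(E - V (Suc n)) * dsol V E (Suc n)\<bar>"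
    unfolding abs_mult by (intro mult_right_mono) auto
  moreover have "\<bar>(E - V (Suc n)) * dsol V E (Suc n)\<bar> \<le> \<bar>dsol V E (Suc (Suc n))\<bar> + \<bar>dsol V E n\<bar>"
    by simp
  ultimately show ?case using Suc by linarith
qed

lemma dsol_root_bound:
  fixes V :: "nat \<Rightarrow> real"
  assumes "\<And>n. \<bar>V n\<bar> \<le> B" "dsol V E n = 0"
  shows "\<bar>E\<bar> \<le> B + 2"
  using dsol_nondecreasing_outside[of V B E n] assms by (rule_tac ccontr) auto

lemma continuous_dsol: "continuous_on UNIV (\<lambda>E::real. dsol V E n)"
proof -
  have "continuous_on UNIV (\<lambda>E. poly (char_poly_seq V n) E)" by (intro continuous_intros)
  then show ?thesis by (simp add: poly_char)
qed

text \<open>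
  Compactness: an energy whose solution is linearly bounded on a long box is close to one whose
  solution is linearly bounded on the whole half-line.
\<close>

lemma near_bounded_energy:
  fixes V :: "nat \<Rightarrow> real"
  assumes "\<epsilon> > 0"
  shows "\<exists>N. \<forall>E. \<bar>E\<bar> \<le> R \<longrightarrow> (\<forall>n<N. \<bar>dsol V E n\<bar> \<le> K * (real n + 1)) \<longrightarrow>
    (\<exists>E'. \<bar>E'\<bar> \<le> R \<and> (\<forall>n. \<bar>dsol V E' n\<bar> \<le> K * (real n + 1)) \<and>
      (\<forall>n<L. \<bar>dsol V E n - dsol V E' n\<bar> \<le> \<epsilon>))"
proof (rule ccontr)
  assume "\<not> ?thesis"
  then have "\<forall>N. \<exists>E. \<bar>E\<bar> \<le> R \<and> (\<forall>n<N. \<bar>dsol V E n\<bar> \<le> K * (real n + 1)) \<and>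
    \<not> (\<exists>E'. \<bar>E'\<bar> \<le> R \<and> (\<forall>n. \<bar>dsol V E' n\<bar> \<le> K * (real n + 1)) \<and>
      (\<forall>n<L. \<bar>dsol V E n - dsol V E' n\<bar> \<le> \<epsilon>))"
    by blast
  then obtain e where e: "\<And>N. \<bar>e N\<bar> \<le> R" "\<And>N n. n < N \<Longrightarrow> \<bar>dsol V (e N) n\<bar> \<le> K * (real n + 1)"
    and no: "\<And>N E'. \<bar>E'\<bar> \<le> R \<Longrightarrow> (\<forall>n. \<bar>dsol V E' n\<bar> \<le> K * (real n + 1)) \<Longrightarrow>
      \<not> (\<forall>n<L. \<bar>dsol V (e N) n - dsol V E' n\<bar> \<le> \<epsilon>)"
    unfolding choice_iff by blast
  have "compact {-R..R}" by simp
  moreover have "\<forall>N. e N \<in> {-R..R}" using e(1) by (auto simp: abs_le_iff) (smt (verit))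
  ultimately obtain l r where l: "l \<in> {-R..R}" and r: "strict_mono r" "(e \<circ> r) \<longlonglongrightarrow> l"
    unfolding compact_def by metis
  have lim: "(\<lambda>i. dsol V (e (r i)) n) \<longlonglongrightarrow> dsol V l n" for n
    using continuous_on_tendsto_compose[OF continuous_dsol[of V n] r(2)] by (simp add: o_def)
  have "\<bar>dsol V l n\<bar> \<le> K * (real n + 1)" for n
  proof (rule tendsto_upperbound[OF tendsto_rabs[OF lim]])
    show "\<forall>\<^sub>F i in sequentially. \<bar>dsol V (e (r i)) n\<bar> \<le> K * (real n + 1)"
      using eventually_gt_at_top[of n]
    proof eventually_elim
      case (elim i)
      then show ?case using e(2)[of n "r i"] seq_suble[OF r(1), of i] by simp
    qed
  qed simp
  moreover have "\<forall>\<^sub>F i in sequentially. \<forall>n\<in>{..<L}. \<bar>dsol V (e (r i)) n - dsol V l n\<bar> < \<epsilon>"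
    unfolding eventually_ball_finite_distrib[OF finite_lessThan]
    using tendstoD[OF lim assms] by (auto simp: dist_real_def)
  then obtain i where "\<forall>n\<in>{..<L}. \<bar>dsol V (e (r i)) n - dsol V l n\<bar> < \<epsilon>"
    by (auto simp: eventually_sequentially)
  ultimately show False using no[of l "r i"] l by (meson abs_le_iff atLeastAtMost_iff lessThan_iff less_imp_le minus_le_iff)
qed

definition jacobi :: "(nat \<Rightarrow> real) \<Rightarrow> (nat \<Rightarrow> complex) \<Rightarrow> nat \<Rightarrow> complex" where
  "jacobi V u = (\<lambda>n. u (n + 1) + (if n = 0 then 0 else u (n - 1)) + of_real (V n) * u n)"

text \<open>
  Self-adjointness by hand. The Wronskian of a square-summable solution and its conjugate tends to
  zero, while the Christoffel-Darboux formula bounds it below by \<open>\<bar>z - cnj z\<bar>\<close>; so the eigenvalue is real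
  and the eigenfunction is a multiple of the Dirichlet solution.
\<close>

lemma eigenfunction_jacobiE:
  assumes V: "\<And>n. \<bar>V n\<bar> \<le> B" and u: "eigenfunction (jacobi V) u"
  obtains E where "\<bar>E\<bar> \<le> B + 2" "\<And>n. u n = u 0 * of_real (dsol V E n)" "u 0 \<noteq> 0"
    "(\<lambda>n. dsol V E n) \<longlonglongrightarrow> 0"
proof -
  let ?V = "\<lambda>k. complex_of_real (V k)"
  from u obtain z where ell: "u \<in> ell2" and nz: "\<exists>n. u n \<noteq> 0" and eq: "\<And>n. jacobi V u n = z * u n"
    unfolding eigenfunction_def by blast
  have sol: "u n = u 0 * dsol ?V z n" for n
    unfolding dsol_def
  proof (rule recurrence_solution_eq_continuant)
    show "u 1 = (z - ?V 0) * u 0"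
      using eq[of 0] by (simp add: jacobi_def algebra_simps)
    show "u (Suc (Suc n)) = (z - ?V (Suc n)) * u (Suc n) - u n" for n
      using eq[of "Suc n"] by (simp add: jacobi_def algebra_simps)
  qed
  have u0: "u 0 \<noteq> 0" using nz sol by (metis mult_zero_left)
  have "(\<lambda>n. (cmod (u n))\<^sup>2) \<longlonglongrightarrow> 0"
    using ell unfolding ell2_def by (intro summable_LIMSEQ_zero) simp
  then have "(\<lambda>n. sqrt ((cmod (u n))\<^sup>2)) \<longlonglongrightarrow> sqrt 0" by (intro tendsto_intros)
  then have "u \<longlonglongrightarrow> 0" by (simp add: tendsto_norm_zero_iff)
  then have "(\<lambda>n. u n / u 0) \<longlonglongrightarrow> 0" by (rule tendsto_divide_zero)
  then have d0: "(\<lambda>n. dsol ?V z n) \<longlonglongrightarrow> 0"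
    using u0 sol by (metis (no_types, lifting) ext nonzero_mult_div_cancel_left)
  have c: "dsol ?V (cnj z) k = cnj (dsol ?V z k)" for k
    unfolding dsol_def cnj_continuant by simp
  let ?r = "\<lambda>n. dsol ?V z (Suc n) * cnj (dsol ?V z n) - dsol ?V z n * cnj (dsol ?V z (Suc n))"
  have d1: "(\<lambda>n. dsol ?V z (Suc n)) \<longlonglongrightarrow> 0" using d0 by (rule LIMSEQ_Suc)
  have "?r \<longlonglongrightarrow> 0 * cnj 0 - 0 * cnj 0"
    by (intro tendsto_diff tendsto_mult tendsto_cnj d0 d1)
  then have r0: "(\<lambda>n. cmod (?r n)) \<longlonglongrightarrow> 0" by (simp add: tendsto_norm_zero)
  have "cmod (z - cnj z) \<le> cmod (?r n)" for n
  proof -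
    have "?r n = (z - cnj z) * (\<Sum>k\<le>n. dsol ?V z k * dsol ?V (cnj z) k)"
      unfolding christoffel_darboux by (simp only: c)
    also have "(\<Sum>k\<le>n. dsol ?V z k * dsol ?V (cnj z) k) = of_real (\<Sum>k\<le>n. (cmod (dsol ?V z k))\<^sup>2)"
      unfolding c of_real_sum complex_norm_square ..
    finally have "cmod (?r n) = cmod (z - cnj z) * \<bar>\<Sum>k\<le>n. (cmod (dsol ?V z k))\<^sup>2\<bar>"
      by (simp only: norm_mult norm_of_real)
    moreover have "(\<Sum>k\<in>{0}. (cmod (dsol ?V z k))\<^sup>2) \<le> (\<Sum>k\<le>n. (cmod (dsol ?V z k))\<^sup>2)"
      by (rule sum_mono2) auto
    ultimately show ?thesis using mult_left_mono[of 1 "\<bar>\<Sum>k\<le>n. (cmod (dsol ?V z k))\<^sup>2\<bar>" "cmod (z - cnj z)"]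
      by simp
  qed
  then have "cmod (z - cnj z) \<le> 0"
    by (intro tendsto_lowerbound[OF r0]) auto
  then have "z \<in> \<real>" by (simp add: Reals_cnj_iff)
  then obtain E where E: "z = of_real E" by (auto elim: Reals_cases)
  have sol': "u n = u 0 * of_real (dsol V E n)" for n
    using sol[of n] unfolding E dsol_of_real .
  have lim: "(\<lambda>n. dsol V E n) \<longlonglongrightarrow> 0"
    using d0 unfolding E dsol_of_real by (rule tendsto_of_real_iff[THEN iffD1, of _ 0, simplified])
  have "\<bar>E\<bar> \<le> B + 2"
  proof (rule ccontr)
    assume "\<not> \<bar>E\<bar> \<le> B + 2"
    then have "\<bar>dsol V E n\<bar> \<ge> 1" for n
      using dsol_nondecreasing_outside[of V B E n] V by auto
    then have "1 \<le> \<bar>0::real\<bar>"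
      by (intro tendsto_lowerbound[OF tendsto_rabs[OF lim]]) auto
    then show False by simp
  qed
  then show ?thesis using that sol' u0 lim by blast
qed

lemma summable_tail_small:
  fixes s :: "nat \<Rightarrow> real"
  assumes "summable s" "\<eta> > 0"
  shows "\<exists>M. \<forall>n\<ge>M. (\<Sum>k. s (k + n)) < \<eta>"
  using suminf_exist_split[OF assms(2,1)] by (auto simp: abs_less_iff)

lemma norm_power2_add_le: "(norm (a + b))\<^sup>2 \<le> 2 * (norm a)\<^sup>2 + 2 * (norm b)\<^sup>2"
proof -
  have "(norm (a + b))\<^sup>2 \<le> (norm a + norm b)\<^sup>2"
    by (intro power_mono norm_triangle_ineq) auto
  also have "\<dots> \<le> 2 * (norm a)\<^sup>2 + 2 * (norm b)\<^sup>2"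
    using sum_squares_bound[of "norm a" "norm b"] by (simp add: power2_sum)
  finally show ?thesis .
qed

lemma exp_square_summable:
  assumes "\<alpha> > 0"
  shows "summable (\<lambda>n. (C * exp (- \<alpha> * real n))\<^sup>2)"
proof -
  have "(C * exp (- \<alpha> * real n))\<^sup>2 = C\<^sup>2 * (exp (- 2 * \<alpha>)) ^ n" for n
    by (simp add: power_mult_distrib exp_of_nat_mult[symmetric] exp_double[symmetric] mult_ac)
  then show ?thesis using assms by (simp add: summable_geometric)
qed

text \<open>
  Linearly bounded solutions play the role of generalised eigenfunctions. If they all decay
  exponentially, with constants that depend only on the bound, then eigenfunctions are complete:
  expand a finitely supported vector exactly in the eigenvectors of a long box, discard the nodes
  without a linear bound, whose total mass is small, and replace each remaining eigenvector by a
  true eigenfunction at a nearby energy. On the first sites the replacement changes little by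
  continuity in the energy, and on the remaining sites uniform decay makes the new vector small.
\<close>

theorem localization_criterion:
  fixes V :: "nat \<Rightarrow> real"
  assumes V: "\<And>n. \<bar>V n\<bar> \<le> B"
    and loc: "\<And>K. K > 0 \<Longrightarrow> \<exists>C>0. \<exists>\<alpha>>0. \<forall>E. \<bar>E\<bar> \<le> B + 2 \<longrightarrow>
      (\<forall>n. \<bar>dsol V E n\<bar> \<le> K * (real n + 1)) \<longrightarrow> (\<forall>n. \<bar>dsol V E n\<bar> \<le> C * exp (- \<alpha> * real n))"
  shows "anderson_localization (jacobi V)"
  unfolding anderson_localization_def
proof (intro conjI allI impI)
  fix u assume "eigenfunction (jacobi V) u"
  from eigenfunction_jacobiE[OF V this] obtain E where E: "\<bar>E\<bar> \<le> B + 2"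
    "\<And>n. u n = u 0 * of_real (dsol V E n)" "u 0 \<noteq> 0" "(\<lambda>n. dsol V E n) \<longlonglongrightarrow> 0" by blast
  have "Bseq (dsol V E)" using E(4) by (intro convergent_imp_Bseq) (auto simp: convergent_def)
  then obtain K where K: "K > 0" "\<And>n. \<bar>dsol V E n\<bar> \<le> K" by (auto elim: BseqE)
  have "\<bar>dsol V E n\<bar> \<le> K * (real n + 1)" for n
  proof -
    have "K * 1 \<le> K * (real n + 1)" using K by (intro mult_left_mono) auto
    then show ?thesis using K(2)[of n] by simp
  qed
  then obtain C \<alpha> where C: "C > 0" "\<alpha> > 0" "\<And>n. \<bar>dsol V E n\<bar> \<le> C * exp (- \<alpha> * real n)"
    using loc[OF K(1)] E(1) by blast
  have "cmod (u n) \<le> (cmod (u 0) * C) * exp (- \<alpha> * real n)" for n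
    using C(3)[of n] unfolding E(2)[of n] norm_mult by (simp add: mult.assoc mult_left_mono)
  moreover have "cmod (u 0) * C > 0" using C(1) E(3) by simp
  ultimately show "exponentially_decaying u"
    unfolding exponentially_decaying_def using C(2) by blast
next
  show "pure_point_spectrum (jacobi V)"
    unfolding pure_point_spectrum_def
  proof (intro ballI allI impI)
    fix v :: "nat \<Rightarrow> complex" and \<epsilon> :: real
    assume v: "v \<in> ell2" and \<epsilon>: "\<epsilon> > 0"
    have sv: "summable (\<lambda>n. (cmod (v n))\<^sup>2)" using v by (simp add: ell2_def)
    have \<epsilon>2: "\<epsilon>\<^sup>2 / 32 > 0" using \<epsilon> by simp
    \<comment> \<open>The sites from \<open>M\<close> on carry a negligible part of \<open>v\<close>; \<open>\<psi>\<close> below is the rest.\<close>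
    obtain M where M: "\<And>n. n \<ge> M \<Longrightarrow> (\<Sum>k. (cmod (v (k + n)))\<^sup>2) < \<epsilon>\<^sup>2 / 32"
      using summable_tail_small[OF sv \<epsilon>2] by blast
    define \<phi> where "\<phi> E = (\<Sum>m<M. v m * of_real (dsol V E m))" for E
    have "bounded (\<phi> ` {-(B+2)..B+2})"
      unfolding \<phi>_def
      by (intro compact_imp_bounded compact_continuous_image continuous_intros
          continuous_on_subset[OF continuous_dsol]) auto
    then obtain \<Phi> where \<Phi>: "\<Phi> > 0" "\<And>E. \<bar>E\<bar> \<le> B + 2 \<Longrightarrow> cmod (\<phi> E) \<le> \<Phi>"
      unfolding bounded_pos by (auto simp: abs_le_iff)
    \<comment> \<open>Makes \<open>2 / K\<^sup>2 * \<Phi>\<^sup>2 = \<epsilon>\<^sup>2 / 128\<close>, the bound for the discarded nodes.\<close>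
    define K where "K = 16 * \<Phi> / \<epsilon>"
    have K: "K > 0" using \<Phi> \<epsilon> by (simp add: K_def)
    obtain C \<alpha> where C: "C > 0" "\<alpha> > 0"
      and dec: "\<And>E n. \<bar>E\<bar> \<le> B + 2 \<Longrightarrow> (\<forall>n. \<bar>dsol V E n\<bar> \<le> K * (real n + 1)) \<Longrightarrow>
        \<bar>dsol V E n\<bar> \<le> C * exp (- \<alpha> * real n)"
      using loc[OF K] by metis
    have sd: "summable (\<lambda>n. ((\<Phi> * C) * exp (- \<alpha> * real n))\<^sup>2)"
      by (rule exp_square_summable[OF C(2)])
    obtain L0 where L0: "\<And>n. n \<ge> L0 \<Longrightarrow> (\<Sum>k. ((\<Phi> * C) * exp (- \<alpha> * real (k + n)))\<^sup>2) < \<epsilon>\<^sup>2 / 32"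
      using summable_tail_small[OF sd \<epsilon>2] by blast
    define L where "L = max M L0"
    define \<epsilon>' where "\<epsilon>' = \<epsilon> / 16 / (real L + 1) / \<Phi>"
    have \<epsilon>': "\<epsilon>' > 0" using \<epsilon> \<Phi> by (simp add: \<epsilon>'_def)
    obtain N0 where N0: "\<And>E. \<bar>E\<bar> \<le> B + 2 \<Longrightarrow> (\<forall>n<N0. \<bar>dsol V E n\<bar> \<le> K * (real n + 1)) \<Longrightarrow>
      \<exists>E'. \<bar>E'\<bar> \<le> B + 2 \<and> (\<forall>n. \<bar>dsol V E' n\<bar> \<le> K * (real n + 1)) \<and>
      (\<forall>n<L. \<bar>dsol V E n - dsol V E' n\<bar> \<le> \<epsilon>')"
      using near_bounded_energy[OF \<epsilon>', of "B + 2" V K L] by blast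
    define N where "N = max N0 L"
    define S where "S = {E. dsol V E (Suc N) = 0}"
    define J where "J = {E \<in> S. \<forall>n<Suc N. \<bar>dsol V E n\<bar> \<le> K * (real n + 1)}"
    let ?w = "christoffel_weight V (Suc N)"
    have finS: "finite S" unfolding S_def by (rule dsol_roots_card)
    have JS: "J \<subseteq> S" by (auto simp: J_def)
    have finJ: "finite J" using JS finS by (rule finite_subset)
    have S_bd: "\<bar>E\<bar> \<le> B + 2" if "E \<in> S" for E
      using dsol_root_bound[where V = V and B = B and E = E and n = "Suc N"] V that by (simp add: S_def)
    have w: "?w E > 0" for E by (rule christoffel_weight_pos)
    have "\<forall>E\<in>J. \<exists>E'. \<bar>E'\<bar> \<le> B + 2 \<and> (\<forall>n. \<bar>dsol V E' n\<bar> \<le> K * (real n + 1)) \<and>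
      (\<forall>n<L. \<bar>dsol V E n - dsol V E' n\<bar> \<le> \<epsilon>')"
      using N0 S_bd by (auto simp: J_def N_def)
    then obtain g where g: "\<And>E. E \<in> J \<Longrightarrow> \<bar>g E\<bar> \<le> B + 2"
      "\<And>E. E \<in> J \<Longrightarrow> \<forall>n. \<bar>dsol V (g E) n\<bar> \<le> K * (real n + 1)"
      "\<And>E n. E \<in> J \<Longrightarrow> n < L \<Longrightarrow> \<bar>dsol V E n - dsol V (g E) n\<bar> \<le> \<epsilon>'"
      unfolding bchoice_iff by blast
    define c where "c E = ?w E * \<phi> E" for E
    define U where "U E = (\<lambda>n. complex_of_real (dsol V (g E) n))" for E
    define u' where "u' n = (\<Sum>E\<in>J. c E * U E n)" for n
    have wsum: "(\<Sum>E\<in>S. ?w E) = 1"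
      using gauss_quadrature[of 0 N 0 V] by (simp add: S_def)
    have wJ: "(\<Sum>E\<in>J. ?w E) \<le> 1"
      unfolding wsum[symmetric] using w by (intro sum_mono2 finS JS less_imp_le) auto
    have cJ: "(\<Sum>E\<in>J. cmod (c E)) \<le> \<Phi>"
    proof -
      have "(\<Sum>E\<in>J. cmod (c E)) \<le> (\<Sum>E\<in>J. ?w E * \<Phi>)"
        using w \<Phi>(2) S_bd JS by (intro sum_mono) (auto simp: c_def norm_mult less_imp_le)
      also have "\<dots> \<le> 1 * \<Phi>"
        unfolding sum_distrib_right[symmetric] using wJ \<Phi>(1) by (intro mult_right_mono) auto
      finally show ?thesis by simp
    qed
    define \<psi> where "\<psi> n = (if n < M then v n else 0)" for n
    have psi_nodes: "\<psi> n = (\<Sum>E\<in>S. c E * of_real (dsol V E n))" if "n < L" for n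
    proof -
      have MN: "M \<le> N" by (simp add: N_def L_def)
      have nN: "n < Suc N" using that by (simp add: N_def)
      have "(\<Sum>E\<in>S. c E * of_real (dsol V E n)) = (\<Sum>E\<in>S. \<Sum>m<M. v m * of_real (?w E * dsol V E m * dsol V E n))"
        unfolding c_def \<phi>_def sum_distrib_left sum_distrib_right
        by (intro sum.cong refl) (simp add: mult_ac)
      also have "\<dots> = (\<Sum>m<M. v m * of_real (\<Sum>E\<in>S. ?w E * dsol V E m * dsol V E n))"
        unfolding of_real_sum sum_distrib_left by (rule sum.swap)
      also have "\<dots> = (\<Sum>m<M. if m = n then v m else 0)"
      proof (intro sum.cong refl)
        fix m assume "m \<in> {..<M}"
        then have m: "m < Suc N" using MN by auto
        show "v m * of_real (\<Sum>E\<in>S. ?w E * dsol V E m * dsol V E n) = (if m = n then v m else 0)"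
          unfolding S_def gauss_quadrature[OF m nN] by simp
      qed
      also have "\<dots> = \<psi> n" by (simp add: \<psi>_def)
      finally show ?thesis by simp
    qed
    define \<rho> where "\<rho> n = (\<Sum>E\<in>S - J. c E * of_real (dsol V E n))" for n
    have \<rho>: "(\<Sum>n<L. (cmod (\<rho> n))\<^sup>2) \<le> \<epsilon>\<^sup>2 / 128"
    proof -
      have "(\<Sum>n<L. (cmod (\<rho> n))\<^sup>2) \<le> (\<Sum>n<Suc N. (cmod (\<rho> n))\<^sup>2)"
        by (rule sum_mono2) (auto simp: N_def)
      also have "\<dots> = (\<Sum>E\<in>S - J. ?w E * (cmod (\<phi> E))\<^sup>2)"
        unfolding \<rho>_def c_def by (rule node_combination_energy) (auto simp: S_def)
      also have "\<dots> \<le> (\<Sum>E\<in>S - J. ?w E * \<Phi>\<^sup>2)"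
        using w \<Phi> S_bd by (intro sum_mono mult_left_mono power_mono) (auto simp: less_imp_le)
      also have "\<dots> = (\<Sum>E\<in>S - J. ?w E) * \<Phi>\<^sup>2" by (simp add: sum_distrib_right)
      also have "\<dots> \<le> 2 / K\<^sup>2 * \<Phi>\<^sup>2"
        using node_mass_outside[OF K, of V N] unfolding S_def[symmetric] J_def[symmetric]
        by (intro mult_right_mono) auto
      also have "\<dots> = \<epsilon>\<^sup>2 / 128"
        using \<Phi>(1) \<epsilon> by (simp add: K_def power_divide power_mult_distrib)
      finally show ?thesis .
    qed
    define b where "b n = (cmod (\<psi> n - u' n))\<^sup>2" for n
    have near: "b n \<le> 2 * (cmod (\<rho> n))\<^sup>2 + 2 * (\<Phi> * \<epsilon>')\<^sup>2" if n: "n < L" for n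
    proof -
      have "\<psi> n = \<rho> n + (\<Sum>E\<in>J. c E * of_real (dsol V E n))"
        unfolding psi_nodes[OF n] \<rho>_def by (rule sum.subset_diff[OF JS finS])
      then have "\<psi> n - u' n = \<rho> n + (\<Sum>E\<in>J. c E * of_real (dsol V E n - dsol V (g E) n))"
        by (simp add: u'_def U_def sum_subtractf right_diff_distrib)
      moreover have "cmod (\<Sum>E\<in>J. c E * of_real (dsol V E n - dsol V (g E) n)) \<le> \<Phi> * \<epsilon>'"
      proof -
        have "cmod (\<Sum>E\<in>J. c E * of_real (dsol V E n - dsol V (g E) n)) \<le> (\<Sum>E\<in>J. cmod (c E) * \<epsilon>')"
          by (intro sum_norm_le) (use g(3) n in \<open>auto simp: norm_mult simp flip: of_real_diff intro!: mult_left_mono\<close>)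
        also have "\<dots> \<le> \<Phi> * \<epsilon>'"
          unfolding sum_distrib_right[symmetric] using cJ \<epsilon>' by (intro mult_right_mono) auto
        finally show ?thesis .
      qed
      then have "(cmod (\<Sum>E\<in>J. c E * of_real (dsol V E n - dsol V (g E) n)))\<^sup>2 \<le> (\<Phi> * \<epsilon>')\<^sup>2"
        by (intro power_mono) auto
      ultimately show ?thesis
        unfolding b_def using norm_power2_add_le[of "\<rho> n" "\<Sum>E\<in>J. c E * of_real (dsol V E n - dsol V (g E) n)"]
        by (simp only:)
    qed
    have udec: "cmod (u' n) \<le> (\<Phi> * C) * exp (- \<alpha> * real n)" for n
    proof -
      have "cmod (u' n) \<le> (\<Sum>E\<in>J. cmod (c E) * (C * exp (- \<alpha> * real n)))"
        unfolding u'_def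
        by (intro sum_norm_le) (use dec g in \<open>auto simp: norm_mult U_def intro!: mult_left_mono\<close>)
      also have "\<dots> \<le> \<Phi> * (C * exp (- \<alpha> * real n))"
        unfolding sum_distrib_right[symmetric] using cJ C by (intro mult_right_mono) auto
      finally show ?thesis by (simp add: mult.assoc)
    qed
    have far: "b n \<le> ((\<Phi> * C) * exp (- \<alpha> * real n))\<^sup>2" if "n \<ge> L" for n
      using that udec[of n] by (auto simp: b_def \<psi>_def L_def intro!: power_mono)
    have sb_tail: "summable (\<lambda>k. b (k + L))"
    proof (rule summable_comparison_test'[where N = 0])
      show "summable (\<lambda>k. ((\<Phi> * C) * exp (- \<alpha> * real (k + L)))\<^sup>2)"
        using summable_ignore_initial_segment[OF sd, of L] .
      show "norm (b (k + L)) \<le> ((\<Phi> * C) * exp (- \<alpha> * real (k + L)))\<^sup>2" for k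
        using far[of "k + L"] by (simp add: b_def)
    qed
    then have sb: "summable b" by (simp only: summable_iff_shift)
    have "suminf b = (\<Sum>k. b (k + L)) + sum b {..<L}"
      by (rule suminf_split_initial_segment[OF sb])
    also have "(\<Sum>k. b (k + L)) \<le> (\<Sum>k. ((\<Phi> * C) * exp (- \<alpha> * real (k + L)))\<^sup>2)"
      by (intro suminf_le far sb_tail summable_ignore_initial_segment[OF sd, of L]) auto
    also have "\<dots> < \<epsilon>\<^sup>2 / 32" by (rule L0) (simp add: L_def)
    also have "sum b {..<L} \<le> (\<Sum>n<L. 2 * (cmod (\<rho> n))\<^sup>2 + 2 * (\<Phi> * \<epsilon>')\<^sup>2)"
      by (intro sum_mono near) auto
    also have "\<dots> = 2 * (\<Sum>n<L. (cmod (\<rho> n))\<^sup>2) + real L * (2 * (\<Phi> * \<epsilon>')\<^sup>2)"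
      by (simp add: sum.distrib sum_distrib_left)
    also have "\<dots> \<le> 2 * (\<epsilon>\<^sup>2 / 128) + \<epsilon>\<^sup>2 / 64"
    proof -
      have \<Phi>\<epsilon>': "\<Phi> * \<epsilon>' = \<epsilon> / 16 / (real L + 1)"
        using \<Phi>(1) by (simp add: \<epsilon>'_def)
      have "real L * (2 * (\<Phi> * \<epsilon>')\<^sup>2) = \<epsilon>\<^sup>2 / 128 * (real L / (real L + 1)\<^sup>2)"
        unfolding \<Phi>\<epsilon>' power_divide by simp
      also have "\<dots> \<le> \<epsilon>\<^sup>2 / 128 * 1"
        by (intro mult_left_mono) (auto simp: divide_le_eq power2_eq_square algebra_simps)
      finally show ?thesis using \<rho> zero_le_power2[of \<epsilon>] by linarith
    qed
    finally have sumb: "suminf b < \<epsilon>\<^sup>2 / 16" by simp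
    define a where "a n = (cmod (v n - \<psi> n))\<^sup>2" for n
    have sa_tail: "(\<lambda>k. a (k + M)) = (\<lambda>k. (cmod (v (k + M)))\<^sup>2)"
      by (auto simp: a_def \<psi>_def)
    have sa: "summable a"
      using summable_ignore_initial_segment[OF sv, of M] unfolding sa_tail[symmetric] summable_iff_shift .
    have "suminf a = (\<Sum>k. a (k + M)) + sum a {..<M}"
      by (rule suminf_split_initial_segment[OF sa])
    also have "sum a {..<M} = 0" by (simp add: a_def \<psi>_def)
    finally have suma: "suminf a < \<epsilon>\<^sup>2 / 32" using M[of M] by (simp add: sa_tail)
    let ?h = "\<lambda>n. (cmod (v n - u' n))\<^sup>2"
    have hab: "?h n \<le> 2 * a n + 2 * b n" for n
      using norm_power2_add_le[of "v n - \<psi> n" "\<psi> n - u' n"] by (simp add: a_def b_def)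
    have sab: "summable (\<lambda>n. 2 * a n + 2 * b n)"
      by (intro summable_add summable_mult sa sb)
    have sh: "summable ?h"
      by (rule summable_comparison_test'[OF sab, of 0]) (use hab in auto)
    have "suminf ?h \<le> (\<Sum>n. 2 * a n + 2 * b n)"
      by (rule suminf_le[OF hab sh sab])
    also have "\<dots> = 2 * suminf a + 2 * suminf b"
      using sa sb by (simp add: suminf_add[symmetric] suminf_mult summable_mult)
    also have "\<dots> < \<epsilon>\<^sup>2" using suma sumb \<epsilon>2 by linarith
    finally have "ell2_norm (\<lambda>n. v n - u' n) < \<epsilon>"
      unfolding ell2_norm_def using \<epsilon> by (intro real_less_lsqrt) (auto intro: suminf_nonneg sh)
    moreover have "u' n = (\<Sum>u\<in>U ` J. (\<Sum>E | E \<in> J \<and> U E = u. c E) * u n)" for n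
      unfolding u'_def
      by (subst sum.image_gen[OF finJ, where g = U]) (auto simp: sum_distrib_right intro!: sum.cong)
    moreover have "eigenfunction (jacobi V) u" if "u \<in> U ` J" for u
    proof -
      from that obtain E where E: "E \<in> J" "u = U E" by blast
      let ?V = "\<lambda>k. complex_of_real (V k)"
      have u: "u n = dsol ?V (of_real (g E)) n" for n
        by (simp add: E(2) U_def dsol_of_real del: dsol_rec)
      have "u \<in> ell2"
        unfolding ell2_def mem_Collect_eq
      proof (rule summable_comparison_test'[OF exp_square_summable[OF C(2), of C], of 0])
        show "norm ((cmod (u n))\<^sup>2) \<le> (C * exp (- \<alpha> * real n))\<^sup>2" for n
          using dec[OF g(1,2)[OF E(1)], of n] by (auto simp: E(2) U_def abs_le_square_iff[symmetric])
      qed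
      moreover have "u 0 \<noteq> 0" by (simp add: E(2) U_def)
      moreover have "jacobi V u n = of_real (g E) * u n" for n
        by (cases n) (simp_all add: jacobi_def u algebra_simps)
      ultimately show ?thesis unfolding eigenfunction_def by blast
    qed
    ultimately show "\<exists>B a. finite B \<and> (\<forall>u\<in>B. eigenfunction (jacobi V) u) \<and>
        ell2_norm (\<lambda>n. v n - (\<Sum>u\<in>B. a u * u n)) < \<epsilon>"
      using finJ by (intro exI[of _ "U ` J"] exI[of _ "\<lambda>u. \<Sum>E | E \<in> J \<and> U E = u. c E"]) simp
  qed
qed

section \<open>Lebesgue measure and the doubling map\<close>

definition unit_integral :: "(real \<Rightarrow> ennreal) \<Rightarrow> ennreal" where
  "unit_integral F = (\<integral>\<^sup>+x\<in>{0..<1}. F x \<partial>lborel)"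

lemma unit_integral_mono:
  "(\<And>x. 0 \<le> x \<Longrightarrow> x < 1 \<Longrightarrow> F x \<le> G x) \<Longrightarrow> unit_integral F \<le> unit_integral G"
  unfolding unit_integral_def by (intro nn_integral_mono) (auto split: split_indicator)

lemma unit_integral_cong:
  "(\<And>x. 0 \<le> x \<Longrightarrow> x < 1 \<Longrightarrow> F x = G x) \<Longrightarrow> unit_integral F = unit_integral G"
  by (intro antisym unit_integral_mono) auto

lemma unit_integral_cmult:
  "F \<in> borel_measurable borel \<Longrightarrow> unit_integral (\<lambda>x. a * F x) = a * unit_integral F"
  unfolding unit_integral_def mult.assoc by (intro nn_integral_cmult) auto

lemma unit_integral_sum:
  "(\<And>i. i \<in> I \<Longrightarrow> F i \<in> borel_measurable borel) \<Longrightarrow>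
    unit_integral (\<lambda>x. \<Sum>i\<in>I. F i x) = (\<Sum>i\<in>I. unit_integral (F i))"
  unfolding unit_integral_def sum_distrib_right by (intro nn_integral_sum) auto

text \<open>
  Cut the unit interval into \<open>n\<close> equal cells and rescale each to the unit interval.
\<close>

lemma unit_integral_partition:
  assumes [measurable]: "F \<in> borel_measurable borel" and n: "n > (0::nat)"
  shows "unit_integral F = unit_integral (\<lambda>y. \<Sum>i<n. ennreal (1 / real n) * F ((y + real i) / real n))"
proof -
  let ?I = "\<lambda>i. {real i / real n..<(real i + 1) / real n}"
  have ind: "indicator {0..<1} x = (\<Sum>i<n. indicator (?I i) x :: ennreal)" for x :: real
  proof (cases "0 \<le> x \<and> x < 1")
    case True
    define k where "k = nat \<lfloor>real n * x\<rfloor>"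
    have k: "real k \<le> real n * x" "real n * x < real k + 1"
      using True n unfolding k_def by (auto simp: of_nat_nat)
    have kn: "k < n"
    proof -
      have "real n * x < real n * 1" using True n by (intro mult_strict_left_mono) auto
      then show ?thesis using k by linarith
    qed
    have "x \<in> ?I i \<longleftrightarrow> i = k" for i
    proof -
      have "x \<in> ?I i \<longleftrightarrow> real i \<le> real n * x \<and> real n * x < real i + 1"
        using n by (simp add: pos_divide_le_eq pos_less_divide_eq mult.commute)
      moreover have "\<dots> \<longleftrightarrow> i = k"
      proof
        assume "real i \<le> real n * x \<and> real n * x < real i + 1"
        then have "real i < real k + 1" "real k < real i + 1" using k by linarith+
        then show "i = k" by linarith
      qed (use k in simp)
      ultimately show ?thesis by simp
    qed
    then have "(\<Sum>i<n. indicator (?I i) x :: ennreal) = (\<Sum>i<n. if i = k then 1 else 0)"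
      by (intro sum.cong refl) (auto split: split_indicator)
    then show ?thesis using True kn by simp
  next
    case False
    have "x \<notin> ?I i" if "i < n" for i
    proof
      assume x: "x \<in> ?I i"
      have "0 \<le> real i / real n" by simp
      moreover have "(real i + 1) / real n \<le> 1" using that n by (simp add: divide_simps)
      moreover have "real i / real n \<le> x" "x < (real i + 1) / real n" using x by simp_all
      ultimately show False using False by linarith
    qed
    then show ?thesis using False by simp
  qed
  have piece: "(\<integral>\<^sup>+x. F x * indicator (?I i) x \<partial>lborel)
      = unit_integral (\<lambda>y. ennreal (1 / real n) * F ((y + real i) / real n))" for i
  proof -
    have "(\<integral>\<^sup>+x. F x * indicator (?I i) x \<partial>lborel) =
      ennreal (1 / real n) * (\<integral>\<^sup>+y. F (real i / real n + 1 / real n * y) * indicator (?I i) (real i / real n + 1 / real n * y) \<partial>lborel)"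
      using n by (subst nn_integral_real_affine[where c = "1 / real n" and t = "real i / real n"]) auto
    also have "(\<integral>\<^sup>+y. F (real i / real n + 1 / real n * y) * indicator (?I i) (real i / real n + 1 / real n * y) \<partial>lborel)
      = unit_integral (\<lambda>y. F ((y + real i) / real n))"
      unfolding unit_integral_def
    proof (intro nn_integral_cong)
      fix y :: real
      have arg: "real i / real n + 1 / real n * y = (y + real i) / real n"
        by (simp add: add_divide_distrib)
      have "(y + real i) / real n \<in> ?I i \<longleftrightarrow> y \<in> {0..<1}"
        using n by (simp add: divide_le_cancel divide_less_cancel)
      then show "F (real i / real n + 1 / real n * y) * indicator (?I i) (real i / real n + 1 / real n * y)
        = F ((y + real i) / real n) * indicator {0..<1} y"
        unfolding arg by (simp only: indicator_def)
    qed
    also have "ennreal (1 / real n) * \<dots> = unit_integral (\<lambda>y. ennreal (1 / real n) * F ((y + real i) / real n))"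
      by (subst unit_integral_cmult) auto
    finally show ?thesis .
  qed
  have "unit_integral F = (\<integral>\<^sup>+x. (\<Sum>i<n. F x * indicator (?I i) x) \<partial>lborel)"
    unfolding unit_integral_def ind sum_distrib_left ..
  also have "\<dots> = (\<Sum>i<n. \<integral>\<^sup>+x. F x * indicator (?I i) x \<partial>lborel)"
    by (intro nn_integral_sum) auto
  also have "\<dots> = unit_integral (\<lambda>y. \<Sum>i<n. ennreal (1 / real n) * F ((y + real i) / real n))"
    unfolding piece by (subst unit_integral_sum) auto
  finally show ?thesis .
qed

lemma unit_integral_indicator:
  assumes [measurable]: "Measurable.pred borel P"
  shows "unit_integral (\<lambda>x. indicator {x. P x} x) = emeasure lborel {x \<in> {0..<1}. P x}"
proof -
  have "unit_integral (\<lambda>x. indicator {x. P x} x) = (\<integral>\<^sup>+x. indicator {x \<in> {0..<1}. P x} x \<partial>lborel)"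
    unfolding unit_integral_def by (intro nn_integral_cong) (auto split: split_indicator)
  also have "\<dots> = emeasure lborel {x \<in> {0..<1}. P x}"
    by (intro nn_integral_indicator) measurable
  finally show ?thesis .
qed

lemma unit_markov:
  assumes [measurable]: "F \<in> borel_measurable borel" "Measurable.pred borel P"
    and F: "\<And>x. 0 \<le> x \<Longrightarrow> x < 1 \<Longrightarrow> P x \<Longrightarrow> 1 \<le> F x"
  shows "emeasure lborel {x \<in> {0..<1}. P x} \<le> unit_integral F"
  unfolding unit_integral_indicator[OF assms(2), symmetric]
  by (intro unit_integral_mono) (auto split: split_indicator simp: F)

lemma doubling_map_range [simp]: "0 \<le> doubling_map x" "doubling_map x < 1"
  by (simp_all add: doubling_map_def frac_lt_1)

lemma doubling_map_funpow_range:
  "0 \<le> x \<Longrightarrow> x < 1 \<Longrightarrow> 0 \<le> (doubling_map ^^ n) x \<and> (doubling_map ^^ n) x < 1"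
  by (cases n) auto

lemma measurable_doubling_map [measurable]: "doubling_map \<in> borel_measurable borel"
  unfolding doubling_map_def frac_def by measurable

lemma measurable_doubling_map_funpow [measurable]: "(doubling_map ^^ n) \<in> borel_measurable borel"
  by (induction n) (auto simp: comp_def)

lemma doubling_map_funpow_eq_frac:
  assumes "0 \<le> x" "x < 1"
  shows "(doubling_map ^^ n) x = frac (2 ^ n * x)"
proof (induction n)
  case 0
  show ?case using assms by (simp add: frac_eq)
next
  case (Suc n)
  have "2 * frac (2 ^ n * x) = 2 * (2 ^ n * x) + of_int (- 2 * \<lfloor>2 ^ n * x\<rfloor>)"
    by (simp add: frac_def)
  then have "frac (2 * frac (2 ^ n * x)) = frac (2 * (2 ^ n * x) + of_int (- 2 * \<lfloor>2 ^ n * x\<rfloor>))"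
    by (simp only:)
  then show ?case using Suc
    by (simp only: funpow.simps comp_def doubling_map_def frac_add_of_int_right power_Suc mult.assoc)
qed

text \<open>
  The \<open>2 ^ n\<close> inverse branches of the iterated doubling map: the integer \<open>i\<close> carries the first \<open>n\<close> binary
  digits of a point, and \<open>y\<close> carries the others.
\<close>

lemma doubling_map_branch:
  assumes "0 \<le> y" "y < 1" "i < 2 ^ n"
  shows "(doubling_map ^^ n) ((y + real i) / 2 ^ n) = y"
    and "0 \<le> (y + real i) / 2 ^ n" "(y + real i) / 2 ^ n < 1"
proof -
  have "real (Suc i) \<le> real (2 ^ n)" using assms(3) by (intro of_nat_mono) auto
  then have i: "real i + 1 \<le> 2 ^ n" by simp
  show 1: "0 \<le> (y + real i) / 2 ^ n" "(y + real i) / 2 ^ n < 1"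
    using assms(1,2) i by (simp_all add: pos_divide_less_eq)
  have "frac (y + real i) = frac y"
    using frac_add_of_int_right[of y "int i"] by simp
  also have "frac y = y" using assms by (simp add: frac_eq)
  finally have "frac (y + real i) = y" .
  then show "(doubling_map ^^ n) ((y + real i) / 2 ^ n) = y"
    by (subst doubling_map_funpow_eq_frac[OF 1]) simp
qed

text \<open>
  In the form used below: under Lebesgue measure the first \<open>n\<close> binary digits are uniformly distributed
  and independent of the point to which the first \<open>n\<close> doublings lead.
\<close>

lemma unit_integral_branches:
  assumes [measurable]: "F \<in> borel_measurable borel"
  shows "unit_integral F = unit_integral (\<lambda>y. ennreal (1 / 2 ^ n) * (\<Sum>i<2 ^ n. F ((y + real i) / 2 ^ n)))"
  by (subst unit_integral_partition[OF assms, of "2 ^ n"]) (auto simp: sum_distrib_left)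

lemma unit_integral_doubling_map_funpow:
  assumes [measurable]: "F \<in> borel_measurable borel"
  shows "unit_integral (\<lambda>x. F ((doubling_map ^^ n) x)) = unit_integral F"
proof -
  have "unit_integral (\<lambda>x. F ((doubling_map ^^ n) x)) =
    unit_integral (\<lambda>y. ennreal (1 / 2 ^ n) * (\<Sum>i<2 ^ n. F ((doubling_map ^^ n) ((y + real i) / 2 ^ n))))"
    by (intro unit_integral_branches) auto
  also have "\<dots> = unit_integral F"
  proof (rule unit_integral_cong)
    fix y :: real assume y: "0 \<le> y" "y < 1"
    have "(\<Sum>i<2 ^ n. F ((doubling_map ^^ n) ((y + real i) / 2 ^ n))) = (\<Sum>i<(2::nat) ^ n. F y)"
      using doubling_map_branch(1)[OF y] by (intro sum.cong refl) auto
    also have "\<dots> = ennreal (2 ^ n) * F y"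
      using ennreal_power[of 2 n] by simp
    finally show "ennreal (1 / 2 ^ n) * (\<Sum>i<2 ^ n. F ((doubling_map ^^ n) ((y + real i) / 2 ^ n))) = F y"
      by (simp add: mult.assoc[symmetric] ennreal_mult[symmetric])
  qed
  finally show ?thesis .
qed

lemma measure_doubling_map_preimage:
  assumes [measurable]: "Measurable.pred borel P"
  shows "emeasure lborel {x \<in> {0..<1}. P ((doubling_map ^^ n) x)} = emeasure lborel {x \<in> {0..<1}. P x}"
proof -
  have "emeasure lborel {x \<in> {0..<1}. P ((doubling_map ^^ n) x)}
    = unit_integral (\<lambda>x. indicator {x. P ((doubling_map ^^ n) x)} x)"
    by (rule unit_integral_indicator[symmetric]) measurable
  also have "\<dots> = unit_integral (\<lambda>x. indicator {x. P x} ((doubling_map ^^ n) x))"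
    by (intro unit_integral_cong) (auto split: split_indicator)
  also have "\<dots> = unit_integral (\<lambda>x. indicator {x. P x} x)"
    by (rule unit_integral_doubling_map_funpow) measurable
  also have "\<dots> = emeasure lborel {x \<in> {0..<1}. P x}"
    by (rule unit_integral_indicator) measurable
  finally show ?thesis .
qed

section \<open>Large deviations at a fixed energy\<close>

text \<open>
  A Lyapunov function on the nonzero vectors of the plane for the backward recursion
  \<open>(a, b) \<mapsto> (e * a - b, a)\<close>: a negative power of the maximum norm, increased by a factor for vectors in
  the second sector, from which the next step can shrink the vector. The factor \<open>8\<close> is large enough
  for \<open>weight_contracted_pair\<close> and small enough to be outweighed by the penalty \<open>1 / 12\<close>
  that is charged for a resonant site in \<open>penalized\<close>.
\<close>

definition weight :: "real \<Rightarrow> real \<Rightarrow> real \<Rightarrow> real" where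
  "weight \<kappa> a b = (if \<bar>b\<bar> \<le> \<bar>a\<bar> then \<bar>a\<bar> powr - \<kappa> else 8 * \<bar>b\<bar> powr - \<kappa>)"

lemma weight_nonneg [simp]: "0 \<le> weight \<kappa> a b"
  by (simp add: weight_def)

lemma powr_neg_antimono: "0 < x \<Longrightarrow> x \<le> y \<Longrightarrow> 0 \<le> \<kappa> \<Longrightarrow> y powr - \<kappa> \<le> x powr - (\<kappa>::real)"
  by (intro powr_mono2') auto

lemma weight_expanding_site:
  assumes "0 < \<kappa>" "1 \<le> G" "2 * G \<le> \<bar>e\<bar>" "\<bar>b\<bar> \<le> \<bar>a\<bar>" "a \<noteq> 0"
  shows "weight \<kappa> (e * a - b) a \<le> G powr - \<kappa> * weight \<kappa> a b"
proof -
  have "2 * G * \<bar>a\<bar> \<le> \<bar>e * a\<bar>" unfolding abs_mult using assms by (intro mult_right_mono) auto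
  moreover have "\<bar>a\<bar> \<le> G * \<bar>a\<bar>" using assms by (simp add: mult_le_cancel_right1)
  ultimately have ge: "G * \<bar>a\<bar> \<le> \<bar>e * a - b\<bar>" "\<bar>a\<bar> \<le> \<bar>e * a - b\<bar>"
    using assms(4) by linarith+
  have "\<bar>e * a - b\<bar> powr - \<kappa> \<le> (G * \<bar>a\<bar>) powr - \<kappa>"
    using assms ge by (intro powr_neg_antimono) auto
  also have "\<dots> = G powr - \<kappa> * \<bar>a\<bar> powr - \<kappa>"
    by (rule powr_mult)
  finally show ?thesis using ge assms by (simp add: weight_def)
qed

lemma weight_any_site:
  assumes "0 < \<kappa>" "\<bar>b\<bar> \<le> \<bar>a\<bar>" "a \<noteq> 0"
  shows "weight \<kappa> (e * a - b) a \<le> 8 * weight \<kappa> a b"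
proof (cases "\<bar>a\<bar> \<le> \<bar>e * a - b\<bar>")
  case True
  then have "\<bar>e * a - b\<bar> powr - \<kappa> \<le> \<bar>a\<bar> powr - \<kappa>"
    using assms by (intro powr_neg_antimono) auto
  also have "\<dots> \<le> 8 * \<bar>a\<bar> powr - \<kappa>" by simp
  finally show ?thesis using True assms(2) by (simp add: weight_def)
qed (use assms in \<open>simp add: weight_def\<close>)

text \<open>
  A vector in the second sector shrinks by a factor of order \<open>D\<close> in the worst case, but only for
  values of \<open>e\<close> close to \<open>b / a\<close>. Of two values of \<open>e\<close> that are far apart at least one returns the vector
  to the first sector with at most a bounded loss. If \<open>\<kappa>\<close> is so small that \<open>(2 * D) powr \<kappa>\<close> is well
  below \<open>2\<close>, the average over the two choices decreases: \<open>101 / 100 + 8 * 101 / 75 \<le> 8 * 154 / 100\<close>.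
\<close>

lemma weight_contracted_pair:
  assumes \<kappa>: "0 < \<kappa>" and ab: "\<bar>a\<bar> < \<bar>b\<bar>"
    and e: "\<bar>e\<^sub>1\<bar> \<le> D" "\<bar>e\<^sub>2\<bar> \<le> D" "\<tau> \<le> \<bar>e\<^sub>1 - e\<^sub>2\<bar>"
    and g: "0 < g" "g \<le> 1 / 2" "g \<le> \<tau> / (4 * D)" and \<tau>: "2 \<le> \<tau>" and D: "1 \<le> D"
    and gk: "g powr - \<kappa> \<le> 101 / 100" and Dk: "(2 * D) powr \<kappa> \<le> 101 / 75"
  shows "weight \<kappa> (e\<^sub>1 * a - b) a + weight \<kappa> (e\<^sub>2 * a - b) a \<le> 154 / 100 * weight \<kappa> a b"
proof -
  let ?W = "\<bar>b\<bar> powr - \<kappa>"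
  have W: "weight \<kappa> a b = 8 * ?W" using ab by (simp add: weight_def)
  have W0: "0 \<le> ?W" by simp
  have big: "weight \<kappa> v a \<le> 101 / 100 * ?W" if "g * \<bar>b\<bar> \<le> \<bar>v\<bar>" "\<bar>a\<bar> \<le> \<bar>v\<bar>" for v
  proof -
    have "weight \<kappa> v a = \<bar>v\<bar> powr - \<kappa>" using that by (simp add: weight_def)
    also have "\<dots> \<le> (g * \<bar>b\<bar>) powr - \<kappa>"
      using that ab g \<kappa> by (intro powr_neg_antimono) auto
    also have "\<dots> = g powr - \<kappa> * ?W" by (rule powr_mult)
    also have "\<dots> \<le> 101 / 100 * ?W" using gk by (intro mult_right_mono) auto
    finally show ?thesis .
  qed
  show ?thesis
  proof (cases "2 * D * \<bar>a\<bar> \<le> \<bar>b\<bar>")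
    case True
    have v: "g * \<bar>b\<bar> \<le> \<bar>e * a - b\<bar> \<and> \<bar>a\<bar> \<le> \<bar>e * a - b\<bar>" if "\<bar>e\<bar> \<le> D" for e
    proof -
      have 1: "\<bar>e * a\<bar> \<le> D * \<bar>a\<bar>" unfolding abs_mult using that by (intro mult_right_mono) auto
      have 2: "1 * \<bar>a\<bar> \<le> D * \<bar>a\<bar>" using D by (intro mult_right_mono) auto
      have 3: "g * \<bar>b\<bar> \<le> 1 / 2 * \<bar>b\<bar>" using g by (intro mult_right_mono) auto
      show ?thesis using 1 2 3 True by linarith
    qed
    have "weight \<kappa> (e\<^sub>1 * a - b) a + weight \<kappa> (e\<^sub>2 * a - b) a \<le> 101 / 100 * ?W + 101 / 100 * ?W"
      by (intro add_mono big) (use v e in auto)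
    then show ?thesis unfolding W using W0 by linarith
  next
    case False
    then have a: "\<bar>b\<bar> < 2 * D * \<bar>a\<bar>" by simp
    have a1: "a \<noteq> 0" using a ab by auto
    have other: "weight \<kappa> v a \<le> 8 * (101 / 75 * ?W)" for v
    proof -
      have "weight \<kappa> v a \<le> 8 * \<bar>a\<bar> powr - \<kappa>"
      proof (cases "\<bar>a\<bar> \<le> \<bar>v\<bar>")
        case True
        then have "\<bar>v\<bar> powr - \<kappa> \<le> \<bar>a\<bar> powr - \<kappa>"
          using a1 \<kappa> by (intro powr_neg_antimono) auto
        also have "\<dots> \<le> 8 * \<bar>a\<bar> powr - \<kappa>" by simp
        finally show ?thesis using True by (simp add: weight_def)
      qed (simp add: weight_def)
      also have "\<bar>a\<bar> powr - \<kappa> \<le> (\<bar>b\<bar> / (2 * D)) powr - \<kappa>"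
        using a ab D \<kappa> by (intro powr_neg_antimono) (auto simp: pos_divide_le_eq mult_ac)
      also have "\<dots> = (2 * D) powr \<kappa> * ?W"
        using D by (simp add: powr_divide powr_minus divide_simps)
      also have "\<dots> \<le> 101 / 75 * ?W" using Dk by (intro mult_right_mono) auto
      finally show ?thesis by simp
    qed
    have "\<tau> * \<bar>a\<bar> \<le> \<bar>e\<^sub>1 - e\<^sub>2\<bar> * \<bar>a\<bar>" using e by (intro mult_right_mono) auto
    also have "\<dots> = \<bar>(e\<^sub>1 * a - b) - (e\<^sub>2 * a - b)\<bar>"
      by (simp add: abs_mult[symmetric] left_diff_distrib)
    finally have sep: "\<tau> * \<bar>a\<bar> / 2 \<le> \<bar>e\<^sub>1 * a - b\<bar> \<or> \<tau> * \<bar>a\<bar> / 2 \<le> \<bar>e\<^sub>2 * a - b\<bar>" by linarith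
    have 1: "2 * \<bar>a\<bar> \<le> \<tau> * \<bar>a\<bar>" using \<tau> by (intro mult_right_mono) auto
    have "g * \<bar>b\<bar> \<le> \<tau> / (4 * D) * (2 * D * \<bar>a\<bar>)"
      using g a D \<tau> by (intro mult_mono) auto
    then have 2: "g * \<bar>b\<bar> \<le> \<tau> * \<bar>a\<bar> / 2" using D by simp
    from sep show ?thesis
    proof
      assume "\<tau> * \<bar>a\<bar> / 2 \<le> \<bar>e\<^sub>1 * a - b\<bar>"
      then have "weight \<kappa> (e\<^sub>1 * a - b) a \<le> 101 / 100 * ?W" using 1 2 by (intro big) auto
      then show ?thesis using other[of "e\<^sub>2 * a - b"] W0 unfolding W by linarith
    next
      assume "\<tau> * \<bar>a\<bar> / 2 \<le> \<bar>e\<^sub>2 * a - b\<bar>"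
      then have "weight \<kappa> (e\<^sub>2 * a - b) a \<le> 101 / 100 * ?W" using 1 2 by (intro big) auto
      then show ?thesis using other[of "e\<^sub>1 * a - b"] W0 unfolding W by linarith
    qed
  qed
qed

lemma weight_lower_bound:
  assumes "0 < \<kappa>" "max \<bar>a\<bar> \<bar>b\<bar> \<le> M" "a \<noteq> 0 \<or> b \<noteq> 0"
  shows "M powr - \<kappa> \<le> weight \<kappa> a b"
proof (cases "\<bar>b\<bar> \<le> \<bar>a\<bar>")
  case True
  then show ?thesis using assms by (auto simp: weight_def intro!: powr_neg_antimono)
next
  case False
  then have "M powr - \<kappa> \<le> \<bar>b\<bar> powr - \<kappa>" using assms by (intro powr_neg_antimono) auto
  also have "\<dots> \<le> 8 * \<bar>b\<bar> powr - \<kappa>" by simp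
  finally show ?thesis using False by (simp add: weight_def)
qed

text \<open>
  The number \<open>X\<close> dominates all constants of the problem, and the coupling dominates a high power of it,
  so that every such constant is negligible against a small power of the coupling.
\<close>

locale steep_potential =
  fixes f :: "real \<Rightarrow> real" and c C X lam :: real
  assumes f_meas [measurable]: "f \<in> borel_measurable borel"
    and f_bound: "\<And>x. 0 \<le> x \<Longrightarrow> x < 1 \<Longrightarrow> \<bar>f x\<bar> \<le> C"
    and f_lipschitz: "\<And>x y. 0 \<le> x \<Longrightarrow> x < 1 \<Longrightarrow> 0 \<le> y \<Longrightarrow> y < 1 \<Longrightarrow> \<bar>f x - f y\<bar> \<le> C * \<bar>x - y\<bar>"
    and f_steep: "\<And>x y. 0 \<le> x \<Longrightarrow> x < 1 \<Longrightarrow> 0 \<le> y \<Longrightarrow> y < 1 \<Longrightarrow> c * \<bar>x - y\<bar> \<le> \<bar>f x - f y\<bar>"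
    and c_pos: "0 < c" and C_pos: "0 < C"
    and X_ge: "2 \<le> X" "2 / C \<le> X" "6 * C \<le> X" "24 * C / c \<le> X" "2 ^ 102 / c \<le> X"
    and lam_ge: "X ^ 30 \<le> lam"
begin

definition pot :: "real \<Rightarrow> nat \<Rightarrow> real" where
  "pot x n = lam * f ((doubling_map ^^ n) x)"

definition R :: real where "R = lam * C + 2"

definition D :: real where "D = 3 * C * lam"

text \<open>
  Chosen so that \<open>lam powr \<kappa> = 4 / 3\<close>: a loss of one factor \<open>lam\<close> in the norm, which occurs for at most one of
  two digits, multiplies the weight by \<open>4 / 3\<close> and so contributes less than \<open>1\<close> to the average. Constants raised
  to the power \<open>\<kappa>\<close> are close to \<open>1\<close>.
\<close>

definition \<kappa> :: real where "\<kappa> = ln (4 / 3) / ln lam"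

lemma lam_gt: "X \<le> lam" "2 ^ 30 \<le> lam"
proof -
  have "X ^ 1 \<le> X ^ 30" using X_ge(1) by (intro power_increasing) auto
  then show "X \<le> lam" using lam_ge by simp
  have "2 ^ 30 \<le> X ^ 30" using X_ge(1) by (intro power_mono) auto
  then show "2 ^ 30 \<le> lam" using lam_ge by linarith
qed

lemma lam_pos: "0 < lam" "1 < lam" using lam_gt(2) by simp_all

lemma lamC: "2 \<le> lam * C"
proof -
  have "2 / C \<le> lam" using X_ge(2) lam_gt(1) by linarith
  then show ?thesis using C_pos by (simp add: pos_divide_le_eq)
qed

lemma \<kappa>_pos: "0 < \<kappa>" using lam_pos by (simp add: \<kappa>_def)

lemma lam_powr_\<kappa>: "lam powr \<kappa> = 4 / 3"
  using lam_pos by (simp add: \<kappa>_def powr_def)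

lemma powr_\<kappa>_le: 
  assumes "0 < a" "a \<le> X"
  shows "a powr \<kappa> \<le> 101 / 100"
proof -
  have "(a powr \<kappa>) ^ 30 = a powr (real 30 * \<kappa>)"
    using assms by (intro powr_power) auto
  also have "\<dots> = (a powr 30) powr \<kappa>" by (simp add: powr_powr)
  also have "a powr 30 = a ^ 30" using assms by (intro powr_numeral) auto
  also have "(a ^ 30) powr \<kappa> \<le> lam powr \<kappa>"
  proof (rule powr_mono2)
    have "a ^ 30 \<le> X ^ 30" using assms by (intro power_mono) auto
    then show "a ^ 30 \<le> lam" using lam_ge by linarith
  qed (use assms \<kappa>_pos in auto)
  also have "\<dots> \<le> (101 / 100) ^ 30" unfolding lam_powr_\<kappa> by (simp add: field_simps)
  finally show ?thesis by (rule power_le_imp_le_base[of _ 29, simplified]) simp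
qed

lemma pot_bound: "0 \<le> x \<Longrightarrow> x < 1 \<Longrightarrow> \<bar>pot x n\<bar> \<le> lam * C"
  unfolding pot_def abs_mult using lam_pos doubling_map_funpow_range[of x n]
  by (auto intro!: mult_left_mono f_bound)

lemma energy_bound: "0 \<le> x \<Longrightarrow> x < 1 \<Longrightarrow> \<bar>E\<bar> \<le> R \<Longrightarrow> \<bar>E - pot x n\<bar> \<le> D"
proof -
  assume "0 \<le> x" "x < 1" and E: "\<bar>E\<bar> \<le> R"
  then have "\<bar>pot x n\<bar> \<le> lam * C" by (intro pot_bound)
  moreover have "D = lam * C + lam * C + lam * C" by (simp add: D_def algebra_simps)
  ultimately show ?thesis using lamC E unfolding R_def by linarith
qed

lemma shift_pot: "shift (pot x) = pot (doubling_map x)"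
  by (auto simp: shift_def pot_def funpow_swap1)

lemma pot_shift: "pot ((doubling_map ^^ m) x) n = pot x (n + m)"
  by (simp add: pot_def funpow_add)

text \<open>
  The second component of the backward recursion: the Dirichlet solution on the box without its
  first site, and \<open>0\<close> for the empty box.
\<close>

definition minor :: "real \<Rightarrow> nat \<Rightarrow> real \<Rightarrow> real" where
  "minor E n x = (case n of 0 \<Rightarrow> 0 | Suc m \<Rightarrow> dsol (pot (doubling_map x)) E m)"

lemma minor_Suc [simp]: "minor E (Suc n) x = dsol (pot (doubling_map x)) E n" "minor E 0 x = 0"
  by (simp_all add: minor_def)

lemma dsol_first_site:
  "dsol (pot x) E (Suc n) = (E - pot x 0) * dsol (pot (doubling_map x)) E n - minor E n (doubling_map x)"
proof (cases n)
  case (Suc m)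
  have s: "shift (\<lambda>k. E - V k) = (\<lambda>k. E - shift V k)" for V :: "nat \<Rightarrow> real"
    by (simp add: shift_def)
  show ?thesis
    unfolding Suc minor_Suc by (simp add: dsol_def continuant_first s shift_pot del: continuant.simps)
qed simp

lemma dsol_minor_nonzero: "dsol (pot x) E n \<noteq> 0 \<or> minor E n x \<noteq> 0"
proof (induction n arbitrary: x)
  case (Suc n)
  show ?case
    using Suc[of "doubling_map x"] unfolding dsol_first_site[of x E n] minor_Suc by auto
qed simp

lemma measurable_dsol [measurable]:
  assumes [measurable]: "g \<in> borel_measurable M" "h \<in> borel_measurable M"
  shows "(\<lambda>w. dsol (pot (g w)) (h w) n) \<in> borel_measurable M"
proof (induction n rule: induct_nat_012)
  case (ge2 n)
  note [measurable] = ge2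
  have [measurable]: "(\<lambda>w. pot (g w) (Suc n)) \<in> borel_measurable M"
    unfolding pot_def by measurable
  show ?case unfolding dsol_rec by measurable
qed (simp_all add: pot_def)

lemma measurable_minor [measurable]:
  assumes [measurable]: "g \<in> borel_measurable M" "h \<in> borel_measurable M"
  shows "(\<lambda>w. minor (h w) n (g w)) \<in> borel_measurable M"
  by (cases n) simp_all

lemma measurable_weight [measurable]:
  assumes [measurable]: "a \<in> borel_measurable M" "b \<in> borel_measurable M"
  shows "(\<lambda>w. weight k (a w) (b w)) \<in> borel_measurable M"
  unfolding weight_def by measurable

text \<open>
  Half of the threshold for a resonant site. The exponent \<open>102\<close> makes resonances so rare that the \<open>2 ^ 100\<close>
  preimages of a point under \<open>100\<close> doublings contain at most one of them.
\<close>

definition G :: real where "G = lam * c / 2 ^ 102"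

definition resonant :: "real \<Rightarrow> real \<Rightarrow> bool" where
  "resonant E x \<longleftrightarrow> \<bar>E - lam * f x\<bar> < 2 * G"

lemma measurable_resonant [measurable]: "Measurable.pred borel (resonant E)"
  unfolding resonant_def by measurable

definition resonances :: "real \<Rightarrow> nat \<Rightarrow> real \<Rightarrow> nat" where
  "resonances E n x = (\<Sum>k<n. of_bool (resonant E ((doubling_map ^^ k) x)))"

lemma resonances_Suc:
  "resonances E (Suc n) x = of_bool (resonant E x) + resonances E n (doubling_map x)"
proof -
  have "(doubling_map ^^ Suc k) x = (doubling_map ^^ k) (doubling_map x)" for k
    by (simp add: funpow_Suc_right del: funpow.simps)
  then show ?thesis
    unfolding resonances_def by (subst sum.lessThan_Suc_shift) (simp only: funpow_0)
qed

lemma measurable_resonances [measurable]: "resonances E n \<in> borel \<rightarrow>\<^sub>M count_space UNIV"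
  unfolding resonances_def of_bool_def by measurable

definition penalized :: "real \<Rightarrow> nat \<Rightarrow> real \<Rightarrow> real" where
  "penalized E n x = weight \<kappa> (dsol (pot x) E n) (minor E n x) * (1 / 12) ^ resonances E n x"

lemma measurable_penalized [measurable]: "penalized E n \<in> borel_measurable borel"
  unfolding penalized_def by measurable

lemma G_ge: "1 \<le> G" "G powr - \<kappa> \<le> 77 / 100"
proof -
  have "2 ^ 102 / c \<le> lam" using X_ge(5) lam_gt(1) by linarith
  then show "1 \<le> G" using c_pos by (simp add: G_def pos_divide_le_eq pos_le_divide_eq)
  have "G = lam / (2 ^ 102 / c)" by (simp add: G_def)
  then have "G powr - \<kappa> = (2 ^ 102 / c) powr \<kappa> / lam powr \<kappa>"
    using lam_pos c_pos by (simp only: powr_divide powr_minus) (simp add: powr_divide)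
  also have "\<dots> \<le> (101 / 100) / (4 / 3)"
    unfolding lam_powr_\<kappa> using X_ge(5) c_pos by (intro divide_right_mono powr_\<kappa>_le) auto
  also have "\<dots> \<le> 77 / 100" by simp
  finally show "G powr - \<kappa> \<le> 77 / 100" .
qed

text \<open>
  The two preimages of \<open>y\<close> share everything to the right of the first site, and their potentials at the
  first site are at least \<open>lam * c / 2\<close> apart by steepness. In the first sector a non-resonant site gains a
  factor of order \<open>lam\<close> and a resonant one is paid for by the penalty; in the second sector
  \<open>weight_contracted_pair\<close> applies.
\<close>

lemma penalized_step:
  assumes y: "0 \<le> y" "y < 1" and E: "\<bar>E\<bar> \<le> R"
  shows "penalized E (Suc n) (y / 2) + penalized E (Suc n) ((y + 1) / 2) \<le> 154 / 100 * penalized E n y"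
proof -
  let ?a = "dsol (pot y) E n" and ?b = "minor E n y" and ?p = "(1 / 12 :: real) ^ resonances E n y"
  let ?e = "\<lambda>x. E - lam * f x"
  have p: "0 \<le> ?p" by simp
  have br: "doubling_map (y / 2) = y" "doubling_map ((y + 1) / 2) = y"
    using doubling_map_branch(1)[OF y, of 0 1] doubling_map_branch(1)[OF y, of 1 1] by simp_all
  have form: "penalized E (Suc n) x =
      weight \<kappa> (?e x * ?a - ?b) ?a * ((1 / 12) ^ of_bool (resonant E x) * ?p)" if "doubling_map x = y" for x
    unfolding penalized_def dsol_first_site minor_Suc resonances_Suc that by (simp add: power_add pot_def)
  have ab: "?a \<noteq> 0 \<or> ?b \<noteq> 0" by (rule dsol_minor_nonzero)
  have fin: "w1 * (q1 * ?p) + w2 * (q2 * ?p) \<le> 154 / 100 * (w * ?p)"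
    if "w1 * q1 + w2 * q2 \<le> 154 / 100 * w" for w1 q1 w2 q2 w :: real
    using mult_right_mono[OF that p] by (simp add: algebra_simps)
  show ?thesis
    unfolding form[OF br(1)] form[OF br(2)] penalized_def[of E n y]
  proof (rule fin, cases "\<bar>?b\<bar> \<le> \<bar>?a\<bar>")
    case True
    then have a0: "?a \<noteq> 0" using ab by auto
    have one: "weight \<kappa> (?e x * ?a - ?b) ?a * (1 / 12) ^ of_bool (resonant E x) \<le> 77 / 100 * weight \<kappa> ?a ?b" for x
    proof (cases "resonant E x")
      case True
      have "weight \<kappa> (?e x * ?a - ?b) ?a \<le> 8 * weight \<kappa> ?a ?b"
        by (rule weight_any_site[OF \<kappa>_pos \<open>\<bar>?b\<bar> \<le> \<bar>?a\<bar>\<close> a0])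
      then have "weight \<kappa> (?e x * ?a - ?b) ?a * (1 / 12) \<le> 8 * weight \<kappa> ?a ?b * (1 / 12)"
        by (rule mult_right_mono) simp
      also have "\<dots> \<le> 77 / 100 * weight \<kappa> ?a ?b"
        using weight_nonneg[of \<kappa> ?a ?b] by linarith
      finally show ?thesis using True by simp
    next
      case False
      have "weight \<kappa> (?e x * ?a - ?b) ?a \<le> G powr - \<kappa> * weight \<kappa> ?a ?b"
        using False by (intro weight_expanding_site[OF \<kappa>_pos G_ge(1) _ \<open>\<bar>?b\<bar> \<le> \<bar>?a\<bar>\<close> a0])
          (simp add: resonant_def)
      also have "\<dots> \<le> 77 / 100 * weight \<kappa> ?a ?b"
        using G_ge(2) by (intro mult_right_mono) auto
      finally show ?thesis using False by simp
    qed
    show "weight \<kappa> (?e (y / 2) * ?a - ?b) ?a * (1 / 12) ^ of_bool (resonant E (y / 2))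
      + weight \<kappa> (?e ((y + 1) / 2) * ?a - ?b) ?a * (1 / 12) ^ of_bool (resonant E ((y + 1) / 2))
      \<le> 154 / 100 * weight \<kappa> ?a ?b"
      using one[of "y / 2"] one[of "(y + 1) / 2"] by linarith
  next
    case False
    define g where "g = min (1 / 2) (c / (24 * C))"
    have gpos: "0 < g" using c_pos C_pos by (simp add: g_def)
    have "weight \<kappa> (?e (y / 2) * ?a - ?b) ?a + weight \<kappa> (?e ((y + 1) / 2) * ?a - ?b) ?a
        \<le> 154 / 100 * weight \<kappa> ?a ?b"
    proof (rule weight_contracted_pair[where D = D and g = g and \<tau> = "lam * c / 2"])
      show "\<bar>?e (y / 2)\<bar> \<le> D" "\<bar>?e ((y + 1) / 2)\<bar> \<le> D"
        using energy_bound[of "y / 2" E 0] energy_bound[of "(y + 1) / 2" E 0] y E by (auto simp: pot_def)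
      have "c * \<bar>y / 2 - (y + 1) / 2\<bar> \<le> \<bar>f (y / 2) - f ((y + 1) / 2)\<bar>"
        using y by (intro f_steep) auto
      also have "\<bar>y / 2 - (y + 1) / 2\<bar> = 1 / 2" by (simp add: field_simps)
      finally have "lam * (c * (1 / 2)) \<le> lam * \<bar>f (y / 2) - f ((y + 1) / 2)\<bar>"
        using lam_pos by (intro mult_left_mono) auto
      also have "\<dots> = \<bar>lam * f (y / 2) - lam * f ((y + 1) / 2)\<bar>"
        using lam_pos by (simp add: abs_mult flip: right_diff_distrib)
      finally show "lam * c / 2 \<le> \<bar>?e (y / 2) - ?e ((y + 1) / 2)\<bar>" by (simp add: abs_minus_commute)
      show "0 < g" by (rule gpos)
      show "g \<le> 1 / 2" by (simp add: g_def)
      have "lam * c / 2 / (4 * D) = c / (24 * C)" using lam_pos by (simp add: D_def)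
      then show "g \<le> lam * c / 2 / (4 * D)" by (simp add: g_def)
      have "2 ^ 102 * 1 \<le> lam * c" using G_ge(1) by (simp add: G_def pos_le_divide_eq)
      then show "2 \<le> lam * c / 2" by simp
      have "D = 3 * (lam * C)" by (simp add: D_def)
      then show "1 \<le> D" using lamC by linarith
      have "1 / g \<le> X" using X_ge(1,4) c_pos C_pos by (auto simp: g_def min_def)
      then have "(1 / g) powr \<kappa> \<le> 101 / 100" using gpos by (intro powr_\<kappa>_le) auto
      then show "g powr - \<kappa> \<le> 101 / 100" by (simp add: powr_minus_divide powr_divide)
      have "(2 * D) powr \<kappa> = (6 * C) powr \<kappa> * lam powr \<kappa>"
        by (simp add: D_def mult.assoc flip: powr_mult)
      also have "\<dots> \<le> 101 / 100 * (4 / 3)"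
        unfolding lam_powr_\<kappa> using X_ge(3) C_pos by (intro mult_right_mono powr_\<kappa>_le) auto
      finally show "(2 * D) powr \<kappa> \<le> 101 / 75" by simp
    qed (use False \<kappa>_pos in auto)
    moreover have "w * (1 / 12) ^ of_bool P \<le> w" if "0 \<le> w" for w :: real and P
      using that by (cases P) auto
    ultimately show "weight \<kappa> (?e (y / 2) * ?a - ?b) ?a * (1 / 12) ^ of_bool (resonant E (y / 2))
      + weight \<kappa> (?e ((y + 1) / 2) * ?a - ?b) ?a * (1 / 12) ^ of_bool (resonant E ((y + 1) / 2))
      \<le> 154 / 100 * weight \<kappa> ?a ?b"
      by (smt (verit) weight_nonneg)
  qed
qed

lemma penalized_nonneg: "0 \<le> penalized E n x" by (simp add: penalized_def)

lemma integral_penalized: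
  assumes E: "\<bar>E\<bar> \<le> R"
  shows "unit_integral (\<lambda>x. ennreal (penalized E n x)) \<le> ennreal ((77 / 100) ^ n)"
proof (induction n)
  case 0
  have "penalized E 0 x = 1" for x by (simp add: penalized_def weight_def resonances_def)
  then show ?case by (simp add: unit_integral_def)
next
  case (Suc n)
  have "unit_integral (\<lambda>x. ennreal (penalized E (Suc n) x))
    = unit_integral (\<lambda>y. ennreal (1 / 2 ^ 1) * (\<Sum>i<2 ^ 1. ennreal (penalized E (Suc n) ((y + real i) / 2 ^ 1))))"
    by (rule unit_integral_branches) measurable
  also have "\<dots> \<le> unit_integral (\<lambda>y. ennreal (77 / 100) * ennreal (penalized E n y))"
  proof (rule unit_integral_mono)
    fix y :: real assume y: "0 \<le> y" "y < 1"
    have "ennreal (1 / 2 ^ 1) * (\<Sum>i<2 ^ 1. ennreal (penalized E (Suc n) ((y + real i) / 2 ^ 1)))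
      = ennreal (1 / 2) * ennreal (penalized E (Suc n) (y / 2) + penalized E (Suc n) ((y + 1) / 2))"
      by (simp add: numeral_2_eq_2 penalized_nonneg)
    also have "\<dots> = ennreal (1 / 2 * (penalized E (Suc n) (y / 2) + penalized E (Suc n) ((y + 1) / 2)))"
      by (rule ennreal_mult[symmetric]) (simp_all add: penalized_nonneg)
    also have "\<dots> \<le> ennreal (77 / 100 * penalized E n y)"
      using penalized_step[OF y E, of n] by (intro ennreal_leI) simp
    also have "\<dots> = ennreal (77 / 100) * ennreal (penalized E n y)"
      by (rule ennreal_mult) (simp_all add: penalized_nonneg)
    finally show "ennreal (1 / 2 ^ 1) * (\<Sum>i<2 ^ 1. ennreal (penalized E (Suc n) ((y + real i) / 2 ^ 1)))
      \<le> ennreal (77 / 100) * ennreal (penalized E n y)" .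
  qed
  also have "\<dots> = ennreal (77 / 100) * unit_integral (\<lambda>y. ennreal (penalized E n y))"
    by (rule unit_integral_cmult) measurable
  also have "\<dots> \<le> ennreal (77 / 100) * ennreal ((77 / 100) ^ n)"
    by (intro mult_left_mono Suc) auto
  also have "\<dots> = ennreal ((77 / 100) ^ Suc n)"
    by (simp add: ennreal_mult[symmetric])
  finally show ?case .
qed

text \<open>
  Values of \<open>f\<close> at points with different first digits are too far apart for both to be resonant.
\<close>

lemma resonant_branch_unique:
  assumes y: "0 \<le> y" "y < 1" and L: "L \<le> 100" and ij: "i < 2 ^ L" "j < 2 ^ L"
    and res: "resonant E ((y + real i) / 2 ^ L)" "resonant E ((y + real j) / 2 ^ L)"
  shows "i = j"
proof (rule ccontr)
  assume "i \<noteq> j"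
  then have d: "1 \<le> \<bar>real i - real j\<bar>" by linarith
  let ?x = "(y + real i) / 2 ^ L" and ?z = "(y + real j) / 2 ^ L"
  have "c * \<bar>?x - ?z\<bar> \<le> \<bar>f ?x - f ?z\<bar>"
    using doubling_map_branch[OF y] ij by (intro f_steep) auto
  moreover have "?x - ?z = (real i - real j) / 2 ^ L" by (simp add: diff_divide_distrib[symmetric])
  ultimately have "c * (\<bar>real i - real j\<bar> / 2 ^ L) \<le> \<bar>f ?x - f ?z\<bar>" by (simp add: abs_divide)
  moreover have "(1 / 2 ^ 100 :: real) \<le> \<bar>real i - real j\<bar> / 2 ^ L"
    using d L by (intro frac_le power_increasing) auto
  then have "c * (1 / 2 ^ 100) \<le> c * (\<bar>real i - real j\<bar> / 2 ^ L)"
    using c_pos by (intro mult_left_mono) auto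
  ultimately have "c * (1 / 2 ^ 100) \<le> \<bar>f ?x - f ?z\<bar>" by (rule order_trans[rotated])
  then have "lam * (c * (1 / 2 ^ 100)) \<le> lam * \<bar>f ?x - f ?z\<bar>"
    using lam_pos by (intro mult_left_mono) auto
  also have "\<dots> = \<bar>lam * f ?x - lam * f ?z\<bar>"
    using lam_pos by (simp add: abs_mult flip: right_diff_distrib)
  also have "\<dots> < 2 * G + 2 * G" using res unfolding resonant_def by linarith
  also have "2 * G + 2 * G = lam * (c * (1 / 2 ^ 100))" by (simp add: G_def)
  finally show False by simp
qed

text \<open>
  Only every \<open>L\<close>-th site is counted: between two counted sites there are \<open>L\<close> fresh digits, which makes the
  counted events nearly independent.
\<close>

definition sparse_resonances :: "real \<Rightarrow> nat \<Rightarrow> nat \<Rightarrow> real \<Rightarrow> nat" where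
  "sparse_resonances E L k x = (\<Sum>i<k. of_bool (resonant E ((doubling_map ^^ (L * i)) x)))"

lemma sparse_resonances_Suc:
  "sparse_resonances E L (Suc k) x = of_bool (resonant E x) + sparse_resonances E L k ((doubling_map ^^ L) x)"
proof -
  have "(doubling_map ^^ (L * Suc i)) x = (doubling_map ^^ (L * i)) ((doubling_map ^^ L) x)" for i
    by (simp only: mult_Suc_right add.commute[of L] funpow_add comp_def)
  then show ?thesis
    unfolding sparse_resonances_def
    by (subst sum.lessThan_Suc_shift) (simp only: funpow_0 mult_0_right)
qed

lemma measurable_sparse_resonances [measurable]: "sparse_resonances E L k \<in> borel \<rightarrow>\<^sub>M count_space UNIV"
  unfolding sparse_resonances_def of_bool_def by measurable

lemma sum_resonant_branches:
  assumes y: "0 \<le> y" "y < 1" and L: "L \<le> 100"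
  shows "(\<Sum>i<2 ^ L. (2::real) ^ (L * of_bool (resonant E ((y + real i) / 2 ^ L)))) \<le> 2 * 2 ^ L"
proof -
  let ?B = "{i. i < 2 ^ L \<and> resonant E ((y + real i) / 2 ^ L)}"
  have "card ?B \<le> 1"
    using resonant_branch_unique[OF y L] card_le_Suc0_iff_eq[of ?B] by auto
  have "(\<Sum>i<2 ^ L. (2::real) ^ (L * of_bool (resonant E ((y + real i) / 2 ^ L))))
     \<le> (\<Sum>i<2 ^ L. 1 + (if i \<in> ?B then 2 ^ L else 0))"
    by (intro sum_mono) auto
  also have "\<dots> = 2 ^ L + (\<Sum>i\<in>{..<2 ^ L} \<inter> ?B. 2 ^ L)"
    unfolding sum.distrib by (subst sum.inter_restrict) auto
  also have "{..<2 ^ L} \<inter> ?B = ?B" by auto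
  also have "(\<Sum>i\<in>?B. (2::real) ^ L) = real (card ?B) * 2 ^ L" by simp
  also have "\<dots> \<le> 1 * 2 ^ L" using \<open>card ?B \<le> 1\<close> by (intro mult_right_mono) auto
  finally show ?thesis by simp
qed

text \<open>
  An exponential moment. At most one of the \<open>2 ^ L\<close> digit blocks is resonant, so rewarding a resonance
  by the factor \<open>2 ^ L\<close> at most doubles the average.
\<close>

lemma integral_sparse_resonances:
  assumes L: "L \<le> 100"
  shows "unit_integral (\<lambda>x. ennreal (2 ^ (L * sparse_resonances E L k x))) \<le> ennreal (2 ^ k)"
proof (induction k)
  case 0
  show ?case by (simp add: sparse_resonances_def unit_integral_def)
next
  case (Suc k)
  let ?H = "\<lambda>k x. (2::real) ^ (L * sparse_resonances E L k x)"
  have "unit_integral (\<lambda>x. ennreal (?H (Suc k) x))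
    = unit_integral (\<lambda>y. ennreal (1 / 2 ^ L) * (\<Sum>i<2 ^ L. ennreal (?H (Suc k) ((y + real i) / 2 ^ L))))"
    by (rule unit_integral_branches) measurable
  also have "\<dots> \<le> unit_integral (\<lambda>y. ennreal 2 * ennreal (?H k y))"
  proof (rule unit_integral_mono)
    fix y :: real assume y: "0 \<le> y" "y < 1"
    have "(\<Sum>i<2 ^ L. ?H (Suc k) ((y + real i) / 2 ^ L))
      = (\<Sum>i<2 ^ L. 2 ^ (L * of_bool (resonant E ((y + real i) / 2 ^ L))) * ?H k y)"
      using doubling_map_branch(1)[OF y] unfolding sparse_resonances_Suc
      by (intro sum.cong refl) (simp add: distrib_left power_add)
    also have "\<dots> \<le> 2 * 2 ^ L * ?H k y"
      unfolding sum_distrib_right[symmetric]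
      by (intro mult_right_mono sum_resonant_branches[OF y L]) auto
    finally have "1 / 2 ^ L * (\<Sum>i<2 ^ L. ?H (Suc k) ((y + real i) / 2 ^ L)) \<le> 1 / 2 ^ L * (2 * 2 ^ L * ?H k y)"
      by (rule mult_left_mono) simp
    then have le: "1 / 2 ^ L * (\<Sum>i<2 ^ L. ?H (Suc k) ((y + real i) / 2 ^ L)) \<le> 2 * ?H k y"
      by simp
    have "ennreal (1 / 2 ^ L) * (\<Sum>i<2 ^ L. ennreal (?H (Suc k) ((y + real i) / 2 ^ L)))
      = ennreal (1 / 2 ^ L) * ennreal (\<Sum>i<2 ^ L. ?H (Suc k) ((y + real i) / 2 ^ L))"
      by (subst sum_ennreal) auto
    also have "\<dots> = ennreal (1 / 2 ^ L * (\<Sum>i<2 ^ L. ?H (Suc k) ((y + real i) / 2 ^ L)))"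
      by (rule ennreal_mult[symmetric]) (auto intro!: sum_nonneg)
    also have "\<dots> \<le> ennreal (2 * ?H k y)" using le by (rule ennreal_leI)
    also have "\<dots> = ennreal 2 * ennreal (?H k y)" by (rule ennreal_mult) auto
    finally show "ennreal (1 / 2 ^ L) * (\<Sum>i<2 ^ L. ennreal (?H (Suc k) ((y + real i) / 2 ^ L)))
      \<le> ennreal 2 * ennreal (?H k y)" .
  qed
  also have "\<dots> = ennreal 2 * unit_integral (\<lambda>y. ennreal (?H k y))"
    by (rule unit_integral_cmult) measurable
  also have "\<dots> \<le> ennreal 2 * ennreal (2 ^ k)" by (intro mult_left_mono Suc) auto
  also have "\<dots> = ennreal (2 ^ Suc k)" by (subst ennreal_mult[symmetric]) auto
  finally show ?case .
qed

lemma sparse_resonances_deviation: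
  "emeasure lborel {x \<in> {0..<1}. k \<le> 50 * sparse_resonances E 100 k x} \<le> ennreal (1 / 2 ^ k)"
proof -
  let ?H = "\<lambda>x. (2::real) ^ (100 * sparse_resonances E 100 k x)"
  have "emeasure lborel {x \<in> {0..<1}. k \<le> 50 * sparse_resonances E 100 k x}
    \<le> unit_integral (\<lambda>x. ennreal (1 / 2 ^ (2 * k)) * ennreal (?H x))"
  proof (rule unit_markov)
    fix x assume "k \<le> 50 * sparse_resonances E 100 k x"
    then have "(2::real) ^ (2 * k) \<le> ?H x" by (intro power_increasing) auto
    then have "1 \<le> 1 / 2 ^ (2 * k) * ?H x" by (simp add: pos_le_divide_eq)
    then have "ennreal 1 \<le> ennreal (1 / 2 ^ (2 * k) * ?H x)" by (rule ennreal_leI)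
    then show "1 \<le> ennreal (1 / 2 ^ (2 * k)) * ennreal (?H x)" by (subst ennreal_mult[symmetric]) auto
  qed measurable
  also have "\<dots> = ennreal (1 / 2 ^ (2 * k)) * unit_integral (\<lambda>x. ennreal (?H x))"
    by (rule unit_integral_cmult) measurable
  also have "\<dots> \<le> ennreal (1 / 2 ^ (2 * k)) * ennreal (2 ^ k)"
    by (intro mult_left_mono integral_sparse_resonances) auto
  also have "\<dots> = ennreal (1 / 2 ^ k)"
    by (subst ennreal_mult[symmetric]) (auto simp: mult_2 power_add)
  finally show ?thesis .
qed

lemma resonances_eq_sum_sparse:
  "resonances E (100 * k) x = (\<Sum>j<100. sparse_resonances E 100 k ((doubling_map ^^ j) x))"
proof -
  let ?r = "\<lambda>n. of_bool (resonant E ((doubling_map ^^ n) x)) :: nat"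
  have "resonances E (100 * k) x = sum ?r {..<k * 100}" by (simp only: resonances_def mult.commute)
  also have "\<dots> = (\<Sum>i<k. sum ?r {i * 100..<i * 100 + 100})" by (rule sum.nat_group[symmetric])
  also have "\<dots> = (\<Sum>i<k. \<Sum>j<100. ?r (100 * i + j))"
  proof (rule sum.cong[OF refl])
    fix i
    show "sum ?r {i * 100..<i * 100 + 100} = (\<Sum>j<100. ?r (100 * i + j))"
      using sum.shift_bounds_nat_ivl[of ?r 0 "i * 100" 100]
      by (simp only: add_0_left atLeast0LessThan add.commute mult.commute)
  qed
  also have "\<dots> = (\<Sum>j<100. \<Sum>i<k. ?r (100 * i + j))" by (rule sum.swap)
  finally show ?thesis unfolding sparse_resonances_def by (simp only: funpow_add comp_def)
qed

text \<open>
  At a fixed energy the backward recursion grows on a box of \<open>100 * k\<close> sites at least like \<open>lam ^ (60 * k)\<close>,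
  apart from an exponentially small set of phases. More than \<open>2 * k\<close> resonances are unlikely. With fewer of
  them and slow growth, \<open>penalized\<close> is at least \<open>(3 / 4) ^ (60 * k) * (1 / 12) ^ (2 * k)\<close>, much more than the
  bound \<open>(77 / 100) ^ (100 * k)\<close> for its mean. What matters in the end is that \<open>60\<close> exceeds half of \<open>100\<close>.
\<close>

theorem large_deviation:
  assumes E: "\<bar>E\<bar> \<le> R"
  shows "emeasure lborel {x \<in> {0..<1}.
      max \<bar>dsol (pot x) E (100 * k)\<bar> \<bar>minor E (100 * k) x\<bar> < lam ^ (60 * k)} \<le> ennreal (101 / 2 ^ k)"
proof -
  define \<theta> :: real where "\<theta> = (3 / 4) ^ 60 / 144"
  have \<theta>: "0 < \<theta>" "2 * (77 / 100) ^ 100 \<le> \<theta>" by (simp_all add: \<theta>_def power_divide)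
  let ?P = "\<lambda>x. max \<bar>dsol (pot x) E (100 * k)\<bar> \<bar>minor E (100 * k) x\<bar> < lam ^ (60 * k)"
  let ?A = "\<lambda>j. {x \<in> {0..<1}. k \<le> 50 * sparse_resonances E 100 k ((doubling_map ^^ j) x)}"
  let ?B = "{x \<in> {0..<1}. \<theta> ^ k \<le> penalized E (100 * k) x}"
  have lk: "(lam ^ (60 * k)) powr - \<kappa> = ((3 / 4) ^ 60) ^ k"
  proof -
    have "(lam ^ (60 * k)) powr - \<kappa> = (lam powr real (60 * k)) powr - \<kappa>"
      using lam_pos by (simp only: powr_realpow)
    also have "\<dots> = lam powr (real (60 * k) * - \<kappa>)" by (simp only: powr_powr)
    also have "\<dots> = (lam powr - \<kappa>) ^ (60 * k)"
      using lam_pos by (intro powr_power[symmetric]) auto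
    also have "lam powr - \<kappa> = 3 / 4" by (simp add: powr_minus lam_powr_\<kappa>)
    finally show ?thesis by (simp only: power_mult)
  qed
  have sub: "{x \<in> {0..<1}. ?P x} \<subseteq> (\<Union>j<100. ?A j) \<union> ?B"
  proof
    fix x assume "x \<in> {x \<in> {0..<1}. ?P x}"
    then have x: "x \<in> {0..<1}" and P: "?P x" by auto
    show "x \<in> (\<Union>j<100. ?A j) \<union> ?B"
    proof (rule ccontr)
      assume no: "x \<notin> (\<Union>j<100. ?A j) \<union> ?B"
      have "50 * sparse_resonances E 100 k ((doubling_map ^^ j) x) < k" if "j < 100" for j
        using no x that by (auto simp: not_le)
      then have "(\<Sum>j<100. 50 * sparse_resonances E 100 k ((doubling_map ^^ j) x)) < (\<Sum>j<(100::nat). k)"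
        by (intro sum_strict_mono) (auto simp: lessThan_empty_iff)
      then have "50 * resonances E (100 * k) x < 100 * k"
        unfolding resonances_eq_sum_sparse sum_distrib_left by simp
      then have res: "resonances E (100 * k) x \<le> 2 * k" by simp
      have "\<theta> ^ k = (lam ^ (60 * k)) powr - \<kappa> * (1 / 12) ^ (2 * k)"
        unfolding lk \<theta>_def power_divide by (simp add: power_mult power_divide)
      also have "\<dots> \<le> weight \<kappa> (dsol (pot x) E (100 * k)) (minor E (100 * k) x) * (1 / 12) ^ resonances E (100 * k) x"
        using P res \<kappa>_pos dsol_minor_nonzero[of x E "100 * k"]
        by (intro mult_mono weight_lower_bound power_decreasing) auto
      also have "\<dots> = penalized E (100 * k) x" by (simp add: penalized_def)
      finally show False using no x by auto
    qed
  qed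
  have A: "emeasure lborel (?A j) \<le> ennreal (1 / 2 ^ k)" for j
    using measure_doubling_map_preimage[of "\<lambda>x. k \<le> 50 * sparse_resonances E 100 k x" j]
      sparse_resonances_deviation[of k E] by simp
  have B: "emeasure lborel ?B \<le> ennreal (1 / 2 ^ k)"
  proof -
    have "emeasure lborel ?B \<le> unit_integral (\<lambda>x. ennreal (1 / \<theta> ^ k) * ennreal (penalized E (100 * k) x))"
    proof (rule unit_markov)
      fix x assume "\<theta> ^ k \<le> penalized E (100 * k) x"
      then have "1 \<le> 1 / \<theta> ^ k * penalized E (100 * k) x" using \<theta> by (simp add: pos_le_divide_eq)
      then have "ennreal 1 \<le> ennreal (1 / \<theta> ^ k * penalized E (100 * k) x)" by (rule ennreal_leI)
      then show "1 \<le> ennreal (1 / \<theta> ^ k) * ennreal (penalized E (100 * k) x)"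
        using \<theta> by (subst ennreal_mult[symmetric]) (auto simp: penalized_nonneg)
    qed measurable
    also have "\<dots> = ennreal (1 / \<theta> ^ k) * unit_integral (\<lambda>x. ennreal (penalized E (100 * k) x))"
      by (rule unit_integral_cmult) measurable
    also have "\<dots> \<le> ennreal (1 / \<theta> ^ k) * ennreal ((77 / 100) ^ (100 * k))"
      by (intro mult_left_mono integral_penalized[OF E]) auto
    also have "\<dots> = ennreal (1 / \<theta> ^ k * (77 / 100) ^ (100 * k))"
      using \<theta> by (intro ennreal_mult[symmetric]) auto
    also have "\<dots> \<le> ennreal (1 / 2 ^ k)"
    proof (rule ennreal_leI)
      have "2 ^ k * (77 / 100) ^ (100 * k) = (2 * (77 / 100 :: real) ^ 100) ^ k"
        by (simp only: power_mult power_mult_distrib)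
      also have "\<dots> \<le> \<theta> ^ k" using \<theta> by (intro power_mono) auto
      finally have le: "2 ^ k * (77 / 100) ^ (100 * k) \<le> \<theta> ^ k" .
      have "1 / t * q \<le> 1 / p" if "p * q \<le> t" "0 < t" "0 < p" for p q t :: real
        using that by (simp add: field_simps)
      from this[OF le] show "1 / \<theta> ^ k * (77 / 100) ^ (100 * k) \<le> 1 / 2 ^ k"
        using \<theta> by simp
    qed
    finally show ?thesis .
  qed
  have "emeasure lborel {x \<in> {0..<1}. ?P x} \<le> emeasure lborel ((\<Union>j<100. ?A j) \<union> ?B)"
    by (rule emeasure_mono[OF sub]) measurable
  also have "\<dots> \<le> emeasure lborel (\<Union>j<100. ?A j) + emeasure lborel ?B"
    by (rule emeasure_subadditive) measurable
  also have "emeasure lborel (\<Union>j<100. ?A j) \<le> (\<Sum>j<(100::nat). emeasure lborel (?A j))"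
    by (rule emeasure_subadditive_finite) auto
  also have "\<dots> \<le> (\<Sum>j<(100::nat). ennreal (1 / 2 ^ k))" by (intro sum_mono A)
  also have "\<dots> = ennreal (100 * (1 / 2 ^ k))"
    by (subst ennreal_mult) auto
  also have "\<dots> + emeasure lborel ?B \<le> ennreal (100 * (1 / 2 ^ k)) + ennreal (1 / 2 ^ k)"
    by (intro add_left_mono B)
  also have "\<dots> = ennreal (101 / 2 ^ k)"
    by (subst ennreal_plus[symmetric]) (auto simp: add_divide_distrib[symmetric])
  finally show ?thesis by simp
qed

end

section \<open>Energies at which the solution on a box is small\<close>

lemma sublevel_component:
  fixes Q :: "real poly"
  assumes "poly Q E \<le> 0" "Q \<noteq> 0" "a \<le> E"
  obtains z where "z = a \<or> poly Q z = 0" "a \<le> z" "z \<le> E" "\<And>t. z < t \<Longrightarrow> t \<le> E \<Longrightarrow> poly Q t \<le> 0"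
proof -
  define Z where "Z = insert a {z. poly Q z = 0 \<and> a \<le> z \<and> z \<le> E}"
  have fin: "finite Z"
    unfolding Z_def using poly_roots_finite[OF assms(2)] by (auto intro: finite_subset)
  define z where "z = Max Z"
  have z: "z \<in> Z" unfolding z_def by (rule Max_in) (use fin in \<open>auto simp: Z_def\<close>)
  have max: "t \<le> z" if "t \<in> Z" for t unfolding z_def using fin that by simp
  have neg: "poly Q t \<le> 0" if t: "z < t" "t \<le> E" for t
  proof (rule ccontr)
    assume "\<not> poly Q t \<le> 0"
    then have pos: "poly Q t > 0" by simp
    have "\<exists>s. t \<le> s \<and> s \<le> E \<and> poly Q s = 0"
      using IVT2'[of "poly Q" E 0 t] pos assms(1) t continuous_on_poly[OF continuous_on_id, of _ Q] by auto
    then obtain s where "t \<le> s" "s \<le> E" "poly Q s = 0" by blast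
    moreover have "a \<le> z" using max[of a] by (simp add: Z_def)
    ultimately have "s \<in> Z" using t by (auto simp: Z_def)
    then show False using max[of s] \<open>t \<le> s\<close> t by simp
  qed
  show ?thesis using that[of z] z neg assms(3) by (auto simp: Z_def)
qed

text \<open>
  A crude form of Boole's equality. The quotient of the two solutions increases with slope at least \<open>1\<close>
  between its poles, so it passes through \<open>[- \<eta>, \<eta>]\<close> within length \<open>2 * \<eta>\<close>; each passage begins at a
  zero of \<open>A\<^sup>2 - \<eta>\<^sup>2 * B\<^sup>2\<close>, a polynomial of degree \<open>2 * Suc n\<close>.
\<close>

lemma boole_inequality:
  fixes V :: "nat \<Rightarrow> real"
  assumes \<eta>: "0 < \<eta>"
  shows "emeasure lborel {E. \<bar>dsol V E (Suc n)\<bar> \<le> \<eta> * \<bar>dsol (shift V) E n\<bar>} \<le> ennreal (4 * real (Suc n) * \<eta>)"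
proof -
  let ?A = "char_poly_seq V (Suc n)" and ?B = "char_poly_seq (shift V) n"
  define Q where "Q = ?A\<^sup>2 - [:\<eta>\<^sup>2:] * ?B\<^sup>2"
  have dA: "degree (?A\<^sup>2) = 2 * Suc n"
    using degree_char_poly_seq[of V "Suc n"] by (subst degree_power_eq) auto
  have dB: "degree ([:\<eta>\<^sup>2:] * ?B\<^sup>2) \<le> 2 * n"
    using degree_char_poly_seq[of "shift V" n] degree_power_le[of ?B 2]
    by (intro order_trans[OF degree_mult_le]) (simp add: mult.commute)
  have degQ: "degree Q = 2 * Suc n"
    unfolding Q_def diff_conv_add_uminus using dA dB by (subst degree_add_eq_left) auto
  then have Q0: "Q \<noteq> 0" by auto
  have Qle: "poly Q t \<le> 0 \<longleftrightarrow> \<bar>dsol V t (Suc n)\<bar> \<le> \<eta> * \<bar>dsol (shift V) t n\<bar>" for t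
  proof -
    have "poly Q t = (dsol V t (Suc n))\<^sup>2 - (\<eta> * dsol (shift V) t n)\<^sup>2"
      by (simp add: Q_def poly_power poly_char power_mult_distrib del: dsol_rec)
    then show ?thesis
      using \<eta> abs_le_square_iff[of "dsol V t (Suc n)" "\<eta> * dsol (shift V) t n"] by (simp add: abs_mult del: dsol_rec)
  qed
  let ?Z = "{z. poly Q z = 0}"
  have finZ: "finite ?Z" by (rule poly_roots_finite[OF Q0])
  have cardZ: "card ?Z \<le> 2 * Suc n" using card_poly_roots_bound[OF Q0] degQ by simp
  have cover: "\<exists>z\<in>?Z. z \<le> E \<and> E \<le> z + 2 * \<eta>" if E: "poly Q E \<le> 0" for E
  proof -
    \<comment> \<open>Starting more than \<open>2 * \<eta>\<close> to the left excludes that the component reaches the starting point.\<close>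
    have "E - 2 * \<eta> - 1 \<le> E" using \<eta> by simp
    from sublevel_component[OF E Q0 this] obtain z where
      z: "z = E - 2 * \<eta> - 1 \<or> poly Q z = 0" "z \<le> E" "\<And>t. z < t \<Longrightarrow> t \<le> E \<Longrightarrow> poly Q t \<le> 0" by blast
    let ?W = "\<lambda>t. poly (pderiv ?A) t * poly ?B t - poly ?A t * poly (pderiv ?B) t"
    have W1: "1 \<le> ?W t" and WB: "(poly ?B t)\<^sup>2 \<le> ?W t" for t
    proof -
      let ?g = "\<lambda>j. (dsol (\<lambda>k. V (k + Suc j)) t (n - j))\<^sup>2"
      have "sum ?g {n} \<le> sum ?g {..n}" "sum ?g {0} \<le> sum ?g {..n}"
        by (rule sum_mono2; simp)+
      then show "1 \<le> ?W t" "(poly ?B t)\<^sup>2 \<le> ?W t"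
        unfolding wronskian_sum_squares by (simp_all add: poly_char shift_def)
    qed
    have B0: "poly ?B t \<noteq> 0" if "z < t" "t \<le> E" for t
    proof
      assume B: "poly ?B t = 0"
      then have "poly ?A t = 0"
        using Qle[of t] z(3)[OF that] by (simp add: poly_char del: dsol_rec)
      then show False using W1[of t] B by simp
    qed
    define s where "s t = poly ?A t / poly ?B t" for t
    have s: "\<bar>s t\<bar> \<le> \<eta>" if "z < t" "t \<le> E" for t
      using Qle[of t] z(3)[OF that] B0[OF that]
      by (simp add: s_def abs_divide pos_divide_le_eq poly_char del: dsol_rec)
    have close: "E - e \<le> 2 * \<eta>" if e: "z < e" "e < E" for e
    proof -
      have "\<exists>x>e. x < E \<and> s E - s e = (E - e) * (?W x / (poly ?B x)\<^sup>2)"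
      proof (rule MVT2[OF e(2)])
        fix x assume "e \<le> x" "x \<le> E"
        then have "poly ?B x \<noteq> 0" using e B0 by auto
        then show "(s has_real_derivative ?W x / (poly ?B x)\<^sup>2) (at x)"
          unfolding s_def by (auto intro!: derivative_eq_intros simp: power2_eq_square)
      qed
      then obtain x where x: "e < x" "x < E" "s E - s e = (E - e) * (?W x / (poly ?B x)\<^sup>2)" by blast
      have "(poly ?B x)\<^sup>2 > 0" using B0[of x] e x by simp
      then have "1 \<le> ?W x / (poly ?B x)\<^sup>2" using WB[of x] by (simp add: pos_le_divide_eq)
      then have "(E - e) * 1 \<le> s E - s e" unfolding x(3) using e by (intro mult_left_mono) auto
      then show ?thesis using s[of E] s[of e] e by auto
    qed
    have "E - z \<le> 2 * \<eta>"
    proof (rule ccontr)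
      assume "\<not> E - z \<le> 2 * \<eta>"
      then show False using close[of "(z + (E - 2 * \<eta>)) / 2"] \<eta> by (simp add: field_simps)
    qed
    then show ?thesis using z by (intro bexI[of _ z]) auto
  qed
  have "emeasure lborel {E. \<bar>dsol V E (Suc n)\<bar> \<le> \<eta> * \<bar>dsol (shift V) E n\<bar>} \<le> emeasure lborel (\<Union>z\<in>?Z. {z..z + 2 * \<eta>})"
    by (rule emeasure_mono) (use cover Qle finZ in auto)
  also have "\<dots> \<le> (\<Sum>z\<in>?Z. emeasure lborel {z..z + 2 * \<eta>})"
    by (rule emeasure_subadditive_finite[OF finZ]) auto
  also have "\<dots> = ennreal (real (card ?Z) * (2 * \<eta>))"
    using \<eta> by (simp add: ennreal_mult ennreal_of_nat_eq_real_of_nat)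
  also have "\<dots> \<le> ennreal (4 * real (Suc n) * \<eta>)"
  proof (rule ennreal_leI)
    have "real (card ?Z) \<le> 2 * real (Suc n)" using cardZ by linarith
    then have "real (card ?Z) * (2 * \<eta>) \<le> 2 * real (Suc n) * (2 * \<eta>)" using \<eta> by (intro mult_right_mono) auto
    then show "real (card ?Z) * (2 * \<eta>) \<le> 4 * real (Suc n) * \<eta>" by (simp add: algebra_simps)
  qed
  finally show ?thesis .
qed

lemma summable_linear_over_power2: "summable (\<lambda>k. (a + b * real k) / 2 ^ k)"
proof -
  have "summable (\<lambda>k. a * (1 / 2) ^ k + b * (real k / 2 ^ k))"
  proof (intro summable_add summable_mult)
    show "summable (\<lambda>k. (1 / 2 :: real) ^ k)" by (rule summable_geometric) simp
    show "summable (\<lambda>k. real k / 2 ^ k)"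
    proof (rule summable_comparison_test'[where N = 0])
      show "summable (\<lambda>k. 2 * (3 / 4 :: real) ^ k)" by (intro summable_mult summable_geometric) simp
      show "norm (real k / 2 ^ k) \<le> 2 * (3 / 4) ^ k" for k
      proof -
        have "1 + real k * (1 / 2) \<le> (1 + 1 / 2) ^ k" by (rule Bernoulli_inequality) simp
        then have "real k \<le> 2 * (3 / 2) ^ k" by simp
        then have "real k / 2 ^ k \<le> 2 * (3 / 2) ^ k / 2 ^ k" by (rule divide_right_mono) simp
        also have "\<dots> = 2 * ((3 / 2) / 2) ^ k" by (simp only: power_divide times_divide_eq_right)
        finally show ?thesis by simp
      qed
    qed
  qed
  moreover have "(a + b * real k) / 2 ^ k = a * (1 / 2) ^ k + b * (real k / 2 ^ k)" for k
    by (simp add: add_divide_distrib power_one_over)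
  ultimately show ?thesis by simp
qed

lemma unit_integral_const: "unit_integral (\<lambda>x. a) = a"
  by (simp add: unit_integral_def nn_integral_cmult_indicator)

lemma borel_cantelli_unit:
  fixes P :: "nat \<Rightarrow> real \<Rightarrow> bool"
  assumes [measurable]: "\<And>j::nat. Measurable.pred borel (P j)"
    and le: "\<And>j. emeasure lborel {x \<in> {0..<1}. P j x} \<le> ennreal ((a + b * real j) / 2 ^ j)"
    and ab: "0 \<le> a" "0 \<le> b"
  shows "AE x in lborel. x \<in> {0..<1} \<longrightarrow> (\<forall>\<^sub>F j in sequentially. \<not> P j x)"
proof -
  let ?A = "\<lambda>j. {x \<in> {0..<1::real}. P j x}"
  have fin: "emeasure lborel (?A j) < \<infinity>" for j using le[of j] by (auto intro: le_less_trans)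
  have "AE x in lborel. \<forall>\<^sub>F j in sequentially. x \<in> space lborel - ?A j"
  proof (rule borel_cantelli_AE1)
    show "summable (\<lambda>j. measure lborel (?A j))"
    proof (rule summable_comparison_test'[OF summable_linear_over_power2[of a b], of 0])
      fix j
      have "0 \<le> (a + b * real j) / 2 ^ j" using ab by simp
      then show "norm (measure lborel (?A j)) \<le> (a + b * real j) / 2 ^ j"
        using enn2real_mono[OF le[of j]] by (simp add: measure_def)
    qed
  qed (use fin in auto)
  then show ?thesis
    by eventually_elim (auto elim: eventually_mono)
qed

context steep_potential
begin

lemma R_pos: "0 < R" using lamC by (simp add: R_def)

text \<open>
  Energies at which the solution has failed to grow by the end of the box. They include every energy
  with a linearly bounded solution, once the box is long.
\<close>

definition low_energies :: "nat \<Rightarrow> real \<Rightarrow> real set" where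
  "low_energies k x = {E. \<bar>E\<bar> \<le> R \<and> \<bar>dsol (pot x) E (100 * k)\<bar> \<le> 2 ^ k}"

lemma measurable_emeasure_section:
  assumes [measurable]: "Measurable.pred (borel \<Otimes>\<^sub>M borel) (\<lambda>w::real \<times> real. P (fst w) (snd w))"
  shows "(\<lambda>x. emeasure lborel {E. P x E}) \<in> borel_measurable borel"
    and "{E. P x E} \<in> sets borel"
proof -
  have [measurable]: "Measurable.pred borel (P x)" for x
  proof -
    have "(\<lambda>E. (x, E)) \<in> borel \<rightarrow>\<^sub>M borel \<Otimes>\<^sub>M borel" by measurable
    from measurable_compose[OF this assms] show ?thesis by simp
  qed
  show "{E. P x E} \<in> sets borel" by measurable
  have "emeasure lborel {E. P x E} = (\<integral>\<^sup>+E. indicator {w. P (fst w) (snd w)} (x, E) \<partial>lborel)" for x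
  proof -
    have "emeasure lborel {E. P x E} = (\<integral>\<^sup>+E. indicator {E. P x E} E \<partial>lborel)"
      by (rule nn_integral_indicator[symmetric]) measurable
    also have "\<dots> = (\<integral>\<^sup>+E. indicator {w. P (fst w) (snd w)} (x, E) \<partial>lborel)"
      by (intro nn_integral_cong) (auto split: split_indicator)
    finally show ?thesis .
  qed
  moreover have "(\<lambda>x. \<integral>\<^sup>+E. indicator {w. P (fst w) (snd w)} (x, E) \<partial>lborel) \<in> borel_measurable borel"
  proof -
    have "{w \<in> space (borel \<Otimes>\<^sub>M borel). P (fst w) (snd w)} \<in> sets (borel \<Otimes>\<^sub>M borel)"
      by measurable
    then have [measurable]: "{w. P (fst w) (snd w)} \<in> sets (borel \<Otimes>\<^sub>M borel)" by (simp add: space_pair_measure)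
    show ?thesis by measurable
  qed
  ultimately show "(\<lambda>x. emeasure lborel {E. P x E}) \<in> borel_measurable borel" by simp
qed

lemma unit_integral_section:
  assumes [measurable]: "Measurable.pred (borel \<Otimes>\<^sub>M borel) (\<lambda>w::real \<times> real. P (fst w) (snd w))"
    and le: "\<And>E. \<bar>E\<bar> \<le> R \<Longrightarrow> emeasure lborel {x \<in> {0..<1}. P x E} \<le> ennreal \<delta>"
    and \<delta>: "0 \<le> \<delta>"
  shows "unit_integral (\<lambda>x. emeasure lborel {E. \<bar>E\<bar> \<le> R \<and> P x E}) \<le> ennreal (2 * R * \<delta>)"
proof -
  let ?S = "{w :: real \<times> real. (0 \<le> fst w \<and> fst w < 1) \<and> \<bar>snd w\<bar> \<le> R \<and> P (fst w) (snd w)}"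
  have PR: "Measurable.pred (borel \<Otimes>\<^sub>M borel) (\<lambda>w::real \<times> real. \<bar>snd w\<bar> \<le> R \<and> P (fst w) (snd w))"
    by measurable
  have "{w \<in> space (borel \<Otimes>\<^sub>M borel). w \<in> ?S} \<in> sets (borel \<Otimes>\<^sub>M borel)" by measurable
  then have S [measurable]: "?S \<in> sets (borel \<Otimes>\<^sub>M borel)" by (simp add: space_pair_measure)
  have "unit_integral (\<lambda>x. emeasure lborel {E. \<bar>E\<bar> \<le> R \<and> P x E})
      = (\<integral>\<^sup>+x. (\<integral>\<^sup>+E. indicator ?S (x, E) \<partial>lborel) \<partial>lborel)"
    unfolding unit_integral_def
  proof (intro nn_integral_cong)
    fix x :: real
    have "emeasure lborel {E. \<bar>E\<bar> \<le> R \<and> P x E} = (\<integral>\<^sup>+E. indicator {E. \<bar>E\<bar> \<le> R \<and> P x E} E \<partial>lborel)"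
      by (rule nn_integral_indicator[symmetric]) (use measurable_emeasure_section(2)[OF PR, of x] in simp)
    then have "emeasure lborel {E. \<bar>E\<bar> \<le> R \<and> P x E} * indicator {0..<1} x
      = (\<integral>\<^sup>+E. indicator {E. \<bar>E\<bar> \<le> R \<and> P x E} E \<partial>lborel) * indicator {0..<1} x" by simp
    also have "\<dots> = (\<integral>\<^sup>+E. indicator ?S (x, E) \<partial>lborel)"
    proof (cases "0 \<le> x \<and> x < 1")
      case True
      then have "(\<integral>\<^sup>+E. indicator {E. \<bar>E\<bar> \<le> R \<and> P x E} E \<partial>lborel) = (\<integral>\<^sup>+E. indicator ?S (x, E) \<partial>lborel)"
        by (intro nn_integral_cong) (auto split: split_indicator)
      then show ?thesis using True by simp
    next
      case False
      then have "indicator ?S (x, E) = (0 :: ennreal)" for E by (auto split: split_indicator)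
      then show ?thesis using False by simp
    qed
    finally show "emeasure lborel {E. \<bar>E\<bar> \<le> R \<and> P x E} * indicator {0..<1} x
      = (\<integral>\<^sup>+E. indicator ?S (x, E) \<partial>lborel)" .
  qed
  also have "\<dots> = (\<integral>\<^sup>+E. (\<integral>\<^sup>+x. indicator ?S (x, E) \<partial>lborel) \<partial>lborel)"
    by (rule lborel_pair.Fubini'[symmetric]) (use S in simp)
  also have "\<dots> \<le> (\<integral>\<^sup>+E. ennreal \<delta> * indicator {-R..R} E \<partial>lborel)"
  proof (intro nn_integral_mono)
    fix E :: real
    show "(\<integral>\<^sup>+x. indicator ?S (x, E) \<partial>lborel) \<le> ennreal \<delta> * indicator {-R..R} E"
    proof (cases "\<bar>E\<bar> \<le> R")
      case True
      have [measurable]: "Measurable.pred borel (\<lambda>x. P x E)"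
      proof -
        have "(\<lambda>x. (x, E)) \<in> borel \<rightarrow>\<^sub>M borel \<Otimes>\<^sub>M borel" by measurable
        from measurable_compose[OF this assms(1)] show ?thesis by simp
      qed
      have "(\<integral>\<^sup>+x. indicator ?S (x, E) \<partial>lborel) = (\<integral>\<^sup>+x. indicator {x \<in> {0..<1}. P x E} x \<partial>lborel)"
        using True by (intro nn_integral_cong) (auto split: split_indicator)
      also have "\<dots> = emeasure lborel {x \<in> {0..<1}. P x E}"
        by (rule nn_integral_indicator) measurable
      also have "\<dots> \<le> ennreal \<delta>" by (rule le[OF True])
      finally show ?thesis using True by (simp add: abs_le_iff)
    next
      case False
      then have "indicator ?S (x, E) = (0 :: ennreal)" for x by (auto split: split_indicator)
      then show ?thesis by simp
    qed
  qed
  also have "\<dots> = ennreal \<delta> * ennreal (2 * R)"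
    using R_pos by (simp add: nn_integral_cmult_indicator)
  also have "\<dots> = ennreal (2 * R * \<delta>)"
    using R_pos \<delta> by (simp add: ennreal_mult[symmetric] mult.commute)
  finally show ?thesis .
qed

lemma pred_low_energies [measurable]:
  "Measurable.pred (borel \<Otimes>\<^sub>M borel) (\<lambda>w. \<bar>snd w\<bar> \<le> R \<and> \<bar>dsol (pot (fst w)) (snd w) (100 * k)\<bar> \<le> 2 ^ k)"
  by measurable

lemma measurable_low_energies [measurable]:
  "(\<lambda>x. emeasure lborel (low_energies k x)) \<in> borel_measurable borel" "low_energies k x \<in> sets borel"
  unfolding low_energies_def by (rule measurable_emeasure_section[OF pred_low_energies])+

text \<open>
  Fubini's theorem turns the estimate at fixed energy into one for fixed phase. The large deviation
  bound controls the maximum of the solution and of its minor; where only the minor is large, the solution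
  is small relative to it, and Boole's inequality bounds the measure of those energies.
\<close>

lemma integral_low_energies:
  "unit_integral (\<lambda>x. emeasure lborel (low_energies k x)) \<le> ennreal ((202 * R + 400 * real k) / 2 ^ k)"
proof (cases "k = 0")
  case True
  have "low_energies k x = {-R..R}" for x by (auto simp: low_energies_def True)
  then have "unit_integral (\<lambda>x. emeasure lborel (low_energies k x)) = ennreal (2 * R)"
    using R_pos by (simp add: unit_integral_const)
  also have "\<dots> \<le> ennreal ((202 * R + 400 * real k) / 2 ^ k)"
    using R_pos by (intro ennreal_leI) (simp add: True)
  finally show ?thesis .
next
  case False
  define n where "n = 100 * k - 1"
  have n: "100 * k = Suc n" using False by (simp add: n_def)
  define small where "small x E \<longleftrightarrow> max \<bar>dsol (pot x) E (100 * k)\<bar> \<bar>minor E (100 * k) x\<bar> < lam ^ (60 * k)" for x E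
  have small_pred: "Measurable.pred (borel \<Otimes>\<^sub>M borel) (\<lambda>w. small (fst w) (snd w))"
    unfolding small_def by measurable
  have small_R_pred: "Measurable.pred (borel \<Otimes>\<^sub>M borel) (\<lambda>w. \<bar>snd w\<bar> \<le> R \<and> small (fst w) (snd w))"
    using small_pred by measurable
  have big: "(2::real) ^ k * 2 ^ k < lam ^ (60 * k)"
  proof -
    have "(2::real) ^ k * 2 ^ k = 2 ^ (2 * k)" by (simp add: mult_2 power_add)
    also have "\<dots> < 2 ^ (60 * k)" using False by (intro power_strict_increasing) auto
    also have "\<dots> \<le> lam ^ (60 * k)" using lam_gt(2) by (intro power_mono) auto
    finally show ?thesis .
  qed
  let ?B = "\<lambda>x. {E. \<bar>dsol (pot x) E (Suc n)\<bar> \<le> (1 / 2 ^ k) * \<bar>dsol (shift (pot x)) E n\<bar>}"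
  have Bm: "?B x \<in> sets borel" for x
  proof -
    have "?B x = {E. \<bar>dsol (pot x) E (Suc n)\<bar> \<le> (1 / 2 ^ k) * \<bar>dsol (pot (doubling_map x)) E n\<bar>}"
      by (simp add: shift_pot)
    also have "\<dots> \<in> sets borel" by measurable
    finally show ?thesis .
  qed
  have "emeasure lborel (low_energies k x) \<le> emeasure lborel {E. \<bar>E\<bar> \<le> R \<and> small x E} + ennreal (400 * real k / 2 ^ k)" for x
  proof -
    have "low_energies k x \<subseteq> {E. \<bar>E\<bar> \<le> R \<and> small x E} \<union> ?B x"
    proof
      fix E assume E: "E \<in> low_energies k x"
      show "E \<in> {E. \<bar>E\<bar> \<le> R \<and> small x E} \<union> ?B x"
      proof (rule ccontr)
        assume no: "E \<notin> {E. \<bar>E\<bar> \<le> R \<and> small x E} \<union> ?B x"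
        let ?a = "\<bar>dsol (pot x) E (Suc n)\<bar>" and ?b = "\<bar>minor E (Suc n) x\<bar>"
        have a: "?a \<le> 2 ^ k" using E by (simp add: low_energies_def n)
        have "lam ^ (60 * k) \<le> max ?a ?b" using E no by (auto simp: low_energies_def small_def n not_less)
        moreover have "?b < 2 ^ k * ?a"
          using no by (simp add: shift_pot not_le pos_divide_less_eq mult.commute del: dsol_rec)
        moreover have "2 ^ k * ?a \<le> 2 ^ k * 2 ^ k" using a by (intro mult_left_mono) auto
        moreover have "(2::real) ^ k \<le> 2 ^ k * 2 ^ k" by simp
        ultimately show False using big a by linarith
      qed
    qed
    then have "emeasure lborel (low_energies k x) \<le> emeasure lborel ({E. \<bar>E\<bar> \<le> R \<and> small x E} \<union> ?B x)"
      using measurable_emeasure_section(2)[OF small_R_pred, of x] Bm[of x]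
      by (intro emeasure_mono) auto
    also have "\<dots> \<le> emeasure lborel {E. \<bar>E\<bar> \<le> R \<and> small x E} + emeasure lborel (?B x)"
      using measurable_emeasure_section(2)[OF small_R_pred, of x] Bm[of x]
      by (intro emeasure_subadditive) auto
    also have "emeasure lborel (?B x) \<le> ennreal (4 * real (Suc n) * (1 / 2 ^ k))"
      by (rule boole_inequality) simp
    also have "4 * real (Suc n) * (1 / 2 ^ k) = 400 * real k / 2 ^ k"
      unfolding n[symmetric] by simp
    finally show ?thesis by (simp add: add_left_mono)
  qed
  then have "unit_integral (\<lambda>x. emeasure lborel (low_energies k x))
    \<le> unit_integral (\<lambda>x. emeasure lborel {E. \<bar>E\<bar> \<le> R \<and> small x E} + ennreal (400 * real k / 2 ^ k))"
    by (intro unit_integral_mono) auto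
  also have "\<dots> = unit_integral (\<lambda>x. emeasure lborel {E. \<bar>E\<bar> \<le> R \<and> small x E})
      + unit_integral (\<lambda>x. ennreal (400 * real k / 2 ^ k))"
    unfolding unit_integral_def distrib_right
    using measurable_emeasure_section(1)[OF small_R_pred] by (intro nn_integral_add) auto
  also have "\<dots> \<le> ennreal (2 * R * (101 / 2 ^ k)) + ennreal (400 * real k / 2 ^ k)"
  proof (rule add_mono)
    show "unit_integral (\<lambda>x. emeasure lborel {E. \<bar>E\<bar> \<le> R \<and> small x E}) \<le> ennreal (2 * R * (101 / 2 ^ k))"
      by (rule unit_integral_section[OF small_pred]) (use large_deviation in \<open>auto simp: small_def\<close>)
  qed (simp add: unit_integral_const)
  also have "\<dots> = ennreal ((202 * R + 400 * real k) / 2 ^ k)"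
    using R_pos by (subst ennreal_plus[symmetric]) (auto simp: add_divide_distrib)
  finally show ?thesis .
qed

lemma AE_low_energies_small:
  "AE x in lborel. x \<in> {0..<1} \<longrightarrow>
    (\<forall>\<^sub>F j in sequentially. \<not> ennreal (1 / 2 ^ j) \<le> emeasure lborel (low_energies (2 * j) x))"
proof (rule borel_cantelli_unit[where a = "202 * R" and b = 800])
  fix j :: nat
  have "emeasure lborel {x \<in> {0..<1}. ennreal (1 / 2 ^ j) \<le> emeasure lborel (low_energies (2 * j) x)}
    \<le> unit_integral (\<lambda>x. ennreal (2 ^ j) * emeasure lborel (low_energies (2 * j) x))"
  proof (rule unit_markov)
    fix x assume "ennreal (1 / 2 ^ j) \<le> emeasure lborel (low_energies (2 * j) x)"
    then have "ennreal (2 ^ j) * ennreal (1 / 2 ^ j) \<le> ennreal (2 ^ j) * emeasure lborel (low_energies (2 * j) x)"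
      by (rule mult_left_mono) simp
    then show "1 \<le> ennreal (2 ^ j) * emeasure lborel (low_energies (2 * j) x)"
      by (simp add: ennreal_mult[symmetric])
  qed measurable
  also have "\<dots> = ennreal (2 ^ j) * unit_integral (\<lambda>x. emeasure lborel (low_energies (2 * j) x))"
    by (rule unit_integral_cmult) measurable
  also have "\<dots> \<le> ennreal (2 ^ j) * ennreal ((202 * R + 400 * real (2 * j)) / 2 ^ (2 * j))"
    by (intro mult_left_mono integral_low_energies) auto
  also have "\<dots> = ennreal (2 ^ j * ((202 * R + 400 * real (2 * j)) / 2 ^ (2 * j)))"
    using R_pos by (intro ennreal_mult[symmetric]) auto
  also have "2 ^ j * ((202 * R + 400 * real (2 * j)) / 2 ^ (2 * j)) = (202 * R + 800 * real j) / 2 ^ j"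
  proof -
    have sq: "(2::real) ^ (2 * j) = 2 ^ j * 2 ^ j" by (simp only: mult_2 power_add)
    have "p * (s / (p * p)) = s / p" if "p \<noteq> 0" for p s :: real
      using that by simp
    from this[of "2 ^ j"] show ?thesis unfolding sq by simp
  qed
  finally show "emeasure lborel {x \<in> {0..<1}. ennreal (1 / 2 ^ j) \<le> emeasure lborel (low_energies (2 * j) x)}
    \<le> ennreal ((202 * R + 800 * real j) / 2 ^ j)" .
qed (use R_pos in auto)

end

section \<open>Elimination of the energy\<close>

lemma real_le_two_power: "real n \<le> 2 ^ n"
  using of_nat_mono[OF less_imp_le[OF less_exp[of n]], where 'a = real] by simp

text \<open>
  Two points with the same first \<open>n\<close> digits are separated exactly by the factor \<open>2\<close> in each of the first
  \<open>n\<close> steps, without wrapping around.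
\<close>

lemma doubling_map_funpow_same_cell:
  assumes y: "0 \<le> y" "y < 1" and i: "i < 2 ^ n" and m: "m \<le> n"
  shows "(doubling_map ^^ m) ((y + real i) / 2 ^ n) - (doubling_map ^^ m) (real i / 2 ^ n) = y * 2 ^ m / 2 ^ n"
proof -
  have br: "0 \<le> (y + real i) / 2 ^ n" "(y + real i) / 2 ^ n < 1" "0 \<le> (0 + real i) / 2 ^ n" "(0 + real i) / 2 ^ n < 1"
    using doubling_map_branch(2,3)[OF y i] doubling_map_branch(2,3)[OF _ _ i, of 0] by auto
  define d :: nat where "d = 2 ^ (n - m)"
  have "real d = 2 ^ (n - m)" by (simp add: d_def)
  also have "\<dots> = 2 ^ n / 2 ^ m" using m by (intro power_diff) auto
  finally have d: "0 < d" "real d = 2 ^ n / 2 ^ m" by (simp_all add: d_def)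
  have sc: "2 ^ m * (t / 2 ^ n) = t / real d" for t :: real by (simp add: d)
  have fl: "\<lfloor>(t + real i) / real d\<rfloor> = int (i div d)" if t: "0 \<le> t" "t < 1" for t
  proof (rule floor_unique)
    have "real (i div d * d) \<le> real i" by (intro of_nat_mono) (simp add: times_div_less_eq_dividend)
    then show "real_of_int (int (i div d)) \<le> (t + real i) / real d"
      using d(1) t by (simp add: pos_le_divide_eq)
    have "Suc i \<le> (i div d + 1) * d"
      using d(1) by (metis Suc_leI add.commute dividend_less_div_times mult.commute mult_Suc_right plus_1_eq_Suc)
    then have "real (Suc i) \<le> real ((i div d + 1) * d)" by (intro of_nat_mono)
    then show "(t + real i) / real d < real_of_int (int (i div d)) + 1"
      using d(1) t by (simp add: pos_divide_less_eq algebra_simps)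
  qed
  have fl0: "\<lfloor>(0 + real i) / real d\<rfloor> = int (i div d)" by (rule fl) auto
  have p1: "(doubling_map ^^ m) ((y + real i) / 2 ^ n) = (y + real i) / real d - real (i div d)"
    unfolding doubling_map_funpow_eq_frac[OF br(1,2)] sc frac_def fl[OF y] by simp
  have p2: "(doubling_map ^^ m) ((0 + real i) / 2 ^ n) = (0 + real i) / real d - real (i div d)"
    unfolding doubling_map_funpow_eq_frac[OF br(3,4)] sc frac_def fl0 by simp
  have "(y + real i) / real d - (0 + real i) / real d = y * 2 ^ m / 2 ^ n"
    unfolding diff_divide_distrib[symmetric] by (simp add: d(2))
  then show ?thesis using p1 p2 by simp
qed

lemma linear_times_halving_exp_decay:
  assumes q: "0 < (q::nat)"
  shows "\<exists>C>0. \<exists>\<alpha>>0. \<forall>n. (real n + 1) / 2 ^ (n div q) \<le> C * exp (- \<alpha> * real n)"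
proof -
  have "(real n + 1) / 2 ^ (n div q) \<le> 4 * real q * exp (- (ln (4 / 3) / real q) * real n)" for n
  proof -
  define k where "k = n div q"
  have n: "real n + 1 \<le> real q * (real k + 1)"
  proof -
    have "Suc n \<le> q * (k + 1)"
      unfolding k_def using q by (metis Suc_leI add.commute dividend_less_times_div mult_Suc_right plus_1_eq_Suc)
    then have "real (Suc n) \<le> real (q * (k + 1))" by (intro of_nat_mono)
    then show ?thesis by (simp add: algebra_simps)
  qed
  have "1 + real k * (1 / 2) \<le> (1 + 1 / 2) ^ k" by (rule Bernoulli_inequality) simp
  moreover have "1 \<le> (3 / 2 :: real) ^ k" by simp
  ultimately have k: "real k + 1 \<le> 3 * (3 / 2) ^ k" by simp
  have "(real n + 1) / 2 ^ k \<le> real q * (3 * (3 / 2) ^ k) / 2 ^ k"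
    using n mult_left_mono[OF k, of "real q"] by (intro divide_right_mono) auto
  also have "\<dots> = 3 * real q * ((3 / 2) / 2) ^ k" by (simp only: power_divide) simp
  also have "((3 / 2) / 2 :: real) ^ k = exp (- ln (4 / 3) * real k)"
  proof -
    have e: "exp (- ln (4 / 3)) = (3 / 4 :: real)" by (simp add: exp_minus)
    show ?thesis unfolding exp_of_nat2_mult e by simp
  qed
  also have "\<dots> \<le> exp (- ln (4 / 3) * (real n / real q - 1))"
  proof -
    have "real n / real q \<le> real k + 1" using n q by (simp add: pos_divide_le_eq mult.commute)
    then show ?thesis by (simp add: mult_left_mono)
  qed
  also have "\<dots> = exp (ln (4 / 3)) * exp (- (ln (4 / 3) / real q) * real n)"
    unfolding exp_add[symmetric] by (simp add: algebra_simps)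
  also have "exp (ln (4 / 3)) = (4 / 3 :: real)" by simp
  finally show ?thesis
    using q by (simp add: k_def mult_left_mono)
  qed
  moreover have "0 < ln (4 / 3) / real q" "0 < 4 * real q" using q by simp_all
  ultimately show ?thesis by blast
qed

context steep_potential
begin

text \<open>
  \<open>2 ^ growth_bits\<close> bounds the growth of solutions per site.
\<close>

definition growth_bits :: nat where "growth_bits = nat \<lceil>4 * C * lam\<rceil>"

text \<open>
  The accuracy \<open>2 ^ (- (precision * k))\<close> of an energy beats the growth of solutions over a window of \<open>100 * k\<close>
  sites, so typical behaviour in such a window persists under an error of that size.
\<close>

definition precision :: nat where "precision = 100 * growth_bits + 100"

text \<open>
  The first \<open>stride * k\<close> digits determine the potential on the first \<open>200 * precision * k\<close> sites with an error
  that is negligible even after multiplication by the growth of solutions over these sites.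
\<close>

definition stride :: nat where "stride = 400 * precision * (growth_bits + 1)"

lemma D_ge: "0 \<le> D" "1 \<le> D" "D + 1 \<le> 4 * C * lam" "D + 1 \<le> 2 ^ growth_bits" "lam * C \<le> 2 ^ growth_bits"
proof -
  have e: "D = 3 * (lam * C)" "4 * C * lam = 4 * (lam * C)" by (simp_all add: D_def)
  show "0 \<le> D" "1 \<le> D" and 1: "D + 1 \<le> 4 * C * lam"
    unfolding e using lamC by linarith+
  have "4 * C * lam \<le> real growth_bits" unfolding growth_bits_def by linarith
  also have "\<dots> \<le> 2 ^ growth_bits" by (rule real_le_two_power)
  finally show "D + 1 \<le> 2 ^ growth_bits" "lam * C \<le> 2 ^ growth_bits" using 1 e lamC by linarith+
qed

lemma growth_bound: "(D + 1) ^ n \<le> 2 ^ (growth_bits * n)"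
  unfolding power_mult using D_ge by (intro power_mono) auto

lemma dsol_energy_lipschitz:
  assumes y: "0 \<le> y" "y < 1" and E: "\<bar>E\<bar> \<le> R" "\<bar>z\<bar> \<le> R"
  shows "\<bar>dsol (pot y) E n - dsol (pot y) z n\<bar> \<le> real n * (D + 1) ^ n * \<bar>E - z\<bar>"
  unfolding dsol_def using energy_bound[OF y] E by (intro continuant_lipschitz) auto

text \<open>
  A polynomial in the energy that depends on the first digits of the phase only and is not positive exactly
  where the solution on the box of \<open>200 * precision * k\<close> sites is small, for the left end point of the cell.
\<close>

definition cell_poly :: "nat \<Rightarrow> nat \<Rightarrow> real poly" where
  "cell_poly k i = (char_poly_seq (pot (real i / 2 ^ (stride * k))) (200 * precision * k))\<^sup>2
     - [:(2 ^ (2 * (precision * k)) - 1)\<^sup>2:]"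

text \<open>
  Few energies, known from the first \<open>stride * k\<close> digits, near which the low energies of a typical
  phase in the cell lie.
  The bottom \<open>- R\<close> of the energy range is included because the component of a low energy may end there.
\<close>

definition candidates :: "nat \<Rightarrow> nat \<Rightarrow> real set" where
  "candidates k i = insert (- R) {z. \<bar>z\<bar> \<le> R \<and> poly (cell_poly k i) z = 0}"

lemma cell_poly_le_0_iff:
  "poly (cell_poly k i) E \<le> 0 \<longleftrightarrow>
    \<bar>dsol (pot (real i / 2 ^ (stride * k))) E (200 * precision * k)\<bar> \<le> 2 ^ (2 * (precision * k)) - 1"
proof -
  have "(1::real) \<le> 2 ^ (2 * (precision * k))" by simp
  then show ?thesis
    unfolding cell_poly_def poly_diff poly_power poly_char
    using abs_le_square_iff[of "dsol (pot (real i / 2 ^ (stride * k))) E (200 * precision * k)" "2 ^ (2 * (precision * k)) - 1"]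
    by simp
qed

lemma cell_poly_nonzero: "cell_poly k i \<noteq> 0" and degree_cell_poly: "degree (cell_poly k i) \<le> 400 * precision * k"
proof -
  let ?p = "char_poly_seq (pot (real i / 2 ^ (stride * k))) (200 * precision * k)"
  have dp: "degree (?p\<^sup>2) = 2 * (200 * precision * k)"
    using degree_char_poly_seq[of "pot (real i / 2 ^ (stride * k))" "200 * precision * k"]
    by (subst degree_power_eq) auto
  show "degree (cell_poly k i) \<le> 400 * precision * k"
    unfolding cell_poly_def using dp by (intro degree_diff_le) auto
  show "cell_poly k i \<noteq> 0"
  proof (cases "k = 0")
    case True
    then show ?thesis by (simp add: cell_poly_def char_poly_seq_def)
  next
    case False
    then have "0 < 2 * (200 * precision * k)" by (simp add: precision_def)
    then have "degree (cell_poly k i) = 2 * (200 * precision * k)"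
      unfolding cell_poly_def diff_conv_add_uminus using dp by (subst degree_add_eq_left) auto
    then show ?thesis using \<open>0 < 2 * (200 * precision * k)\<close> by (metis degree_0 less_numeral_extra(3))
  qed
qed

lemma candidates_finite: "finite (candidates k i)"
  and candidates_card: "card (candidates k i) \<le> 400 * precision * k + 1"
proof -
  have fin: "finite {z. poly (cell_poly k i) z = 0}" by (rule poly_roots_finite[OF cell_poly_nonzero])
  have sub: "{z. \<bar>z\<bar> \<le> R \<and> poly (cell_poly k i) z = 0} \<subseteq> {z. poly (cell_poly k i) z = 0}" by auto
  show "finite (candidates k i)" unfolding candidates_def using finite_subset[OF sub fin] by simp
  have "card (candidates k i) \<le> card {z. \<bar>z\<bar> \<le> R \<and> poly (cell_poly k i) z = 0} + 1"
    unfolding candidates_def by (simp add: card_insert_if finite_subset[OF sub fin])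
  also have "card {z. \<bar>z\<bar> \<le> R \<and> poly (cell_poly k i) z = 0} \<le> card {z. poly (cell_poly k i) z = 0}"
    by (rule card_mono[OF fin sub])
  also have "\<dots> \<le> 400 * precision * k"
    using card_poly_roots_bound[OF cell_poly_nonzero, of k i] degree_cell_poly[of k i] by (rule order_trans)
  finally show "card (candidates k i) \<le> 400 * precision * k + 1" by simp
qed

lemma candidates_bound: "z \<in> candidates k i \<Longrightarrow> \<bar>z\<bar> \<le> R"
  using R_pos by (auto simp: candidates_def)

definition atypical :: "nat \<Rightarrow> real \<Rightarrow> real \<Rightarrow> bool" where
  "atypical k z y \<longleftrightarrow> max \<bar>dsol (pot y) z (100 * k)\<bar> \<bar>minor z (100 * k) y\<bar> < lam ^ (60 * k)"

lemma measurable_atypical [measurable]: "Measurable.pred borel (atypical k z)"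
  unfolding atypical_def by measurable

definition in_cell :: "nat \<Rightarrow> nat \<Rightarrow> real \<Rightarrow> bool" where
  "in_cell k i x \<longleftrightarrow> real i \<le> 2 ^ (stride * k) * x \<and> 2 ^ (stride * k) * x < real i + 1"

lemma measurable_in_cell [measurable]: "Measurable.pred borel (in_cell k i)"
  unfolding in_cell_def by measurable

text \<open>
  A candidate energy is atypical for some window that starts \<open>l \<le> stride + 50\<close> sites after site \<open>stride * k\<close>.
  Consecutive \<open>k\<close> shift the first of these windows by \<open>stride\<close> sites and their centres by \<open>stride + 50\<close>,
  so the centres for all \<open>k\<close> together exhaust all sites from some point on.
\<close>

definition resonant_window :: "nat \<Rightarrow> real \<Rightarrow> bool" where
  "resonant_window k x \<longleftrightarrow> (\<exists>i<2 ^ (stride * k). in_cell k i x \<and>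
     (\<exists>z\<in>candidates k i. \<exists>l\<in>{..stride + 50}. atypical k z ((doubling_map ^^ (l + stride * k)) x)))"

lemma measurable_resonant_window [measurable]: "Measurable.pred borel (resonant_window k)"
proof -
  have at: "{x. atypical k z ((doubling_map ^^ m) x)} \<in> sets borel" for z m
    by measurable
  have cell: "{x. in_cell k i x} \<in> sets borel" for i
    by measurable
  have "{x. resonant_window k x} = (\<Union>i\<in>{..<2 ^ (stride * k)}. {x. in_cell k i x} \<inter>
      (\<Union>z\<in>candidates k i. \<Union>l\<in>{..stride + 50}. {x. atypical k z ((doubling_map ^^ (l + stride * k)) x)}))"
    unfolding resonant_window_def by blast
  also have "\<dots> \<in> sets borel"
    by (intro sets.finite_UN sets.Int at cell candidates_finite finite_lessThan finite_atMost)
  finally show ?thesis by (simp add: pred_def)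
qed

text \<open>
  The candidates depend on the first \<open>stride * k\<close> digits and the windows on the later ones. The two
  are independent, so the bound at fixed energy applies to each candidate, and there are only linearly many.
\<close>

lemma resonant_window_probability:
  "emeasure lborel {x \<in> {0..<1}. resonant_window k x}
    \<le> ennreal ((101 * real (stride + 51) + 101 * real (stride + 51) * real (400 * precision) * real k) / 2 ^ k)"
proof -
  let ?n = "stride * k" and ?B = "101 * real (stride + 51) * (real (400 * precision * k + 1))"
  have "emeasure lborel {x \<in> {0..<1}. resonant_window k x} = unit_integral (\<lambda>x. indicator {x. resonant_window k x} x)"
    by (rule unit_integral_indicator[symmetric]) measurable
  also have "\<dots> = unit_integral (\<lambda>y. ennreal (1 / 2 ^ ?n) *
      (\<Sum>i<2 ^ ?n. indicator {x. resonant_window k x} ((y + real i) / 2 ^ ?n)))"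
    by (rule unit_integral_branches) measurable
  also have "\<dots> \<le> unit_integral (\<lambda>y. ennreal (1 / 2 ^ ?n) *
      (\<Sum>i<2 ^ ?n. \<Sum>z\<in>candidates k i. \<Sum>l\<le>stride + 50. indicator {y. atypical k z ((doubling_map ^^ l) y)} y))"
  proof (intro unit_integral_mono mult_left_mono sum_mono)
    fix y :: real and i :: nat
    assume y: "0 \<le> y" "y < 1" and i: "i \<in> {..<2 ^ ?n}"
    let ?s = "\<Sum>z\<in>candidates k i. \<Sum>l\<le>stride + 50. indicator {y. atypical k z ((doubling_map ^^ l) y)} y :: ennreal"
    show "indicator {x. resonant_window k x} ((y + real i) / 2 ^ ?n) \<le> ?s"
    proof (cases "resonant_window k ((y + real i) / 2 ^ ?n)")
      case True
      then obtain i' z l where *: "in_cell k i' ((y + real i) / 2 ^ ?n)" "z \<in> candidates k i'" "l \<le> stride + 50"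
        "atypical k z ((doubling_map ^^ (l + ?n)) ((y + real i) / 2 ^ ?n))"
        unfolding resonant_window_def by auto
      have "real i' \<le> y + real i" "y + real i < real i' + 1" using *(1) by (auto simp: in_cell_def)
      then have "real i' < real i + 1" "real i < real i' + 1" using y by linarith+
      then have "i' = i" by linarith
      have "(doubling_map ^^ (l + ?n)) ((y + real i) / 2 ^ ?n) = (doubling_map ^^ l) y"
        using doubling_map_branch(1)[OF y, of i ?n] i by (simp add: funpow_add)
      then have at: "atypical k z ((doubling_map ^^ l) y)" using * by simp
      have "(1::ennreal) = (\<Sum>l\<in>{l}. indicator {y. atypical k z ((doubling_map ^^ l) y)} y)" using at by simp
      also have "\<dots> \<le> (\<Sum>l\<le>stride + 50. indicator {y. atypical k z ((doubling_map ^^ l) y)} y)"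
        using *(3) by (intro sum_mono2) auto
      also have "\<dots> = (\<Sum>z\<in>{z}. \<Sum>l\<le>stride + 50. indicator {y. atypical k z ((doubling_map ^^ l) y)} y)" by simp
      also have "\<dots> \<le> ?s" using *(2) \<open>i' = i\<close> by (intro sum_mono2 candidates_finite) auto
      finally show ?thesis using True by simp
    qed simp
  qed simp
  also have "\<dots> = ennreal (1 / 2 ^ ?n) * (\<Sum>i<2 ^ ?n. \<Sum>z\<in>candidates k i. \<Sum>l\<le>stride + 50.
      emeasure lborel {y \<in> {0..<1}. atypical k z y})"
  proof -
    have "unit_integral (\<lambda>y. indicator {y. atypical k z ((doubling_map ^^ l) y)} y)
        = emeasure lborel {y \<in> {0..<1}. atypical k z y}" for z l
    proof -
      have "unit_integral (\<lambda>y. indicator {y. atypical k z ((doubling_map ^^ l) y)} y)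
        = emeasure lborel {y \<in> {0..<1}. atypical k z ((doubling_map ^^ l) y)}"
        by (rule unit_integral_indicator) measurable
      then show ?thesis using measure_doubling_map_preimage[of "atypical k z" l] by simp
    qed
    note single = this
    let ?g = "\<lambda>z l y. indicator {y. atypical k z ((doubling_map ^^ l) y)} y :: ennreal"
    have inner: "unit_integral (\<lambda>y. \<Sum>l\<le>stride + 50. ?g z l y)
        = (\<Sum>l\<le>stride + 50. emeasure lborel {y \<in> {0..<1}. atypical k z y})" for z
    proof -
      have "unit_integral (\<lambda>y. \<Sum>l\<le>stride + 50. ?g z l y) = (\<Sum>l\<le>stride + 50. unit_integral (\<lambda>y. ?g z l y))"
        by (rule unit_integral_sum) measurable
      then show ?thesis by (simp only: single)
    qed
    have middle: "unit_integral (\<lambda>y. \<Sum>z\<in>candidates k i. \<Sum>l\<le>stride + 50. ?g z l y)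
        = (\<Sum>z\<in>candidates k i. \<Sum>l\<le>stride + 50. emeasure lborel {y \<in> {0..<1}. atypical k z y})" for i
      unfolding inner[symmetric] by (rule unit_integral_sum) measurable
    have outer: "unit_integral (\<lambda>y. \<Sum>i<2 ^ ?n. \<Sum>z\<in>candidates k i. \<Sum>l\<le>stride + 50. ?g z l y)
        = (\<Sum>i<2 ^ ?n. \<Sum>z\<in>candidates k i. \<Sum>l\<le>stride + 50. emeasure lborel {y \<in> {0..<1}. atypical k z y})"
      unfolding middle[symmetric] by (rule unit_integral_sum) measurable
    show ?thesis
      unfolding outer[symmetric] by (rule unit_integral_cmult) measurable
  qed
  also have "\<dots> \<le> ennreal (1 / 2 ^ ?n) * (\<Sum>i<(2::nat) ^ ?n. ennreal (?B / 2 ^ k))"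
  proof (intro mult_left_mono sum_mono)
    fix i
    have "(\<Sum>z\<in>candidates k i. \<Sum>l\<le>stride + 50. emeasure lborel {y \<in> {0..<1}. atypical k z y})
        \<le> (\<Sum>z\<in>candidates k i. \<Sum>l\<le>stride + 50. ennreal (101 / 2 ^ k))"
      using large_deviation candidates_bound by (intro sum_mono) (auto simp: atypical_def)
    also have "\<dots> = ennreal (real (card (candidates k i)) * (real (stride + 51) * (101 / 2 ^ k)))"
    proof -
      have c1: "(\<Sum>l\<le>stride + 50. ennreal b) = ennreal (real (stride + 51) * b)" if "0 \<le> b" for b
        using that by (subst sum_ennreal) auto
      have c2: "(\<Sum>z\<in>candidates k i. ennreal b) = ennreal (real (card (candidates k i)) * b)" if "0 \<le> b" for b
        using that by (subst sum_ennreal) auto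
      show ?thesis
        by (subst c1, simp, subst c2) auto
    qed
    also have "\<dots> \<le> ennreal (?B / 2 ^ k)"
    proof (rule ennreal_leI)
      have "real (card (candidates k i)) \<le> real (400 * precision * k + 1)"
        using candidates_card by (intro of_nat_mono)
      then have "real (card (candidates k i)) * (real (stride + 51) * (101 / 2 ^ k))
          \<le> real (400 * precision * k + 1) * (real (stride + 51) * (101 / 2 ^ k))"
        by (intro mult_right_mono) auto
      also have "real (400 * precision * k + 1) * (real (stride + 51) * (101 / 2 ^ k)) = ?B / 2 ^ k"
        by (simp only: times_divide_eq_right mult.commute mult.left_commute)
      finally show "real (card (candidates k i)) * (real (stride + 51) * (101 / 2 ^ k)) \<le> ?B / 2 ^ k" .
    qed
    finally show "(\<Sum>z\<in>candidates k i. \<Sum>l\<le>stride + 50. emeasure lborel {y \<in> {0..<1}. atypical k z y})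
        \<le> ennreal (?B / 2 ^ k)" .
  qed simp
  also have "\<dots> = ennreal (?B / 2 ^ k)"
  proof -
    have c3: "(\<Sum>i<(2::nat) ^ ?n. ennreal b) = ennreal (2 ^ ?n * b)" if "0 \<le> b" for b
      using that by (subst sum_ennreal) auto
    have c4: "ennreal (1 / p) * ennreal (p * b) = ennreal b" if "0 \<le> b" "0 < p" for b p
      using that by (subst ennreal_mult[symmetric]) auto
    show ?thesis by (subst c3, simp, rule c4) auto
  qed
  also have "?B = 101 * real (stride + 51) + 101 * real (stride + 51) * real (400 * precision) * real k"
    unfolding of_nat_add of_nat_mult by (simp only: distrib_left of_nat_1 mult_1_right mult.assoc add.commute)
  finally show ?thesis .
qed

lemma AE_no_resonant_window:
  "AE x in lborel. x \<in> {0..<1} \<longrightarrow> (\<forall>\<^sub>F k in sequentially. \<not> resonant_window k x)"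
  by (rule borel_cantelli_unit[OF measurable_resonant_window resonant_window_probability]) auto

lemma window_decay:
  assumes x: "0 \<le> x" "x < 1" and E: "\<bar>E\<bar> \<le> R"
  shows "\<bar>dsol (pot ((doubling_map ^^ Suc m) x)) E (Suc (h + d))\<bar> * \<bar>dsol (pot x) E (Suc (m + h))\<bar>
    \<le> (D + 1) ^ h * \<bar>dsol (pot x) E (Suc (Suc (m + h + d)))\<bar> + (D + 1) ^ d * \<bar>dsol (pot x) E m\<bar>"
proof -
  let ?e = "\<lambda>k. E - pot x (Suc (m + k))"
  have win: "pot ((doubling_map ^^ Suc m) x) k = pot x (Suc (m + k))" for k
    unfolding pot_shift by (simp add: add.commute)
  have e: "\<bar>?e k\<bar> \<le> D" for k by (rule energy_bound[OF x E])
  have rec: "dsol (pot x) E (m + Suc (Suc k)) = ?e k * dsol (pot x) E (m + Suc k) - dsol (pot x) E (m + k)" for k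
    by simp
  have "continuant ?e (Suc (h + d)) * dsol (pot x) E (m + Suc h) =
      continuant ?e h * dsol (pot x) E (m + Suc (Suc (h + d)))
      + continuant (\<lambda>k. ?e (Suc (k + h))) d * dsol (pot x) E (m + 0)"
    by (rule window_identity[where u = "\<lambda>k. dsol (pot x) E (m + k)", OF rec])
  moreover have "dsol (pot ((doubling_map ^^ Suc m) x)) E (Suc (h + d)) = continuant ?e (Suc (h + d))"
    unfolding dsol_def win ..
  ultimately have "\<bar>dsol (pot ((doubling_map ^^ Suc m) x)) E (Suc (h + d))\<bar> * \<bar>dsol (pot x) E (Suc (m + h))\<bar>
      = \<bar>continuant ?e h * dsol (pot x) E (m + Suc (Suc (h + d)))
      + continuant (\<lambda>k. ?e (Suc (k + h))) d * dsol (pot x) E (m + 0)\<bar>"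
    by (simp add: abs_mult[symmetric] del: dsol_rec)
  also have "\<dots> \<le> \<bar>continuant ?e h\<bar> * \<bar>dsol (pot x) E (m + Suc (Suc (h + d)))\<bar>
      + \<bar>continuant (\<lambda>k. ?e (Suc (k + h))) d\<bar> * \<bar>dsol (pot x) E (m + 0)\<bar>"
    unfolding abs_mult[symmetric] by (rule abs_triangle_ineq)
  also have "\<dots> \<le> (D + 1) ^ h * \<bar>dsol (pot x) E (m + Suc (Suc (h + d)))\<bar> + (D + 1) ^ d * \<bar>dsol (pot x) E (m + 0)\<bar>"
    by (intro add_mono mult_right_mono continuant_bound e abs_ge_zero)
  finally show ?thesis by (simp add: add.assoc del: dsol_rec)
qed

text \<open>
  Half a window costs \<open>(D + 1) ^ (50 * k)\<close>, which is roughly \<open>lam ^ (50 * k)\<close>, against a gain of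
  \<open>lam ^ (60 * k)\<close> from the whole window.
\<close>

lemma window_gain: "2 * (D + 1) ^ (50 * k) \<le> lam ^ (60 * k) / 2 ^ k" if "1 \<le> k"
proof -
  have "(4 * C) ^ 50 \<le> X ^ 50" using X_ge(1,3) C_pos by (intro power_mono) auto
  also have "\<dots> \<le> X ^ 60" using X_ge(1) by (intro power_increasing) auto
  also have "\<dots> = (X ^ 30) ^ 2" by (simp flip: power_mult)
  also have "\<dots> \<le> lam ^ 2" using lam_ge X_ge(1) by (intro power_mono) auto
  finally have 1: "(4 * C) ^ 50 \<le> lam ^ 2" .
  have "(D + 1) ^ 50 \<le> (4 * C * lam) ^ 50" using D_ge by (intro power_mono) auto
  also have "\<dots> = (4 * C) ^ 50 * lam ^ 50" by (rule power_mult_distrib)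
  also have "\<dots> \<le> lam ^ 2 * lam ^ 50" using 1 lam_pos by (intro mult_right_mono) auto
  also have "\<dots> = lam ^ 52" by (simp flip: power_add)
  finally have 2: "(D + 1) ^ 50 \<le> lam ^ 52" .
  have "4 * (D + 1) ^ 50 \<le> lam * lam ^ 52"
    using 2 lam_gt(2) D_ge lam_pos by (intro mult_mono) auto
  also have "\<dots> = lam ^ 53" by (simp flip: power_Suc)
  also have "\<dots> \<le> lam ^ 60" using lam_pos by (intro power_increasing) auto
  finally have 3: "4 * (D + 1) ^ 50 \<le> lam ^ 60" .
  have "(2::real) ^ 1 \<le> 2 ^ k" using that by (intro power_increasing) auto
  then have "(2 * 2 ^ k) * (D + 1) ^ (50 * k) \<le> (2 ^ k * 2 ^ k) * (D + 1) ^ (50 * k)"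
    using D_ge by (intro mult_right_mono) auto
  also have "\<dots> = (4 * (D + 1) ^ 50) ^ k"
    by (simp add: power_mult power_mult_distrib flip: power_mult_distrib[of 2 2])
  also have "\<dots> \<le> (lam ^ 60) ^ k" using 3 D_ge by (intro power_mono) auto
  also have "\<dots> = lam ^ (60 * k)" by (rule power_mult[symmetric])
  finally show ?thesis by (simp add: pos_le_divide_eq mult_ac)
qed

lemma cell_approximation:
  assumes y: "0 \<le> y" "y < 1" and i: "i < 2 ^ (stride * k)" and k: "1 \<le> k" and E: "\<bar>E\<bar> \<le> R"
  defines "x \<equiv> (y + real i) / 2 ^ (stride * k)"
  shows "\<bar>dsol (pot x) E (200 * precision * k) - dsol (pot (real i / 2 ^ (stride * k))) E (200 * precision * k)\<bar> \<le> 1"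
proof -
  let ?N = "200 * precision * k" and ?n = "stride * k"
  let ?x = "real i / 2 ^ ?n"
  have x: "0 \<le> x" "x < 1" unfolding x_def using doubling_map_branch[OF y i] by auto
  have x': "0 \<le> ?x" "?x < 1" using doubling_map_branch(2,3)[OF _ _ i, of 0] by auto
  have Nn: "?N * (2 * growth_bits + 2) = ?n" by (simp add: stride_def algebra_simps)
  have N1: "1 \<le> ?N" using k by (simp add: precision_def)
  have mono: "?N \<le> ?n" unfolding Nn[symmetric] by simp
  have h: "\<bar>(E - pot x m) - (E - pot ?x m)\<bar> \<le> lam * C * (2 ^ ?N / 2 ^ ?n)" if m: "m < ?N" for m
  proof -
    have mn: "m \<le> ?n" using m mono by linarith
    have "\<bar>f ((doubling_map ^^ m) x) - f ((doubling_map ^^ m) ?x)\<bar>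
        \<le> C * \<bar>(doubling_map ^^ m) x - (doubling_map ^^ m) ?x\<bar>"
      using doubling_map_funpow_range[OF x] doubling_map_funpow_range[OF x'] by (intro f_lipschitz) auto
    also have "(doubling_map ^^ m) x - (doubling_map ^^ m) ?x = y * 2 ^ m / 2 ^ ?n"
      unfolding x_def by (rule doubling_map_funpow_same_cell[OF y i mn])
    also have "\<bar>y * 2 ^ m / 2 ^ ?n\<bar> = y * 2 ^ m / 2 ^ ?n" using y by simp
    also have "C * (y * 2 ^ m / 2 ^ ?n) \<le> C * (1 * 2 ^ ?N / 2 ^ ?n)"
      using y m C_pos by (intro mult_left_mono divide_right_mono mult_mono power_increasing) auto
    finally have "lam * \<bar>f ((doubling_map ^^ m) x) - f ((doubling_map ^^ m) ?x)\<bar> \<le> lam * (C * (1 * 2 ^ ?N / 2 ^ ?n))"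
      using lam_pos by (intro mult_left_mono) auto
    moreover have "\<bar>(E - pot x m) - (E - pot ?x m)\<bar> = lam * \<bar>f ((doubling_map ^^ m) x) - f ((doubling_map ^^ m) ?x)\<bar>"
    proof -
      have "(E - pot x m) - (E - pot ?x m) = lam * (f ((doubling_map ^^ m) ?x) - f ((doubling_map ^^ m) x))"
        by (simp add: pot_def right_diff_distrib)
      then show ?thesis using lam_pos by (simp add: abs_mult abs_minus_commute)
    qed
    ultimately show ?thesis by (simp add: mult.assoc)
  qed
  have "\<bar>dsol (pot x) E ?N - dsol (pot ?x) E ?N\<bar> \<le> real ?N * (D + 1) ^ ?N * (lam * C * (2 ^ ?N / 2 ^ ?n))"
    unfolding dsol_def
    by (rule continuant_lipschitz) (use energy_bound[OF x E] energy_bound[OF x' E] h lam_pos C_pos in auto)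
  also have "\<dots> \<le> 2 ^ ?N * 2 ^ (growth_bits * ?N) * (2 ^ (growth_bits * ?N) * (2 ^ ?N / 2 ^ ?n))"
  proof -
    have "lam * C \<le> 2 ^ (growth_bits * ?N)"
    proof (rule order_trans[OF D_ge(5)])
      have "growth_bits * 1 \<le> growth_bits * ?N" using N1 by (rule mult_le_mono2)
      then show "(2::real) ^ growth_bits \<le> 2 ^ (growth_bits * ?N)" by (intro power_increasing) auto
    qed
    then show ?thesis
      using lam_pos C_pos D_ge by (intro mult_mono growth_bound real_le_two_power) auto
  qed
  also have "\<dots> = 2 ^ (?N * (2 * growth_bits + 2)) / 2 ^ ?n"
  proof -
    have e: "?N * (2 * growth_bits + 2) = ?N + growth_bits * ?N + (growth_bits * ?N + ?N)" by (simp add: algebra_simps)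
    show ?thesis unfolding e power_add by simp
  qed
  also have "\<dots> = 1" unfolding Nn by simp
  finally show ?thesis .
qed

text \<open>
  The component of low energies to the left of \<open>E\<close> begins at a candidate. It consists of low energies for
  \<open>x\<close> itself, up to the approximation of \<open>x\<close> by the end of its cell, so its length is bounded by
  their total measure.
\<close>

lemma energy_near_candidate:
  assumes y: "0 \<le> y" "y < 1" and i: "i < 2 ^ (stride * k)" and k: "1 \<le> k" and E: "\<bar>E\<bar> \<le> R"
  defines "x \<equiv> (y + real i) / 2 ^ (stride * k)"
  assumes low: "\<bar>dsol (pot x) E (200 * precision * k)\<bar> \<le> 2 ^ (2 * (precision * k)) - 2"
    and small: "\<not> ennreal (1 / 2 ^ (precision * k)) \<le> emeasure lborel (low_energies (2 * (precision * k)) x)"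
  shows "\<exists>z\<in>candidates k i. \<bar>E - z\<bar> \<le> 1 / 2 ^ (precision * k)"
proof -
  let ?j = "precision * k" and ?N = "200 * precision * k" and ?x = "real i / 2 ^ (stride * k)"
  have N: "100 * (2 * ?j) = ?N" by simp
  note approx = cell_approximation[OF y i k, folded x_def]
  have "poly (cell_poly k i) E \<le> 0"
    unfolding cell_poly_le_0_iff using approx[OF E] low by linarith
  moreover have "- R \<le> E" using E by auto
  ultimately obtain z where
    z: "z = - R \<or> poly (cell_poly k i) z = 0" "- R \<le> z" "z \<le> E"
      "\<And>t. z < t \<Longrightarrow> t \<le> E \<Longrightarrow> poly (cell_poly k i) t \<le> 0"
    using sublevel_component[OF _ cell_poly_nonzero, of k i E "- R"] by blast
  have zc: "z \<in> candidates k i" using z E by (auto simp: candidates_def)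
  have "{z<..E} \<subseteq> low_energies (2 * ?j) x"
  proof
    fix t assume t: "t \<in> {z<..E}"
    then have tR: "\<bar>t\<bar> \<le> R" using z E by auto
    have "\<bar>dsol (pot ?x) t ?N\<bar> \<le> 2 ^ (2 * ?j) - 1"
      using z(4)[of t] t by (simp only: cell_poly_le_0_iff greaterThanAtMost_iff)
    then show "t \<in> low_energies (2 * ?j) x"
      unfolding low_energies_def mem_Collect_eq N using approx[OF tR] tR by linarith
  qed
  then have "emeasure lborel {z<..E} \<le> emeasure lborel (low_energies (2 * ?j) x)"
    by (intro emeasure_mono) auto
  then have "ennreal (E - z) < ennreal (1 / 2 ^ ?j)" using small z(3) by (simp add: not_le)
  then have "E - z \<le> 1 / 2 ^ ?j" using z(3) by (simp add: ennreal_less_iff)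
  then show ?thesis using zc z(3) by (intro bexI[of _ z]) auto
qed

lemma typical_window_stable:
  assumes y: "0 \<le> y" "y < 1" and k: "1 \<le> k" and E: "\<bar>E\<bar> \<le> R" "\<bar>z\<bar> \<le> R"
    and near: "\<bar>E - z\<bar> \<le> 1 / 2 ^ (precision * k)" and typical: "\<not> atypical k z y"
  shows "lam ^ (60 * k) / 2 \<le> \<bar>dsol (pot y) E (100 * k)\<bar> \<or>
    lam ^ (60 * k) / 2 \<le> \<bar>dsol (pot (doubling_map y)) E (100 * k - 1)\<bar>"
proof -
  have stable: "\<bar>dsol (pot y) E n - dsol (pot y) z n\<bar> \<le> 1" if y: "0 \<le> y" "y < 1" and n: "n \<le> 100 * k" for y n
  proof -
    have "\<bar>dsol (pot y) E n - dsol (pot y) z n\<bar> \<le> real n * (D + 1) ^ n * \<bar>E - z\<bar>"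
      by (rule dsol_energy_lipschitz[OF y E])
    also have "\<dots> \<le> real (100 * k) * (D + 1) ^ (100 * k) * (1 / 2 ^ (precision * k))"
      using n D_ge near by (intro mult_mono power_increasing of_nat_mono) auto
    also have "\<dots> \<le> 2 ^ (100 * k) * 2 ^ (growth_bits * (100 * k)) * (1 / 2 ^ (precision * k))"
      using D_ge by (intro mult_mono growth_bound real_le_two_power) auto
    also have "\<dots> = 1"
    proof -
      have e: "precision * k = 100 * k + growth_bits * (100 * k)" by (simp add: precision_def algebra_simps)
      show ?thesis unfolding e power_add by simp
    qed
    finally show ?thesis .
  qed
  have k100: "100 * k = Suc (100 * k - 1)" using k by simp
  have lam1: "1 \<le> lam ^ (60 * k) / 2"
  proof -
    have "lam ^ 1 \<le> lam ^ (60 * k)" using lam_pos k by (intro power_increasing) auto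
    then show ?thesis using lam_gt(2) by simp
  qed
  have "lam ^ (60 * k) \<le> \<bar>dsol (pot y) z (100 * k)\<bar> \<or> lam ^ (60 * k) \<le> \<bar>minor z (100 * k) y\<bar>"
    using typical by (auto simp: atypical_def not_less le_max_iff_disj)
  moreover have "minor z (100 * k) y = dsol (pot (doubling_map y)) z (100 * k - 1)"
    by (subst k100) (rule minor_Suc)
  ultimately show ?thesis
    using stable[OF y, of "100 * k"] stable[of "doubling_map y" "100 * k - 1"] lam1 by auto
qed

text \<open>
  The energy of a linearly bounded solution is close to a candidate, the candidate is typical for the
  window centred at \<open>n\<close>, and typicality is stable under the small change of energy. Green's formula on that
  window, or on the window without its first site, then makes the solution small at the centre.
\<close>

lemma solution_small:
  assumes x: "0 \<le> x" "x < 1" and k: "1 \<le> k" and E: "\<bar>E\<bar> \<le> R" and K: "0 < K"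
    and bd: "\<And>n. \<bar>dsol (pot x) E n\<bar> \<le> K * (real n + 1)"
    and n: "(stride + 50) * k \<le> n" "n < (stride + 50) * (k + 1)"
    and small: "\<not> ennreal (1 / 2 ^ (precision * k)) \<le> emeasure lborel (low_energies (2 * (precision * k)) x)"
    and free: "\<not> resonant_window k x"
    and low: "K * (200 * real (precision * k) + 1) \<le> 2 ^ (2 * (precision * k)) - 2"
  shows "\<bar>dsol (pot x) E n\<bar> \<le> 3 * K * (real n + 1) / 2 ^ k"
proof -
  let ?s = "stride * k"
  define i where "i = nat \<lfloor>2 ^ ?s * x\<rfloor>"
  define y where "y = 2 ^ ?s * x - real i"
  have i: "real i \<le> 2 ^ ?s * x" "2 ^ ?s * x < real i + 1" using x by (auto simp: i_def)
  then have y: "0 \<le> y" "y < 1" by (auto simp: y_def)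
  have xy: "x = (y + real i) / 2 ^ ?s" by (simp add: y_def)
  have "2 ^ ?s * x < 2 ^ ?s * 1" using x by (intro mult_strict_left_mono) auto
  then have "real i < 2 ^ ?s" using i(1) by linarith
  then have "real i < real (2 ^ ?s)" by (simp only: of_nat_power of_nat_numeral)
  then have i2: "i < 2 ^ ?s" by (simp only: of_nat_less_iff)
  have "\<bar>dsol (pot x) E (200 * precision * k)\<bar> \<le> 2 ^ (2 * (precision * k)) - 2"
  proof -
    have "real (200 * precision * k) + 1 = 200 * real (precision * k) + 1" by simp
    then show ?thesis using bd[of "200 * precision * k"] low by (simp only:)
  qed
  then obtain z where z: "z \<in> candidates k i" "\<bar>E - z\<bar> \<le> 1 / 2 ^ (precision * k)"
    using energy_near_candidate[OF y i2 k E] small unfolding xy[symmetric] by blast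
  define M where "M = n - 50 * k"
  have sk: "(stride + 50) * k = ?s + 50 * k" "(stride + 50) * (k + 1) = ?s + 50 * k + stride + 50"
    by (simp_all add: algebra_simps)
  have nM: "n = M + 50 * k" "?s \<le> M" "M \<le> ?s + stride + 50"
    using n unfolding sk M_def by linarith+
  have "M - ?s \<in> {..stride + 50}" "M - ?s + ?s = M" using nM by auto
  then have "\<not> atypical k z ((doubling_map ^^ M) x)"
    using free i2 i z unfolding resonant_window_def in_cell_def by metis
  then have big: "lam ^ (60 * k) / 2 \<le> \<bar>dsol (pot ((doubling_map ^^ M) x)) E (100 * k)\<bar> \<or>
      lam ^ (60 * k) / 2 \<le> \<bar>dsol (pot ((doubling_map ^^ Suc M) x)) E (100 * k - 1)\<bar>"
    using typical_window_stable[OF _ _ k E candidates_bound[OF z(1)] z(2), of "(doubling_map ^^ M) x"]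
      doubling_map_funpow_range[OF x, of M] by simp
  have M1: "1 \<le> M"
  proof -
    have "1 \<le> stride" by (simp add: stride_def precision_def)
    then have "1 * 1 \<le> ?s" using k by (intro mult_le_mono)
    then show ?thesis using nM by linarith
  qed
  have kn: "50 * k \<le> n" using nM by linarith
  let ?u = "\<lambda>n. \<bar>dsol (pot x) E n\<bar>" and ?g = "(D + 1) ^ (50 * k)"
  have sum: "?u (n + 50 * k) + ?u l \<le> 3 * K * (real n + 1)" if "l \<le> M" for l
  proof -
    have "?u (n + 50 * k) \<le> K * (2 * real n + 1)"
      by (rule order_trans[OF bd]) (use K kn in \<open>auto intro!: mult_left_mono\<close>)
    moreover have "?u l \<le> K * (real n + 1)"
      by (rule order_trans[OF bd]) (use K nM that in \<open>auto intro!: mult_left_mono\<close>)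
    ultimately have "?u (n + 50 * k) + ?u l \<le> K * (2 * real n + 1) + K * (real n + 1)" by linarith
    also have "\<dots> \<le> 3 * K * (real n + 1)" using K by (simp add: algebra_simps)
    finally show ?thesis .
  qed
  have gpos: "0 \<le> ?g" using D_ge by simp
  have key: "lam ^ (60 * k) / 2 * ?u n \<le> ?g * (3 * K * (real n + 1))"
    using big
  proof
    assume b: "lam ^ (60 * k) / 2 \<le> \<bar>dsol (pot ((doubling_map ^^ M) x)) E (100 * k)\<bar>"
    define m where "m = M - 1"
    define d where "d = 50 * k - 1"
    have idx: "Suc m = M" "Suc (50 * k + d) = 100 * k" "Suc (m + 50 * k) = n" "Suc (Suc (m + 50 * k + d)) = n + 50 * k"
      using M1 k nM by (auto simp: m_def d_def)
    have "lam ^ (60 * k) / 2 * ?u n \<le> \<bar>dsol (pot ((doubling_map ^^ M) x)) E (100 * k)\<bar> * ?u n"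
      using b by (intro mult_right_mono) auto
    also have "\<dots> \<le> ?g * ?u (n + 50 * k) + (D + 1) ^ d * ?u m"
      using window_decay[OF x E, of m "50 * k" d] unfolding idx .
    also have "\<dots> \<le> ?g * ?u (n + 50 * k) + ?g * ?u m"
      using D_ge by (intro add_left_mono mult_right_mono power_increasing) (auto simp: d_def)
    also have "\<dots> \<le> ?g * (3 * K * (real n + 1))"
      unfolding distrib_left[symmetric] using gpos by (intro mult_left_mono sum) (auto simp: m_def)
    finally show ?thesis .
  next
    assume b: "lam ^ (60 * k) / 2 \<le> \<bar>dsol (pot ((doubling_map ^^ Suc M) x)) E (100 * k - 1)\<bar>"
    define h where "h = 50 * k - 1"
    have idx: "Suc (h + h) = 100 * k - 1" "Suc (M + h) = n" "Suc (Suc (M + h + h)) = n + 50 * k"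
      using M1 k nM by (auto simp: h_def)
    have "lam ^ (60 * k) / 2 * ?u n \<le> \<bar>dsol (pot ((doubling_map ^^ Suc M) x)) E (100 * k - 1)\<bar> * ?u n"
      using b by (intro mult_right_mono) auto
    also have "\<dots> \<le> (D + 1) ^ h * ?u (n + 50 * k) + (D + 1) ^ h * ?u M"
      using window_decay[OF x E, of M h h] unfolding idx .
    also have "\<dots> \<le> ?g * ?u (n + 50 * k) + ?g * ?u M"
      using D_ge by (intro add_mono mult_right_mono power_increasing) (auto simp: h_def)
    also have "\<dots> \<le> ?g * (3 * K * (real n + 1))"
      unfolding distrib_left[symmetric] using gpos by (intro mult_left_mono sum) auto
    finally show ?thesis .
  qed
  have gain: "?g * (3 * K * (real n + 1)) \<le> (lam ^ (60 * k) / 2 ^ k / 2) * (3 * K * (real n + 1))"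
    using window_gain[OF k] K by (intro mult_right_mono) auto
  have "lam ^ (60 * k) / 2 ^ k / 2 * (3 * K * (real n + 1)) = lam ^ (60 * k) / 2 * (3 * K * (real n + 1) / 2 ^ k)"
    by simp
  then have "lam ^ (60 * k) / 2 * ?u n \<le> lam ^ (60 * k) / 2 * (3 * K * (real n + 1) / 2 ^ k)"
    using order_trans[OF key gain] by (simp only:)
  then show ?thesis using lam_pos by (simp only: mult_le_cancel_left_pos half_gt_zero_iff zero_less_power)
qed

text \<open>
  Apply \<open>solution_small\<close> with \<open>k\<close> proportional to \<open>n\<close>. How far out this starts depends on the phase and on \<open>K\<close>
  but not on the energy, as the criterion requires.
\<close>

lemma bounded_solutions_decay:
  assumes x: "0 \<le> x" "x < 1" and K: "0 < K"
    and small: "\<forall>\<^sub>F j in sequentially. \<not> ennreal (1 / 2 ^ j) \<le> emeasure lborel (low_energies (2 * j) x)"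
    and free: "\<forall>\<^sub>F k in sequentially. \<not> resonant_window k x"
  shows "\<exists>C>0. \<exists>\<alpha>>0. \<forall>E. \<bar>E\<bar> \<le> R \<longrightarrow> (\<forall>n. \<bar>dsol (pot x) E n\<bar> \<le> K * (real n + 1)) \<longrightarrow>
    (\<forall>n. \<bar>dsol (pot x) E n\<bar> \<le> C * exp (- \<alpha> * real n))"
proof -
  have "\<forall>\<^sub>F j in sequentially. K * (200 * real j + 1) \<le> 2 ^ (2 * j) - 2" using K by real_asymp
  from eventually_conj[OF this small] obtain j0 where j0:
    "\<And>j. j \<ge> j0 \<Longrightarrow> K * (200 * real j + 1) \<le> 2 ^ (2 * j) - 2 \<and>
      \<not> ennreal (1 / 2 ^ j) \<le> emeasure lborel (low_energies (2 * j) x)"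
    unfolding eventually_sequentially by blast
  from free obtain k0 where k0: "\<And>k. k \<ge> k0 \<Longrightarrow> \<not> resonant_window k x"
    unfolding eventually_sequentially by blast
  define k1 where "k1 = max 1 (max j0 k0)"
  let ?q = "stride + 50"
  obtain C \<alpha> where C: "C > 0" "\<alpha> > 0" "\<And>n. (real n + 1) / 2 ^ (n div ?q) \<le> C * exp (- \<alpha> * real n)"
    using linear_times_halving_exp_decay[of ?q] by auto
  define B where "B = K * (3 + 2 ^ k1)"
  have B: "B > 0" using K by (simp add: B_def add_pos_pos)
  have "\<bar>dsol (pot x) E n\<bar> \<le> (B * C) * exp (- \<alpha> * real n)"
    if E: "\<bar>E\<bar> \<le> R" and bd: "\<And>n. \<bar>dsol (pot x) E n\<bar> \<le> K * (real n + 1)" for E n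
  proof -
    define k where "k = n div ?q"
    have "\<bar>dsol (pot x) E n\<bar> \<le> B * ((real n + 1) / 2 ^ k)"
    proof (cases "k1 \<le> k")
      case True
      have "j0 \<le> 1 * k" using True by (simp add: k1_def)
      also have "\<dots> \<le> precision * k" by (intro mult_le_mono1) (simp add: precision_def)
      finally have jk: "j0 \<le> precision * k" .
      have "?q * k \<le> n" "n < ?q * (k + 1)"
        unfolding k_def by (simp_all add: dividend_less_times_div times_div_less_eq_dividend)
      then have "\<bar>dsol (pot x) E n\<bar> \<le> 3 * K * (real n + 1) / 2 ^ k"
        using True j0[OF jk] k0[of k] by (intro solution_small[OF x _ E K bd]) (auto simp: k1_def)
      also have "\<dots> = (3 * K) * ((real n + 1) / 2 ^ k)" by simp
      also have "\<dots> \<le> B * ((real n + 1) / 2 ^ k)"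
        using K by (intro mult_right_mono) (auto simp: B_def algebra_simps)
      finally show ?thesis .
    next
      case False
      have "\<bar>dsol (pot x) E n\<bar> \<le> K * 2 ^ k * ((real n + 1) / 2 ^ k)" using bd[of n] by simp
      also have "\<dots> \<le> B * ((real n + 1) / 2 ^ k)"
      proof (rule mult_right_mono)
        have "(2::real) ^ k \<le> 2 ^ k1" using False by (intro power_increasing) auto
        then have "(2::real) ^ k \<le> 3 + 2 ^ k1" by linarith
        then show "K * 2 ^ k \<le> B" unfolding B_def using K by (intro mult_left_mono) auto
      qed auto
      finally show ?thesis .
    qed
    also have "\<dots> \<le> B * (C * exp (- \<alpha> * real n))"
      unfolding k_def using B C(3)[of n] by (intro mult_left_mono) auto
    finally show ?thesis by (simp add: mult.assoc)
  qed
  then show ?thesis using B C by (intro exI[of _ "B * C"] conjI exI[of _ \<alpha>]) auto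
qed

theorem AE_localization:
  "AE x in lborel. x \<in> {0..<1} \<longrightarrow> anderson_localization (jacobi (pot x))"
  using AE_low_energies_small AE_no_resonant_window
proof eventually_elim
  case (elim x)
  show ?case
  proof
    assume x: "x \<in> {0..<1}"
    then have x': "0 \<le> x" "x < 1" by auto
    show "anderson_localization (jacobi (pot x))"
    proof (rule localization_criterion[where B = "lam * C"])
      show "\<bar>pot x n\<bar> \<le> lam * C" for n by (rule pot_bound[OF x'])
      show "\<exists>Ca>0. \<exists>\<alpha>>0. \<forall>E. \<bar>E\<bar> \<le> lam * C + 2 \<longrightarrow> (\<forall>n. \<bar>dsol (pot x) E n\<bar> \<le> K * (real n + 1)) \<longrightarrow>
          (\<forall>n. \<bar>dsol (pot x) E n\<bar> \<le> Ca * exp (- \<alpha> * real n))" if "0 < K" for K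
        using bounded_solutions_decay[OF x' that] elim x unfolding R_def by blast
    qed
  qed
qed

end

section \<open>Monotone potentials over the doubling map\<close>

lemma periodic_frac:
  fixes f :: "real \<Rightarrow> 'a"
  assumes "\<And>x. f (x + 1) = f x"
  shows "f (frac x) = f x"
proof -
  have nat: "f (y + real n) = f y" for y n
    by (induction n) (use assms[of "y + real _"] in \<open>auto simp: algebra_simps\<close>)
  show ?thesis
  proof (cases "0 \<le> \<lfloor>x\<rfloor>")
    case True
    then have "x = frac x + real (nat \<lfloor>x\<rfloor>)" by (simp add: frac_def)
    then show ?thesis using nat[of "frac x" "nat \<lfloor>x\<rfloor>"] by simp
  next
    case False
    then have "frac x = x + real (nat (- \<lfloor>x\<rfloor>))" by (simp add: frac_def)
    then show ?thesis using nat[of x "nat (- \<lfloor>x\<rfloor>)"] by simp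
  qed
qed

lemma C1_norm_bounds:
  assumes "C1_norm S f < ereal C" "x \<in> S"
  shows "\<bar>f x\<bar> < C" "\<bar>deriv f x\<bar> < C"
proof -
  let ?A = "SUP x\<in>S. ereal \<bar>f x\<bar>" and ?B = "SUP x\<in>S. ereal \<bar>deriv f x\<bar>"
  have A: "ereal \<bar>f x\<bar> \<le> ?A" and B: "ereal \<bar>deriv f x\<bar> \<le> ?B"
    using assms(2) by (auto intro: SUP_upper)
  have "0 \<le> ?A" "0 \<le> ?B"
    using order_trans[OF _ A, of 0] order_trans[OF _ B, of 0] by auto
  then have "?A \<le> C1_norm S f" "?B \<le> C1_norm S f"
    unfolding C1_norm_def by (auto intro: add_increasing add_increasing2)
  then have "ereal \<bar>f x\<bar> < ereal C" "ereal \<bar>deriv f x\<bar> < ereal C"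
    using A B assms(1) by (meson le_less_trans)+
  then show "\<bar>f x\<bar> < C" "\<bar>deriv f x\<bar> < C" by simp_all
qed

theorem theorem2p4:
  fixes f :: "real \<Rightarrow> real" and c C :: real
  assumes torus: "\<And>x. f (x + 1) = f x"
    and monotonic: "mono_on {0..<1} f \<or> antimono_on {0..<1} f"
    and C1: "f C1_differentiable_on {0<..<1}"
    and jump: "jump_discontinuity f 0"
    and right_cont: "continuous (at_right 0) f"
    and right_deriv: "\<exists>D. (f has_real_derivative D) (at_right 0)"
    and c_pos: "0 < c"
    and inf_deriv: "c \<le> (INF x\<in>{0<..<1}. \<bar>deriv f x\<bar>)"
    and C_pos: "0 < C"
    and C1_bound: "C1_norm {0<..<1} f < ereal C"
  shows "\<exists>lam\<^sub>0>0. \<forall>lam>lam\<^sub>0. AE x in lebesgue_on {0..<1}.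
           anderson_localization (doubling_schroedinger f lam x)"
proof -
  have deriv: "(f has_real_derivative deriv f x) (at x)" if "0 < x" "x < 1" for x
  proof -
    obtain D where D: "\<forall>x\<in>{0<..<1}. (f has_vector_derivative D x) (at x)"
      using C1 unfolding C1_differentiable_on_def by blast
    then have "(f has_vector_derivative D x) (at x)" using that by simp
    then have "(f has_real_derivative D x) (at x)"
      by (simp add: has_real_derivative_iff_has_vector_derivative)
    then show ?thesis by (metis DERIV_imp_deriv)
  qed
  have lower: "c \<le> \<bar>deriv f x\<bar>" if "0 < x" "x < 1" for x
  proof -
    have "bdd_below ((\<lambda>x. \<bar>deriv f x\<bar>) ` {0<..<1})" by (intro bdd_belowI2[of _ 0]) auto
    then have "(INF x\<in>{0<..<1}. \<bar>deriv f x\<bar>) \<le> \<bar>deriv f x\<bar>"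
      using that by (intro cINF_lower) auto
    then show ?thesis using inf_deriv by linarith
  qed
  have cont: "continuous_on {0..<1} f"
    unfolding continuous_on_eq_continuous_within
  proof
    fix x :: real assume x: "x \<in> {0..<1}"
    show "continuous (at x within {0..<1}) f"
    proof (cases "x = 0")
      case True
      have "at 0 within {0..<1} \<le> at_right (0::real)"
        unfolding at_within_def by (intro inf_mono) auto
      then show ?thesis
        using right_cont unfolding True continuous_within by (rule tendsto_mono)
    next
      case False
      then show ?thesis
        using deriv[of x] x by (auto intro: continuous_at_imp_continuous_at_within DERIV_isCont)
    qed
  qed
  have bound: "\<bar>f x\<bar> \<le> C" if "0 \<le> x" "x < 1" for x
  proof (cases "x = 0")
    case True
    have "((\<lambda>t. \<bar>f t\<bar>) \<longlongrightarrow> \<bar>f 0\<bar>) (at_right 0)"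
      using right_cont unfolding continuous_within by (rule tendsto_rabs)
    moreover have "\<forall>\<^sub>F t in at_right (0::real). \<bar>f t\<bar> \<le> C"
      unfolding eventually_at_right_field
      by (intro exI[of _ 1]) (auto intro!: less_imp_le C1_norm_bounds(1)[OF C1_bound])
    ultimately show ?thesis
      unfolding True by (intro tendsto_upperbound[of _ "\<bar>f 0\<bar>" "at_right 0"]) auto
  qed (use C1_norm_bounds(1)[OF C1_bound, of x] that in auto)
  have mvt: "\<exists>z. 0 < z \<and> z < 1 \<and> f y - f x = (y - x) * deriv f z" if "0 \<le> x" "x < y" "y < 1" for x y
  proof -
    have "continuous_on {x..y} f" by (rule continuous_on_subset[OF cont]) (use that in auto)
    moreover have "f differentiable (at z)" if "x < z" "z < y" for z
      using deriv[of z] that \<open>0 \<le> x\<close> \<open>y < 1\<close> by (auto simp: real_differentiable_def)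
    ultimately obtain l z where z: "x < z" "z < y" "(f has_real_derivative l) (at z)" "f y - f x = (y - x) * l"
      using MVT[OF \<open>x < y\<close>] by blast
    then show ?thesis using that by (intro exI[of _ z]) (auto dest: DERIV_imp_deriv)
  qed
  have incr: "c * \<bar>x - y\<bar> \<le> \<bar>f x - f y\<bar> \<and> \<bar>f x - f y\<bar> \<le> C * \<bar>x - y\<bar>"
    if xy: "0 \<le> x" "x < 1" "0 \<le> y" "y < 1" for x y
  proof -
    have *: "c * \<bar>x - y\<bar> \<le> \<bar>f x - f y\<bar> \<and> \<bar>f x - f y\<bar> \<le> C * \<bar>x - y\<bar>"
      if "0 \<le> x" "x < y" "y < 1" for x y
    proof -
      from mvt[OF that] obtain z where z: "0 < z" "z < 1" "f y - f x = (y - x) * deriv f z" by blast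
      have "\<bar>f x - f y\<bar> = \<bar>deriv f z\<bar> * \<bar>x - y\<bar>"
        using z(3) by (metis abs_minus_commute abs_mult mult.commute)
      then show ?thesis
        using lower[OF z(1,2)] C1_norm_bounds(2)[OF C1_bound, of z] z by (auto intro!: mult_right_mono)
    qed
    consider "x < y" | "y < x" | "x = y" by linarith
    then show ?thesis
      using *[of x y] *[of y x] xy by cases (auto simp: abs_minus_commute)
  qed
  have meas: "f \<in> borel_measurable borel"
  proof -
    have [measurable]: "(\<lambda>x. indicator {0..<1} x *\<^sub>R f x) \<in> borel_measurable borel"
      by (rule borel_measurable_continuous_on_indicator[OF _ cont]) simp
    have [measurable]: "(frac :: real \<Rightarrow> real) \<in> borel_measurable borel"
      unfolding frac_def by measurable
    have "(\<lambda>x. indicator {0..<1} (frac x) *\<^sub>R f (frac x)) \<in> borel_measurable borel"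
      by measurable
    also have "(\<lambda>x. indicator {0..<1} (frac x) *\<^sub>R f (frac x)) = f"
      using periodic_frac[of f, OF torus] by (auto simp: frac_lt_1)
    finally show ?thesis .
  qed
  \<comment> \<open>The sum dominates each of the quantities that \<open>X\<close> has to dominate.\<close>
  define X where "X = 2 + 2 / C + 6 * C + 24 * C / c + 2 ^ 102 / c"
  have pos: "0 \<le> 2 / C" "0 \<le> 6 * C" "0 \<le> 24 * C / c" "0 \<le> 2 ^ 102 / c"
    using c_pos C_pos by simp_all
  have X: "2 \<le> X" "2 / C \<le> X" "6 * C \<le> X" "24 * C / c \<le> X" "2 ^ 102 / c \<le> X"
    unfolding X_def using pos by linarith+
  show ?thesis
  proof (intro exI[of _ "X ^ 30"] conjI allI impI)
    show "0 < X ^ 30" using X(1) by simp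
    fix lam assume lam: "X ^ 30 < lam"
    interpret steep_potential f c C X lam
      by unfold_locales (use meas bound incr c_pos C_pos X lam in auto)
    have "doubling_schroedinger f lam x = jacobi (pot x)" for x
      by (intro ext) (simp add: doubling_schroedinger_def jacobi_def pot_def)
    then have "AE x in lborel. x \<in> {0..<1} \<longrightarrow> anderson_localization (doubling_schroedinger f lam x)"
      using AE_localization by simp
    then have "AE x in lebesgue. x \<in> {0..<1} \<longrightarrow> anderson_localization (doubling_schroedinger f lam x)"
      by (rule AE_completion)
    then show "AE x in lebesgue_on {0..<1}. anderson_localization (doubling_schroedinger f lam x)"
      by (subst AE_restrict_space_iff) auto
  qed
qed

end
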